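(* Let $0<\kappa<1$ and $p_-=\frac{2}{1+\kappa}$. There is a Borel function $\widetilde a$ on $\mathcal Q=(0,1)\times\mathbb R$, satisfying $\kappa\le\widetilde a\le\kappa^{-1}$, such that both of the following hold. (1) There is no constant $N$ such that, for every $f\in L_2(\mathcal Q)\cap L_{p_-}(\mathcal Q)$, the $W^{1,2}_2(\mathcal Q)$ solution $u$ of $$u_t-\widetilde a u_{xx}=f\ \text{ in }\mathcal Q,\qquad u(0,\cdot)=0,$$ satisfies $$\|u_t\|_{L_{p_-}(\mathcal Q)}+\|u_{xx}\|_{L_{p_-}(\mathcal Q)}\le N\|f\|_{L_{p_-}(\mathcal Q)}.$$ (2) There is no constant $N$ such that, for every $f\in L_2(\mathcal Q)\cap L_{p_-}(\mathcal Q)$, the weak solution $v$ of $$v_t-(\widetilde a v_x)_x=f_x\ \text{ in }\mathcal Q,\qquad v(0,\cdot)=0,$$ satisfies $$\|v_x\|_{L_{p_-}(\mathcal Q)}\le N\|f\|_{L_{p_-}(\mathcal Q)}.$$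
   Context: Points are written $(t,x)$ with $t$ time and $x$ space. $W^{1,2}_2(\mathcal Q)=\{u:u,u_x,u_t,u_{xx}\in L_2(\mathcal Q)\}$ (weak derivatives). For every $f\in L_2(\mathcal Q)$ the problem in (1) has a unique solution in $W^{1,2}_2(\mathcal Q)$ and the problem in (2) has a unique weak (energy) solution in $\mathcal H^1_2(\mathcal Q)=\{v:v,v_x,(1-\partial_{xx})^{-1/2}v_t\in L_2(\mathcal Q)\}$; these are the solutions referred to. Weak solution in (2) means $\int_{\mathcal Q}(v\varphi_t-\widetilde a v_x\varphi_x)\,dx\,dt=\int_{\mathcal Q}f\varphi_x\,dx\,dt$ for all $\varphi\in C_c^\infty(\overline{\mathcal Q})$ with $\varphi(1,\cdot)=0$. The $L_{p_-}$ norm of a function not in $L_{p_-}$ is $+\infty$. *)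

theory Defs
  imports "HOL-Analysis.Analysis"
begin

section \<open>Lebesgue spaces and the domain\<close>

text \<open>Functions are represented by Borel functions (w.r.t. \<open>lborel\<close>); every Lebesgue class has
  such a representative.  The norm of a function that is not in \<open>L\<^sub>p\<close> is infinite.\<close>

definition Lp_space :: "real \<Rightarrow> 'a measure \<Rightarrow> ('a \<Rightarrow> real) set" where
  "Lp_space p M = {f \<in> borel_measurable M. (\<integral>\<^sup>+ z. ennreal (\<bar>f z\<bar> powr p) \<partial>M) < \<infinity>}"

definition Lp_norm :: "real \<Rightarrow> 'a measure \<Rightarrow> ('a \<Rightarrow> real) \<Rightarrow> ennreal" where
  "Lp_norm p M f =
    (if f \<in> Lp_space p M
     then ennreal (enn2real (\<integral>\<^sup>+ z. ennreal (\<bar>f z\<bar> powr p) \<partial>M) powr (1 / p))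
     else \<infinity>)"

text \<open>Points are pairs \<open>(t, x)\<close>, time first.\<close>

definition Q :: "(real \<times> real) set" where
  "Q = {0<..<1} \<times> UNIV"

definition MQ :: "(real \<times> real) measure" where
  "MQ = restrict_space lborel Q"


section \<open>Test functions\<close>

definition dt :: "(real \<times> real \<Rightarrow> real) \<Rightarrow> real \<times> real \<Rightarrow> real" where
  "dt \<phi> = (\<lambda>(t, x). deriv (\<lambda>s. \<phi> (s, x)) t)"

definition dx :: "(real \<times> real \<Rightarrow> real) \<Rightarrow> real \<times> real \<Rightarrow> real" where
  "dx \<phi> = (\<lambda>(t, x). deriv (\<lambda>y. \<phi> (t, y)) x)"

primrec Ck :: "nat \<Rightarrow> (real \<times> real \<Rightarrow> real) \<Rightarrow> bool" where
  "Ck 0 \<phi> \<longleftrightarrow> continuous_on UNIV \<phi>"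
| "Ck (Suc k) \<phi> \<longleftrightarrow> (\<forall>z. \<phi> differentiable (at z)) \<and> Ck k (dt \<phi>) \<and> Ck k (dx \<phi>)"

definition supp :: "(real \<times> real \<Rightarrow> real) \<Rightarrow> (real \<times> real) set" where
  "supp \<phi> = closure {z. \<phi> z \<noteq> 0}"

text \<open>\<open>C\<^sub>c\<^sup>\<infinity>\<close> of the plane.  Its restrictions to the closed strip \<open>[0,1] \<times> \<real>\<close> are the elements of
  \<open>C\<^sub>c\<^sup>\<infinity>\<close> of the closure of \<open>Q\<close>.\<close>

definition test_plane :: "(real \<times> real \<Rightarrow> real) set" where
  "test_plane = {\<phi>. (\<forall>k. Ck k \<phi>) \<and> compact (supp \<phi>)}"

definition test_Q :: "(real \<times> real \<Rightarrow> real) set" where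
  "test_Q = {\<phi> \<in> test_plane. supp \<phi> \<subseteq> Q}"


section \<open>Weak derivatives on \<open>Q\<close>\<close>

definition locally_integrable_Q :: "(real \<times> real \<Rightarrow> real) \<Rightarrow> bool" where
  "locally_integrable_Q u \<longleftrightarrow> (\<forall>K. compact K \<and> K \<subseteq> Q \<longrightarrow> set_integrable lborel K u)"

definition weak_dt :: "(real \<times> real \<Rightarrow> real) \<Rightarrow> (real \<times> real \<Rightarrow> real) \<Rightarrow> bool" where
  "weak_dt u g \<longleftrightarrow> locally_integrable_Q u \<and> locally_integrable_Q g \<and>
     (\<forall>\<phi>\<in>test_Q. (LINT z|MQ. u z * dt \<phi> z) = - (LINT z|MQ. g z * \<phi> z))"

definition weak_dx :: "(real \<times> real \<Rightarrow> real) \<Rightarrow> (real \<times> real \<Rightarrow> real) \<Rightarrow> bool" where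
  "weak_dx u g \<longleftrightarrow> locally_integrable_Q u \<and> locally_integrable_Q g \<and>
     (\<forall>\<phi>\<in>test_Q. (LINT z|MQ. u z * dx \<phi> z) = - (LINT z|MQ. g z * \<phi> z))"


section \<open>Strong solutions of \<open>u\<^sub>t - a u\<^sub>x\<^sub>x = f\<close>, \<open>u(0,\<cdot>) = 0\<close>\<close>

text \<open>\<open>u\<close> belongs to \<open>W\<^sup>1\<^sup>,\<^sup>2\<^sub>2(Q)\<close> and its weak derivatives, unique up to null sets, are
  \<open>ut\<close>, \<open>ux\<close>, \<open>uxx\<close>.\<close>

definition W12_2 ::
  "(real \<times> real \<Rightarrow> real) \<Rightarrow> (real \<times> real \<Rightarrow> real) \<Rightarrow> (real \<times> real \<Rightarrow> real) \<Rightarrow>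
   (real \<times> real \<Rightarrow> real) \<Rightarrow> bool" where
  "W12_2 u ut ux uxx \<longleftrightarrow>
     u \<in> Lp_space 2 MQ \<and> ut \<in> Lp_space 2 MQ \<and> ux \<in> Lp_space 2 MQ \<and> uxx \<in> Lp_space 2 MQ \<and>
     weak_dt u ut \<and> weak_dx u ux \<and> weak_dx ux uxx"

text \<open>The initial value is that of the representative of \<open>u\<close> in \<open>C([0,1]; L\<^sub>2(\<real>))\<close>.\<close>

definition initial_value :: "(real \<times> real \<Rightarrow> real) \<Rightarrow> (real \<Rightarrow> real) \<Rightarrow> bool" where
  "initial_value u g \<longleftrightarrow>
     (\<exists>U :: real \<Rightarrow> real \<Rightarrow> real.
        (\<forall>t\<in>{0..1}. U t \<in> Lp_space 2 lborel) \<and>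
        (\<forall>t\<in>{0..1}. ((\<lambda>s. Lp_norm 2 lborel (\<lambda>x. U s x - U t x)) \<longlongrightarrow> 0) (at t within {0..1})) \<and>
        (AE t in lborel. t \<in> {0<..<1} \<longrightarrow> (AE x in lborel. U t x = u (t, x))) \<and>
        (AE x in lborel. U 0 x = g x))"

definition strong_solution ::
  "(real \<times> real \<Rightarrow> real) \<Rightarrow> (real \<times> real \<Rightarrow> real) \<Rightarrow> (real \<times> real \<Rightarrow> real) \<Rightarrow>
   (real \<times> real \<Rightarrow> real) \<Rightarrow> (real \<times> real \<Rightarrow> real) \<Rightarrow> (real \<times> real \<Rightarrow> real) \<Rightarrow> bool" where
  "strong_solution a f u ut ux uxx \<longleftrightarrow>
     W12_2 u ut ux uxx \<and>
     (AE z in MQ. ut z - a z * uxx z = f z) \<and>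
     initial_value u (\<lambda>x. 0)"


section \<open>Weak solutions of \<open>v\<^sub>t - (a v\<^sub>x)\<^sub>x = f\<^sub>x\<close>, \<open>v(0,\<cdot>) = 0\<close>\<close>

text \<open>\<open>(1 - \<partial>\<^sub>x\<^sub>x)\<^sup>-\<^sup>1\<^sup>/\<^sup>2\<close> on test functions, as the Fourier multiplier \<open>(1 + \<xi>\<^sup>2)\<^sup>-\<^sup>1\<^sup>/\<^sup>2\<close> in \<open>x\<close>.
  The multiplier is even, so the result is real for real \<open>\<phi>\<close> and \<open>Re\<close> only adjusts the type.\<close>

definition fourier_x :: "(real \<times> real \<Rightarrow> real) \<Rightarrow> real \<Rightarrow> real \<Rightarrow> complex" where
  "fourier_x \<phi> t \<xi> = (LINT y|lborel. cis (- (\<xi> * y)) * complex_of_real (\<phi> (t, y)))"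

definition bessel_x :: "(real \<times> real \<Rightarrow> real) \<Rightarrow> real \<times> real \<Rightarrow> real" where
  "bessel_x \<phi> = (\<lambda>(t, x). Re ((1 / (2 * pi)) *
     (LINT \<xi>|lborel. cis (\<xi> * x) * (complex_of_real (1 / sqrt (1 + \<xi>\<^sup>2)) * fourier_x \<phi> t \<xi>))))"

text \<open>\<open>g = (1 - \<partial>\<^sub>x\<^sub>x)\<^sup>-\<^sup>1\<^sup>/\<^sup>2 v\<^sub>t\<close> in the sense of distributions: the operator is symmetric and
  commutes with \<open>\<partial>\<^sub>t\<close>, so the left-hand side pairs with \<open>\<phi>\<close> as
  \<open>\<langle>v\<^sub>t, (1 - \<partial>\<^sub>x\<^sub>x)\<^sup>-\<^sup>1\<^sup>/\<^sup>2 \<phi>\<rangle> = - \<integral> v (1 - \<partial>\<^sub>x\<^sub>x)\<^sup>-\<^sup>1\<^sup>/\<^sup>2 \<phi>\<^sub>t\<close>.\<close>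

definition bessel_weak_dt :: "(real \<times> real \<Rightarrow> real) \<Rightarrow> (real \<times> real \<Rightarrow> real) \<Rightarrow> bool" where
  "bessel_weak_dt v g \<longleftrightarrow>
     (\<forall>\<phi>\<in>test_Q. - (LINT z|MQ. v z * bessel_x (dt \<phi>) z) = (LINT z|MQ. g z * \<phi> z))"

definition H1_2 :: "(real \<times> real \<Rightarrow> real) \<Rightarrow> (real \<times> real \<Rightarrow> real) \<Rightarrow> bool" where
  "H1_2 v vx \<longleftrightarrow>
     v \<in> Lp_space 2 MQ \<and> vx \<in> Lp_space 2 MQ \<and> weak_dx v vx \<and>
     (\<exists>g\<in>Lp_space 2 MQ. bessel_weak_dt v g)"

text \<open>The initial condition is encoded by the test functions not vanishing at \<open>t = 0\<close>.\<close>

definition weak_solution ::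
  "(real \<times> real \<Rightarrow> real) \<Rightarrow> (real \<times> real \<Rightarrow> real) \<Rightarrow> (real \<times> real \<Rightarrow> real) \<Rightarrow>
   (real \<times> real \<Rightarrow> real) \<Rightarrow> bool" where
  "weak_solution a f v vx \<longleftrightarrow>
     H1_2 v vx \<and>
     (\<forall>\<phi>\<in>test_plane. (\<forall>x. \<phi> (1, x) = 0) \<longrightarrow>
        (LINT z|MQ. v z * dt \<phi> z - a z * vx z * dx \<phi> z) = (LINT z|MQ. f z * dx \<phi> z))"

end

theory Submission
  imports Defs "HOL-Probability.Probability"
begin

text \<open>If \<open>u\<close> is smooth with compact support in \<open>Q\<close> and \<open>f = u\<^sub>t - a u\<^sub>x\<^sub>x\<close>, then \<open>v = u\<^sub>x\<close> solves the
  divergence form problem with the same \<open>f\<close>, so both claims follow once \<open>\<parallel>u\<^sub>x\<^sub>x\<parallel>\<^sub>p / \<parallel>f\<parallel>\<^sub>p\<close> is unbounded.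
  For the best \<open>a\<close>, \<open>\<bar>f\<bar>\<close> is the distance of \<open>u\<^sub>t\<close> to the interval between \<open>\<kappa> u\<^sub>x\<^sub>x\<close> and \<open>u\<^sub>x\<^sub>x / \<kappa>\<close>, and the
  question becomes one about the attainable distributions of the pair \<open>(u\<^sub>t, u\<^sub>x\<^sub>x)\<close>.  Rapid oscillation
  in \<open>t\<close> changes \<open>u\<^sub>t\<close> only and rapid oscillation in \<open>x\<close> changes \<open>u\<^sub>x\<^sub>x\<close> only, so the optimal mean energy
  is separately convex.  A staircase running along \<open>(s, -s)\<close> and dropping mass into the cone where
  \<open>f = 0\<close> loses mass at the rate \<open>s\<^sup>-\<^sup>p\<close> with \<open>p = 2 / (1 + \<kappa>)\<close>, which makes the energy
  \<open>M \<bar>f\<bar>\<^sup>p - \<bar>u\<^sub>x\<^sub>x\<bar>\<^sup>p\<close> unbounded below for every \<open>M\<close>.  One such \<open>u\<close> for each \<open>M\<close> is placed in disjoint strips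
  of \<open>Q\<close>.\<close>

section \<open>Calculus of functions of two variables\<close>

text \<open>The exponent is borderline. For a free exponent the energy factor of a step of size
  \<open>\<delta>\<close> is \<open>1 + (p - 2 / (1 + \<kappa>)) \<delta>\<close> to first order;
  when this coefficient is zero, every dyadic range of \<open>s\<close> contributes a comparable
  amount and the total diverges only logarithmically. No sum over steps is formed: if the infimum of
  the energies attainable at \<open>(1, -1)\<close> were finite, homogeneity would determine it at
  \<open>(1 + \<delta>, -(1 + \<delta>))\<close>, and one small step would push it below itself.
  Oscillations can be nested and cut off because the rescaling \<open>u (n^2 t, n x) / n^2\<close>
  preserves the sizes of \<open>u_t\<close> and \<open>u_xx\<close> while \<open>u\<close> and
  \<open>u_x\<close> tend to zero. Compact support forces the pair to have mean
  \<open>(0, 0)\<close>, so two further splittings must link the origin to the staircase; their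
  fixed cost is outweighed by an arbitrarily negative energy. A separate obstacle is that
  \<open>v = u_x\<close> must lie in the energy space, where
  \<open>(1 - \<partial>_xx)^(-1/2)\<close> is given by a Fourier integral. It is rewritten as an
  average of translations, which is easily transposed onto \<open>v_t\<close>.\<close>

lemma has_field_derivative_fst:
  fixes u :: "real \<times> real \<Rightarrow> real"
  assumes "(u has_derivative D) (at (t, x))"
  shows "((\<lambda>s. u (s, x)) has_field_derivative D (1, 0)) (at t)"
proof -
  have "((\<lambda>s::real. (s, x)) has_derivative (\<lambda>h. (h, 0))) (at t)"
    by (auto intro!: derivative_eq_intros)
  from diff_chain_at[OF this, of u D] assms
  have *: "((\<lambda>s. u (s, x)) has_derivative (\<lambda>h. D (h, 0))) (at t)"
    by (simp add: o_def)
  moreover have "(\<lambda>h. D (h, 0)) = (*) (D (1, 0))"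
  proof
    fix h :: real
    have "D (h *\<^sub>R (1, 0)) = h *\<^sub>R D (1, 0)"
      using assms by (intro linear_scale has_derivative_linear) simp
    then show "D (h, 0) = D (1, 0) * h" by simp
  qed
  ultimately show ?thesis by (simp add: has_field_derivative_def)
qed

lemma has_field_derivative_snd:
  fixes u :: "real \<times> real \<Rightarrow> real"
  assumes "(u has_derivative D) (at (t, x))"
  shows "((\<lambda>y. u (t, y)) has_field_derivative D (0, 1)) (at x)"
proof -
  have "((\<lambda>y::real. (t, y)) has_derivative (\<lambda>h. (0, h))) (at x)"
    by (auto intro!: derivative_eq_intros)
  from diff_chain_at[OF this, of u D] assms
  have *: "((\<lambda>y. u (t, y)) has_derivative (\<lambda>h. D (0, h))) (at x)"
    by (simp add: o_def)
  moreover have "(\<lambda>h. D (0, h)) = (*) (D (0, 1))"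
  proof
    fix h :: real
    have "D (h *\<^sub>R (0, 1)) = h *\<^sub>R D (0, 1)"
      using assms by (intro linear_scale has_derivative_linear) simp
    then show "D (0, h) = D (0, 1) * h" by simp
  qed
  ultimately show ?thesis by (simp add: has_field_derivative_def)
qed

lemma dt_eqI:
  "((\<lambda>s. u (s, snd z)) has_field_derivative d) (at (fst z)) \<Longrightarrow> dt u z = d"
  by (simp add: dt_def case_prod_beta DERIV_imp_deriv)

lemma dx_eqI:
  "((\<lambda>y. u (fst z, y)) has_field_derivative d) (at (snd z)) \<Longrightarrow> dx u z = d"
  by (simp add: dx_def case_prod_beta DERIV_imp_deriv)

lemma dt_DERIV:
  assumes "\<And>z. u differentiable (at z)"
  shows "((\<lambda>s. u (s, x)) has_field_derivative dt u (t, x)) (at t)"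
  using assms has_field_derivative_fst[of u _ t x] dt_eqI[of u "(t,x)"]
  unfolding differentiable_def by (metis fst_conv snd_conv)

lemma dx_DERIV:
  assumes "\<And>z. u differentiable (at z)"
  shows "((\<lambda>y. u (t, y)) has_field_derivative dx u (t, x)) (at x)"
  using assms has_field_derivative_snd[of u _ t x] dx_eqI[of u "(t,x)"]
  unfolding differentiable_def by (metis fst_conv snd_conv)

lemma Ck_differentiable: "Ck (Suc k) u \<Longrightarrow> u differentiable (at z)"
  by (cases z) simp

lemma Ck_SucD: "Ck (Suc k) u \<Longrightarrow> Ck k u"
proof (induction k arbitrary: u)
  case 0
  then show ?case
    by (auto intro!: differentiable_imp_continuous_on simp: differentiable_on_def)
next
  case (Suc k)
  from Suc.prems have "Ck (Suc k) (dt u)" "Ck (Suc k) (dx u)" "\<forall>z. u differentiable (at z)"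
    by simp_all
  then have "Ck k (dt u)" "Ck k (dx u)" "\<forall>z. u differentiable (at z)"
    by (blast intro: Suc.IH)+
  then show ?case by simp
qed

lemma Ck_continuous: "Ck k u \<Longrightarrow> continuous_on UNIV u"
  by (induction k) (simp, blast dest: Ck_SucD)

lemma Ck_const [simp]: "Ck k (\<lambda>z. c)"
proof (induction k arbitrary: c)
  case (Suc k)
  have "dt (\<lambda>z. c) = (\<lambda>z. 0)" "dx (\<lambda>z. c) = (\<lambda>z. 0)"
    by (auto simp: dt_def dx_def fun_eq_iff)
  then show ?case using Suc by simp
qed simp

lemma dt_add:
  assumes "\<And>z. u differentiable (at z)" "\<And>z. v differentiable (at z)"
  shows "dt (\<lambda>z. u z + v z) = (\<lambda>z. dt u z + dt v z)"
proof (rule ext, rule dt_eqI)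
  fix z :: "real \<times> real"
  show "((\<lambda>s. u (s, snd z) + v (s, snd z)) has_field_derivative dt u z + dt v z) (at (fst z))"
    using dt_DERIV[OF assms(1), of "snd z" "fst z"] dt_DERIV[OF assms(2), of "snd z" "fst z"]
    by (auto intro!: derivative_eq_intros)
qed

lemma dx_add:
  assumes "\<And>z. u differentiable (at z)" "\<And>z. v differentiable (at z)"
  shows "dx (\<lambda>z. u z + v z) = (\<lambda>z. dx u z + dx v z)"
proof (rule ext, rule dx_eqI)
  fix z :: "real \<times> real"
  show "((\<lambda>s. u (fst z, s) + v (fst z, s)) has_field_derivative dx u z + dx v z) (at (snd z))"
    using dx_DERIV[OF assms(1), of "fst z" "snd z"] dx_DERIV[OF assms(2), of "fst z" "snd z"]
    by (auto intro!: derivative_eq_intros)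
qed

lemma dt_mult:
  assumes "\<And>z. u differentiable (at z)" "\<And>z. v differentiable (at z)"
  shows "dt (\<lambda>z. u z * v z) = (\<lambda>z. dt u z * v z + u z * dt v z)"
proof (rule ext, rule dt_eqI)
  fix z :: "real \<times> real"
  show "((\<lambda>s. u (s, snd z) * v (s, snd z)) has_field_derivative dt u z * v z + u z * dt v z) (at (fst z))"
    using dt_DERIV[OF assms(1), of "snd z" "fst z"] dt_DERIV[OF assms(2), of "snd z" "fst z"]
    by (auto intro!: derivative_eq_intros)
qed

lemma dx_mult:
  assumes "\<And>z. u differentiable (at z)" "\<And>z. v differentiable (at z)"
  shows "dx (\<lambda>z. u z * v z) = (\<lambda>z. dx u z * v z + u z * dx v z)"
proof (rule ext, rule dx_eqI)
  fix z :: "real \<times> real"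
  show "((\<lambda>s. u (fst z, s) * v (fst z, s)) has_field_derivative dx u z * v z + u z * dx v z) (at (snd z))"
    using dx_DERIV[OF assms(1), of "fst z" "snd z"] dx_DERIV[OF assms(2), of "fst z" "snd z"]
    by (auto intro!: derivative_eq_intros)
qed

lemma Ck_add: "Ck k u \<Longrightarrow> Ck k v \<Longrightarrow> Ck k (\<lambda>z. u z + v z)"
proof (induction k arbitrary: u v)
  case 0
  then show ?case by (auto intro: continuous_intros)
next
  case (Suc k)
  then have uv: "\<And>z. u differentiable (at z)" "\<And>z. v differentiable (at z)"
    by (blast intro: Ck_differentiable)+
  show ?case
    unfolding Ck.simps dt_add[OF uv] dx_add[OF uv]
    using Suc.prems by (simp add: Suc.IH differentiable_add uv)
qed

lemma Ck_mult: "Ck k u \<Longrightarrow> Ck k v \<Longrightarrow> Ck k (\<lambda>z. u z * v z)"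
proof (induction k arbitrary: u v)
  case 0
  then show ?case by (auto intro: continuous_intros)
next
  case (Suc k)
  note uv = Ck_SucD[OF Suc.prems(1)] Ck_SucD[OF Suc.prems(2)]
  have d: "\<And>z. u differentiable (at z)" "\<And>z. v differentiable (at z)"
    using Suc.prems by (blast intro: Ck_differentiable)+
  show ?case
    unfolding Ck.simps dt_mult[OF d] dx_mult[OF d]
    using Suc.prems by (auto intro!: Ck_add Suc.IH uv differentiable_mult d)
qed

lemma affine_has_derivative:
  "((\<lambda>z::real\<times>real. (a * fst z + b, c * snd z + d)) has_derivative (\<lambda>h. (a * fst h, c * snd h))) (at z)"
  by (auto intro!: derivative_eq_intros)

lemma differentiable_affine:
  assumes "\<And>z. u differentiable (at (z::real\<times>real))"
  shows "(\<lambda>z. u (a * fst z + b, c * snd z + d)) differentiable (at z)"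
proof -
  obtain D where "(u has_derivative D) (at (a * fst z + b, c * snd z + d))"
    using assms unfolding differentiable_def by blast
  from diff_chain_at[OF affine_has_derivative this] show ?thesis
    unfolding differentiable_def o_def by blast
qed

lemma dt_affine:
  assumes "\<And>z. u differentiable (at z)"
  shows "dt (\<lambda>z. u (a * fst z + b, c * snd z + d)) = (\<lambda>z. a * dt u (a * fst z + b, c * snd z + d))"
proof (rule ext, rule dt_eqI)
  fix z :: "real \<times> real"
  have "((\<lambda>s. a * s + b) has_field_derivative a) (at (fst z))"
    by (auto intro!: derivative_eq_intros)
  from DERIV_chain2[OF dt_DERIV[OF assms, of "c * snd z + d"] this]
  show "((\<lambda>s. u (a * fst (s, snd z) + b, c * snd (s, snd z) + d)) has_field_derivative
       a * dt u (a * fst z + b, c * snd z + d)) (at (fst z))" by (simp add: mult.commute)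
qed

lemma dx_affine:
  assumes "\<And>z. u differentiable (at z)"
  shows "dx (\<lambda>z. u (a * fst z + b, c * snd z + d)) = (\<lambda>z. c * dx u (a * fst z + b, c * snd z + d))"
proof (rule ext, rule dx_eqI)
  fix z :: "real \<times> real"
  have "((\<lambda>s. c * s + d) has_field_derivative c) (at (snd z))"
    by (auto intro!: derivative_eq_intros)
  from DERIV_chain2[OF dx_DERIV[OF assms, of "a * fst z + b"] this]
  show "((\<lambda>s. u (a * fst (fst z, s) + b, c * snd (fst z, s) + d)) has_field_derivative
       c * dx u (a * fst z + b, c * snd z + d)) (at (snd z))" by (simp add: mult.commute)
qed

lemma Ck_affine: "Ck k u \<Longrightarrow> Ck k (\<lambda>z. u (a * fst z + b, c * snd z + d))"
proof (induction k arbitrary: u)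
  case 0
  then show ?case
    by (auto intro!: continuous_intros continuous_on_compose2[of UNIV u])
next
  case (Suc k)
  then have d: "\<And>z. u differentiable (at z)"
    by (blast intro: Ck_differentiable)
  show ?case
    unfolding Ck.simps dt_affine[OF d] dx_affine[OF d]
    using Suc.prems by (simp add: Ck_mult Suc.IH differentiable_affine[OF d])
qed

section \<open>Smooth functions of one variable and their lifts to the plane\<close>

primrec C1 :: "nat \<Rightarrow> (real \<Rightarrow> real) \<Rightarrow> bool" where
  "C1 0 g \<longleftrightarrow> continuous_on UNIV g"
| "C1 (Suc k) g \<longleftrightarrow> (\<forall>x. g differentiable (at x)) \<and> C1 k (deriv g)"

lemma C1_SucI:
  assumes "\<And>x. (g has_field_derivative g' x) (at x)" "C1 k g'"
  shows "C1 (Suc k) g"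
proof -
  have "deriv g = g'" using assms(1) by (auto intro: DERIV_imp_deriv)
  then show ?thesis using assms by (auto simp: real_differentiable_def)
qed

lemma C1_deriv: "C1 (Suc k) g \<Longrightarrow> (g has_field_derivative deriv g x) (at x)"
  using DERIV_deriv_iff_real_differentiable by auto

lemma C1_SucD: "C1 (Suc k) g \<Longrightarrow> C1 k g"
proof (induction k arbitrary: g)
  case 0
  then show ?case
    by (auto intro!: differentiable_imp_continuous_on simp: differentiable_on_def)
next
  case (Suc k)
  from Suc.prems have "C1 (Suc k) (deriv g)" "\<forall>z. g differentiable (at z)"
    by simp_all
  then have "C1 k (deriv g)" "\<forall>z. g differentiable (at z)"
    by (blast intro: Suc.IH)+
  then show ?case by simp
qed

lemma C1_continuous: "C1 k g \<Longrightarrow> continuous_on UNIV g"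
  by (induction k) (simp, blast dest: C1_SucD)

lemma C1_const [simp]: "C1 k (\<lambda>z. c)"
proof (induction k arbitrary: c)
  case (Suc k)
  show ?case by (rule C1_SucI[where g' = "\<lambda>x. 0"]) (use Suc in auto)
qed simp

lemma C1_add: "C1 k f \<Longrightarrow> C1 k g \<Longrightarrow> C1 k (\<lambda>x. f x + g x)"
proof (induction k arbitrary: f g)
  case 0
  then show ?case by (auto intro: continuous_intros)
next
  case (Suc k)
  show ?case
    by (rule C1_SucI[where g' = "\<lambda>x. deriv f x + deriv g x"])
       (use Suc in \<open>auto intro!: derivative_eq_intros C1_deriv\<close>)
qed

lemma C1_mult: "C1 k f \<Longrightarrow> C1 k g \<Longrightarrow> C1 k (\<lambda>x. f x * g x)"
proof (induction k arbitrary: f g)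
  case 0
  then show ?case by (auto intro: continuous_intros)
next
  case (Suc k)
  show ?case
    by (rule C1_SucI[where g' = "\<lambda>x. deriv f x * g x + f x * deriv g x"])
       (use Suc.prems C1_SucD[OF Suc.prems(1)] C1_SucD[OF Suc.prems(2)]
         in \<open>auto intro!: derivative_eq_intros C1_deriv C1_add Suc.IH\<close>)
qed

lemma C1_compose: "C1 k f \<Longrightarrow> C1 k g \<Longrightarrow> C1 k (\<lambda>x. f (g x))"
proof (induction k arbitrary: f g)
  case 0
  then show ?case by (auto intro: continuous_on_compose2[of UNIV f])
next
  case (Suc k)
  show ?case
    by (rule C1_SucI[where g' = "\<lambda>x. deriv f (g x) * deriv g x"])
       (use Suc.prems C1_SucD[OF Suc.prems(2)] in
         \<open>auto intro: DERIV_chain2[OF C1_deriv[OF Suc.prems(1)] C1_deriv[OF Suc.prems(2)]]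
            C1_mult Suc.IH\<close>)
qed

lemma C1_affine [simp]: "C1 k (\<lambda>x. a * x + b)"
proof (cases k)
  case (Suc j)
  then show ?thesis
    by (simp only:, intro C1_SucI[where g' = "\<lambda>x. a"])
       (auto intro!: derivative_eq_intros)
qed (auto intro!: continuous_intros)

lemma dt_fst:
  assumes "C1 (Suc k) g"
  shows "dt (\<lambda>z. g (fst z)) = (\<lambda>z. deriv g (fst z))" "dx (\<lambda>z. g (fst z)) = (\<lambda>z. 0)"
  using assms by (auto simp: dt_def dx_def)

lemma dt_snd:
  assumes "C1 (Suc k) g"
  shows "dt (\<lambda>z. g (snd z)) = (\<lambda>z. 0)" "dx (\<lambda>z. g (snd z)) = (\<lambda>z. deriv g (snd z))"
  using assms by (auto simp: dt_def dx_def)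

lemma Ck_fst: "C1 k g \<Longrightarrow> Ck k (\<lambda>z. g (fst z))"
proof (induction k arbitrary: g)
  case 0
  then show ?case by (auto intro!: continuous_intros continuous_on_compose2[of UNIV g])
next
  case (Suc k)
  have "(\<lambda>z. g (fst z)) differentiable (at z)" for z :: "real \<times> real"
  proof -
    obtain g' where "(g has_derivative g') (at (fst z))"
      using Suc.prems by (auto simp: differentiable_def)
    from diff_chain_at[OF has_derivative_fst[OF has_derivative_ident] this] show ?thesis
      unfolding differentiable_def o_def by blast
  qed
  then show ?case using Suc by (simp add: dt_fst[of k])
qed

lemma Ck_snd: "C1 k g \<Longrightarrow> Ck k (\<lambda>z. g (snd z))"
proof (induction k arbitrary: g)
  case 0
  then show ?case by (auto intro!: continuous_intros continuous_on_compose2[of UNIV g])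
next
  case (Suc k)
  have "(\<lambda>z. g (snd z)) differentiable (at z)" for z :: "real \<times> real"
  proof -
    obtain g' where "(g has_derivative g') (at (snd z))"
      using Suc.prems by (auto simp: differentiable_def)
    from diff_chain_at[OF has_derivative_snd[OF has_derivative_ident] this] show ?thesis
      unfolding differentiable_def o_def by blast
  qed
  then show ?case using Suc by (simp add: dt_snd[of k])
qed

section \<open>Locality of the derivatives\<close>

lemma dt_cong_open:
  assumes "open S" "z \<in> S" "\<And>w. w \<in> S \<Longrightarrow> u w = v w"
  shows "dt u z = dt v z"
proof -
  have "eventually (\<lambda>s. (s, snd z) \<in> S) (nhds (fst z))"
  proof -
    have "open ((\<lambda>s. (s, snd z)) -` S)"
      by (intro open_vimage assms continuous_intros)
    moreover have "fst z \<in> (\<lambda>s. (s, snd z)) -` S" using assms by simp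
    ultimately show ?thesis by (auto simp: eventually_nhds)
  qed
  then have "eventually (\<lambda>s. u (s, snd z) = v (s, snd z)) (nhds (fst z))"
    by eventually_elim (use assms in auto)
  then show ?thesis
    by (simp add: dt_def case_prod_beta deriv_cong_ev)
qed

lemma dx_cong_open:
  assumes "open S" "z \<in> S" "\<And>w. w \<in> S \<Longrightarrow> u w = v w"
  shows "dx u z = dx v z"
proof -
  have "eventually (\<lambda>s. (fst z, s) \<in> S) (nhds (snd z))"
  proof -
    have "open ((\<lambda>s. (fst z, s)) -` S)"
      by (intro open_vimage assms continuous_intros)
    moreover have "snd z \<in> (\<lambda>s. (fst z, s)) -` S" using assms by simp
    ultimately show ?thesis by (auto simp: eventually_nhds)
  qed
  then have "eventually (\<lambda>s. u (fst z, s) = v (fst z, s)) (nhds (snd z))"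
    by eventually_elim (use assms in auto)
  then show ?thesis
    by (simp add: dx_def case_prod_beta deriv_cong_ev)
qed

lemma dxx_cong_open:
  assumes "open S" "z \<in> S" "\<And>w. w \<in> S \<Longrightarrow> u w = v w"
  shows "dx (dx u) z = dx (dx v) z"
  using assms by (intro dx_cong_open[of S]) (auto intro: dx_cong_open[of S])

section \<open>Integration of compactly supported functions\<close>

lemma Ck1_iff: "Ck 1 u \<longleftrightarrow> (\<forall>z. u differentiable (at z)) \<and> continuous_on UNIV (dt u) \<and> continuous_on UNIV (dx u)"
  by (simp only: One_nat_def Ck.simps)

lemma Ck2_iff: "Ck 2 u \<longleftrightarrow> (\<forall>z. u differentiable (at z)) \<and> Ck 1 (dt u) \<and> Ck 1 (dx u)"
  by (simp only: One_nat_def numeral_2_eq_2 Ck.simps)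

lemma Ck1D:
  assumes "Ck 1 u"
  shows "\<And>z. u differentiable (at z)" "continuous_on UNIV u"
    "continuous_on UNIV (dt u)" "continuous_on UNIV (dx u)"
  using assms Ck_continuous[OF assms] unfolding Ck1_iff by blast+

lemma Ck2D:
  assumes "Ck 2 u"
  shows "Ck 1 u" "\<And>z. u differentiable (at z)" "Ck 1 (dt u)" "Ck 1 (dx u)"
  using assms Ck_SucD[of 1 u] unfolding Ck2_iff by (simp_all only: Suc_1 Ck2_iff simp_thms)

text \<open>Differentiate \<open>u (t, x) = u (c, x) + \<integral> u\<^sub>t\<close> under the
  integral sign.\<close>

lemma dt_dx_commute:
  assumes "Ck 2 u"
  shows "dt (dx u) z = dx (dt u) z"
proof -
  obtain t x where z: "z = (t, x)" by (cases z)
  have u: "\<And>z. u differentiable (at z)" "\<And>z. dt u differentiable (at z)"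
      "\<And>z. dx u differentiable (at z)" "continuous_on UNIV (dx (dt u))"
    by (fact Ck2D[OF assms] Ck1D[OF Ck2D(3)[OF assms]] Ck1D[OF Ck2D(4)[OF assms]])+
  \<comment> \<open>The base point lies strictly left of \<open>t\<close>, so \<open>t\<close> is
    interior to \<open>{c..t+1}\<close> and the derivative within that interval is a full
    derivative.\<close>
  define c where "c = t - 1"
  have ct: "continuous_on UNIV (dt u)"
    by (rule Ck1D[OF Ck2D(3)[OF assms]])
  have I: "integral (cbox c s) (\<lambda>r. dt u (r, y)) = u (s, y) - u (c, y)" if "c \<le> s" for s y
  proof -
    have "((\<lambda>s. u (s, y)) has_vector_derivative dt u (r, y)) (at r within {c..s})" for r
      using dt_DERIV[OF u(1), of y r]
      by (simp add: has_real_derivative_iff_has_vector_derivative has_vector_derivative_at_within)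
    from fundamental_theorem_of_calculus[OF that this] show ?thesis
      by (simp add: integral_unique)
  qed
  have D: "dx u (s, x) - dx u (c, x) = integral (cbox c s) (\<lambda>r. dx (dt u) (r, x))"
    if "c \<le> s" for s
  proof -
    have "((\<lambda>y. integral (cbox c s) (\<lambda>r. dt u (r, y))) has_field_derivative
         integral (cbox c s) (\<lambda>r. dx (dt u) (r, x))) (at x within UNIV)"
    proof (rule leibniz_rule_field_derivative)
      show "((\<lambda>x. dt u (t, x)) has_field_derivative dx (dt u) (t, x)) (at x within UNIV)" for x t
        using dx_DERIV[OF u(2)] by simp
      show "(\<lambda>r. dt u (r, x)) integrable_on cbox c s" for x
        by (intro integrable_continuous continuous_on_compose2[OF ct] continuous_intros) auto
      show "continuous_on (UNIV \<times> cbox c s) (\<lambda>(x, t). dx (dt u) (t, x))"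
        unfolding case_prod_beta
        by (intro continuous_on_compose2[OF u(4)] continuous_intros) auto
    qed auto
    moreover have "((\<lambda>y. u (s, y) - u (c, y)) has_field_derivative dx u (s, x) - dx u (c, x)) (at x)"
      by (intro DERIV_diff dx_DERIV u)
    ultimately show ?thesis
      using I[OF that] by (simp add: DERIV_unique)
  qed
  have "((\<lambda>s. integral {c..s} (\<lambda>r. dx (dt u) (r, x))) has_real_derivative dx (dt u) (t, x))
      (at t within {c..t+1})"
    by (rule integral_has_real_derivative)
       (auto intro!: continuous_on_compose2[OF u(4)] continuous_intros simp: c_def)
  then have "((\<lambda>s. integral {c..s} (\<lambda>r. dx (dt u) (r, x))) has_real_derivative dx (dt u) (t, x)) (at t)"
    by (subst (asm) at_within_Icc_at) (auto simp: c_def)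
  then have "((\<lambda>s. dx u (s, x) - dx u (c, x)) has_real_derivative dx (dt u) (t, x)) (at t)"
    by (rule has_field_derivative_transform_within_open[of _ _ _ "{c<..}"])
       (auto simp: D, auto simp: c_def)
  moreover have "((\<lambda>s. dx u (s, x) - dx u (c, x)) has_real_derivative dt (dx u) (t, x)) (at t)"
    using DERIV_diff[OF dt_DERIV[OF u(3)] DERIV_const] by simp
  ultimately show ?thesis
    by (simp add: z DERIV_unique)
qed

text \<open>A norm bound on the nonzero set, in place of compactness of \<open>supp\<close>, passes
  to derivatives, slices and products without closure arguments.\<close>

definition csupp :: "('a::euclidean_space \<Rightarrow> 'b::zero) \<Rightarrow> bool" where
  "csupp u \<longleftrightarrow> (\<exists>R. \<forall>z. u z \<noteq> 0 \<longrightarrow> norm z \<le> R)"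

lemma csupp_mono: "csupp u \<Longrightarrow> (\<And>z. v z \<noteq> 0 \<Longrightarrow> u z \<noteq> 0) \<Longrightarrow> csupp v"
  unfolding csupp_def by metis

lemma compact_supp_csupp: "compact (supp u) \<Longrightarrow> csupp u"
  unfolding csupp_def supp_def
  by (metis (mono_tags, lifting) bounded_iff closure_subset compact_imp_bounded mem_Collect_eq subsetD)

lemma csupp_bounded:
  fixes u :: "'a::euclidean_space \<Rightarrow> 'b::real_normed_vector"
  assumes "continuous_on UNIV u" "csupp u"
  obtains B where "B \<ge> 0" "\<And>z. norm (u z) \<le> B"
proof -
  obtain R where R: "\<And>z. u z \<noteq> 0 \<Longrightarrow> norm z \<le> R" using assms unfolding csupp_def by blast
  have "compact (u ` cball 0 R)"
    by (intro compact_continuous_image continuous_on_subset[OF assms(1)]) auto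
  then obtain B where B: "\<And>z. z \<in> cball 0 R \<Longrightarrow> norm (u z) \<le> B"
    by (force dest!: compact_imp_bounded simp: bounded_iff)
  have "norm (u z) \<le> max B 0" for z
    using B[of z] R[of z] by (cases "u z = 0") auto
  then show ?thesis by (intro that[of "max B 0"]) auto
qed

lemma csupp_integrable:
  fixes u :: "'a::euclidean_space \<Rightarrow> 'b::{banach, second_countable_topology}"
  assumes "continuous_on UNIV u" "csupp u"
  shows "integrable lborel u"
proof -
  obtain R where R: "\<And>z. u z \<noteq> 0 \<Longrightarrow> norm z \<le> R" using assms unfolding csupp_def by blast
  have "integrable lborel (\<lambda>z. indicator (cball 0 R) z *\<^sub>R u z)"
    by (intro borel_integrable_compact continuous_on_subset[OF assms(1)]) auto
  moreover have "(\<lambda>z. indicator (cball 0 R) z *\<^sub>R u z) = u"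
    using R by (force simp: indicator_def)
  ultimately show ?thesis by simp
qed

lemma csupp_integrable_bounded:
  fixes f :: "'a::euclidean_space \<Rightarrow> real"
  assumes "f \<in> borel_measurable borel" "csupp f" "\<And>z. \<bar>f z\<bar> \<le> B"
  shows "integrable lborel f"
proof -
  obtain R where R: "\<And>z. f z \<noteq> 0 \<Longrightarrow> norm z \<le> R" using assms unfolding csupp_def by blast
  show ?thesis
  proof (rule Bochner_Integration.integrable_bound)
    show "integrable lborel (\<lambda>z::'a. B * indicat_real (cball 0 R) z)"
      using emeasure_lborel_cball_finite[of "0::'a" R]
      by (intro integrable_mult_right integrable_real_indicator) auto
    show "AE z in lborel. norm (f z) \<le> norm (B * indicat_real (cball 0 R) z)"
    proof (intro AE_I2)
      fix z
      have "B \<ge> 0" using assms(3)[of z] abs_ge_zero[of "f z"] by linarith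
      then show "norm (f z) \<le> norm (B * indicat_real (cball 0 R) z)"
        using assms(3)[of z] R[of z] by (cases "f z = 0") auto
    qed
  qed (use assms in simp)
qed

text \<open>Beyond the support the fundamental theorem of calculus leaves no boundary terms. Vector
  values are allowed because the Fourier estimate applies this to a complex integrand.\<close>

lemma integral_deriv_csupp:
  fixes g :: "real \<Rightarrow> 'a::euclidean_space"
  assumes "\<And>x. (g has_vector_derivative g' x) (at x)" "continuous_on UNIV g'" "csupp g"
  shows "(LINT x|lborel. g' x) = 0" "csupp g'"
proof -
  obtain R where R: "\<And>z. g z \<noteq> 0 \<Longrightarrow> norm z \<le> R" using assms unfolding csupp_def by blast
  \<comment> \<open>\<open>g\<close> must vanish at both \<open>S\<close> and \<open>-S\<close>, and
    the bound \<open>R\<close> may be negative.\<close>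
  define S where "S = max R 0 + 1"
  have g0: "g x = 0" if "\<bar>x\<bar> > R" for x using R[of x] that by auto
  have g'0: "g' x = 0" if "\<bar>x\<bar> > R" for x
  proof -
    have "(g has_vector_derivative 0) (at x)"
      by (rule has_vector_derivative_transform_within_open[of "\<lambda>x. 0" _ _ "{x. \<bar>x\<bar> > R}"])
         (use g0 that in \<open>auto intro!: open_Collect_less continuous_intros\<close>)
    then show ?thesis using assms(1) vector_derivative_unique_at by blast
  qed
  then show "csupp g'" unfolding csupp_def by (intro exI[of _ R]) force
  have "(LINT x|lborel. g' x) = (LINT x|lborel. indicator {-S..S} x *\<^sub>R g' x)"
    by (intro Bochner_Integration.integral_cong) (auto simp: indicator_def S_def intro!: g'0)
  also have "\<dots> = g S - g (- S)"
  proof (rule integral_FTC_atLeastAtMost)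
    show "continuous_on {-S..S} g'" using assms(2) by (rule continuous_on_subset) simp
  qed (use assms(1) in \<open>auto simp: S_def intro: has_vector_derivative_at_within\<close>)
  also have "\<dots> = 0" using g0[of S] g0[of "-S"] by (simp add: S_def)
  finally show "(LINT x|lborel. g' x) = 0" .
qed

lemma csupp_dt: "csupp u \<Longrightarrow> csupp (dt u)" and csupp_dx: "csupp u \<Longrightarrow> csupp (dx u)"
proof -
  assume "csupp u"
  then obtain R where R: "\<And>z. u z \<noteq> 0 \<Longrightarrow> norm z \<le> R" unfolding csupp_def by blast
  have "dt u z = dt (\<lambda>z. 0) z" "dx u z = dx (\<lambda>z. 0) z" if "norm z > R" for z
    by (rule dt_cong_open[of "{z. norm z > R}"] dx_cong_open[of "{z. norm z > R}"];
        use that R in \<open>force intro!: open_Collect_less continuous_intros\<close>)+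
  then have "dt u z = 0" "dx u z = 0" if "norm z > R" for z
    using that by (simp_all add: dt_def dx_def case_prod_beta)
  then show "csupp (dt u)" "csupp (dx u)" unfolding csupp_def
    by (metis not_le)+
qed

lemma csupp_slice:
  fixes u :: "real \<times> real \<Rightarrow> 'b::zero"
  assumes "csupp u" shows "csupp (\<lambda>s. u (s, x))" "csupp (\<lambda>y. u (t, y))"
proof -
  obtain R where R: "\<And>z. u z \<noteq> 0 \<Longrightarrow> norm z \<le> R" using assms unfolding csupp_def by blast
  have "\<bar>s\<bar> \<le> norm (s, x)" "\<bar>y\<bar> \<le> norm (t, y)" for s y
    using norm_fst_le[of s x] norm_snd_le[of y t] by auto
  then have "\<bar>s\<bar> \<le> R" if "u (s, x) \<noteq> 0" for s
    using R[OF that] by (meson order_trans)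
  moreover have "\<bar>y\<bar> \<le> R" if "u (t, y) \<noteq> 0" for y
    using R[OF that] \<open>\<And>y s. \<bar>y\<bar> \<le> norm (t, y)\<close> by (meson order_trans)
  ultimately show "csupp (\<lambda>s. u (s, x))" "csupp (\<lambda>y. u (t, y))"
    unfolding csupp_def real_norm_def by blast+
qed

lemma continuous_on_slice:
  assumes "continuous_on UNIV (u :: real \<times> real \<Rightarrow> 'b::topological_space)"
  shows "continuous_on UNIV (\<lambda>s. u (s, x))" "continuous_on UNIV (\<lambda>y. u (t, y))"
  by (auto intro!: continuous_on_compose2[OF assms] continuous_intros)

lemma integral_plane:
  fixes f :: "real \<times> real \<Rightarrow> 'b::{banach, second_countable_topology}"
  assumes "integrable lborel f"
  shows "(LINT z|lborel. f z) = (LINT t|lborel. LINT x|lborel. f (t, x))"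
    "(LINT z|lborel. f z) = (LINT x|lborel. LINT t|lborel. f (t, x))"
proof -
  have i: "integrable (lborel \<Otimes>\<^sub>M lborel) f"
    using assms by (simp add: lborel_prod)
  show "(LINT z|lborel. f z) = (LINT t|lborel. LINT x|lborel. f (t, x))"
    using lborel_pair.integral_fst'[OF i] by (simp add: lborel_prod)
  show "(LINT z|lborel. f z) = (LINT x|lborel. LINT t|lborel. f (t, x))"
    using lborel_pair.integral_snd[of "\<lambda>t x. f (t, x)"] i by (simp add: lborel_prod)
qed

lemma integral_dt_zero:
  assumes "Ck 1 u" "csupp u"
  shows "(LINT z|lborel. dt u z) = 0" "(LINT z|lborel. dx u z) = 0"
proof -
  have u: "\<And>z. u differentiable (at z)" "continuous_on UNIV (dt u)" "continuous_on UNIV (dx u)"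
    by (fact Ck1D[OF assms(1)])+
  have "(LINT t|lborel. dt u (t, x)) = 0" for x
    by (rule integral_deriv_csupp[of "\<lambda>s. u (s, x)"])
      (use dt_DERIV[OF u(1)] u assms(2) in \<open>auto intro: continuous_on_slice csupp_slice
        simp flip: has_real_derivative_iff_has_vector_derivative\<close>)
  then show "(LINT z|lborel. dt u z) = 0"
    using integral_plane(2)[OF csupp_integrable[OF u(2) csupp_dt[OF assms(2)]]] by simp
  have "(LINT x|lborel. dx u (t, x)) = 0" for t
    by (rule integral_deriv_csupp[of "\<lambda>s. u (t, s)"])
      (use dx_DERIV[OF u(1)] u assms(2) in \<open>auto intro: continuous_on_slice csupp_slice
        simp flip: has_real_derivative_iff_has_vector_derivative\<close>)
  then show "(LINT z|lborel. dx u z) = 0"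
    using integral_plane(1)[OF csupp_integrable[OF u(3) csupp_dx[OF assms(2)]]] by simp
qed

lemma integral_by_parts_plane:
  assumes "Ck 1 u" "csupp u" "Ck 1 \<phi>"
  shows "(LINT z|lborel. u z * dt \<phi> z) = - (LINT z|lborel. dt u z * \<phi> z)"
    "(LINT z|lborel. u z * dx \<phi> z) = - (LINT z|lborel. dx u z * \<phi> z)"
proof -
  have d: "\<And>z. u differentiable (at z)" "\<And>z. \<phi> differentiable (at z)"
    by (fact Ck1D[OF assms(1)] Ck1D[OF assms(3)])+
  have c: "continuous_on UNIV u" "continuous_on UNIV \<phi>" "continuous_on UNIV (dt u)"
      "continuous_on UNIV (dt \<phi>)" "continuous_on UNIV (dx u)" "continuous_on UNIV (dx \<phi>)"
    by (fact Ck1D[OF assms(1)] Ck1D[OF assms(3)])+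
  have i: "integrable lborel (\<lambda>z. u z * dt \<phi> z)" "integrable lborel (\<lambda>z. dt u z * \<phi> z)"
     "integrable lborel (\<lambda>z. u z * dx \<phi> z)" "integrable lborel (\<lambda>z. dx u z * \<phi> z)"
    by (intro csupp_integrable continuous_intros c;
        rule csupp_mono[OF assms(2)] csupp_mono[OF csupp_dt[OF assms(2)]]
          csupp_mono[OF csupp_dx[OF assms(2)]]; simp)+
  have s: "csupp (\<lambda>z. u z * \<phi> z)" by (rule csupp_mono[OF assms(2)]) simp
  have *: "(LINT z|lborel. dt u z * \<phi> z + u z * dt \<phi> z) = 0"
    "(LINT z|lborel. dx u z * \<phi> z + u z * dx \<phi> z) = 0"
    using integral_dt_zero[OF Ck_mult[OF assms(1,3)] s]
    unfolding dt_mult[OF d] dx_mult[OF d] by simp_all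
  show "(LINT z|lborel. u z * dt \<phi> z) = - (LINT z|lborel. dt u z * \<phi> z)"
    "(LINT z|lborel. u z * dx \<phi> z) = - (LINT z|lborel. dx u z * \<phi> z)"
    using * i by simp_all
qed

text \<open>Both sides equal minus the integral of \<open>u\<close> against the mixed derivative of
  \<open>\<phi>\<close>. This identity is what turns the equation for \<open>u\<close> into the
  divergence form equation for \<open>u_x\<close>.\<close>

lemma integral_dx_dt_swap:
  assumes "Ck 1 u" "csupp u" "Ck 2 \<phi>"
  shows "(LINT z|lborel. dx u z * dt \<phi> z) = (LINT z|lborel. dt u z * dx \<phi> z)"
proof -
  note p = Ck2D(3,4)[OF assms(3)]
  have "(LINT z|lborel. dx u z * dt \<phi> z) = - (LINT z|lborel. u z * dx (dt \<phi>) z)"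
    "(LINT z|lborel. dt u z * dx \<phi> z) = - (LINT z|lborel. u z * dt (dx \<phi>) z)"
    using integral_by_parts_plane[OF assms(1,2) p(1)] integral_by_parts_plane[OF assms(1,2) p(2)]
    by simp_all
  then show ?thesis using dt_dx_commute[OF assms(3)] by simp
qed

section \<open>The Bessel multiplier as a probability kernel\<close>

lemma borel_measurable_cis [measurable]:
  "f \<in> borel_measurable M \<Longrightarrow> (\<lambda>x. cis (f x)) \<in> borel_measurable M"
  unfolding cis_conv_exp by measurable

text \<open>Multiplying the standard normal density by the Gaussian in \<open>s\<close> gives
  \<open>\<sigma>\<close> times the normal density of variance
  \<open>\<sigma>\<^sup>2 = 1 / (1 + \<xi>\<^sup>2)\<close>, which has mass one. The Bessel symbol
  thus becomes a mixture of Gaussian symbols, each of which averages translations.\<close>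

lemma gaussian_mixture:
  "(LINT s|std_normal_distribution. exp (- (s\<^sup>2 * \<xi>\<^sup>2) / 2)) = 1 / sqrt (1 + \<xi>\<^sup>2)"
proof -
  define \<sigma> where "\<sigma> = 1 / sqrt (1 + \<xi>\<^sup>2)"
  have p: "1 + \<xi>\<^sup>2 > 0" by (simp add: add_pos_nonneg)
  have s2: "\<sigma>\<^sup>2 = 1 / (1 + \<xi>\<^sup>2)" and s0: "\<sigma> > 0"
    using p by (auto simp: \<sigma>_def power_divide)
  have "(LINT s|std_normal_distribution. exp (- (s\<^sup>2 * \<xi>\<^sup>2) / 2)) =
      (LINT s|lborel. std_normal_density s * exp (- (s\<^sup>2 * \<xi>\<^sup>2) / 2))"
    by (subst integral_density) auto
  also have "\<dots> = (LINT s|lborel. \<sigma> * normal_density 0 \<sigma> s)"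
  proof (intro Bochner_Integration.integral_cong refl)
    fix s :: real
    have "exp (- s\<^sup>2 / 2) * exp (- (s\<^sup>2 * \<xi>\<^sup>2) / 2) = exp (- (s\<^sup>2 * (1 + \<xi>\<^sup>2)) / 2)"
      by (simp flip: exp_add add: algebra_simps)
    moreover have "sqrt (2 * pi * \<sigma>\<^sup>2) = sqrt (2 * pi) * \<sigma>"
      using s0 by (simp add: real_sqrt_mult)
    ultimately show "std_normal_density s * exp (- (s\<^sup>2 * \<xi>\<^sup>2) / 2) = \<sigma> * normal_density 0 \<sigma> s"
      using s0 p by (simp add: normal_density_def std_normal_density_def s2)
  qed
  also have "\<dots> = \<sigma>" using s0 by simp
  finally show ?thesis by (simp add: \<sigma>_def)
qed

text \<open>Rescaling by \<open>s\<close> reduces this to the characteristic function of the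
  standard normal law.\<close>

lemma gaussian_fourier:
  assumes "s \<noteq> 0"
  shows "(LINT \<xi>|lborel. cis (\<xi> * b) * complex_of_real (exp (- (s\<^sup>2 * \<xi>\<^sup>2) / 2))) =
    complex_of_real (sqrt (2 * pi) / \<bar>s\<bar> * exp (- (b / s)\<^sup>2 / 2))"
proof -
  have "(LINT \<xi>|lborel. cis (\<xi> * b) * complex_of_real (exp (- (s\<^sup>2 * \<xi>\<^sup>2) / 2))) =
     (1 / \<bar>s\<bar>) *\<^sub>R (LINT \<eta>|lborel. cis (\<eta> * b / s) * complex_of_real (exp (- \<eta>\<^sup>2 / 2)))"
    by (subst lborel_integral_real_affine[of "1 / s" _ 0])
       (use assms in \<open>auto simp: power_divide\<close>)
  also have "(LINT \<eta>|lborel. cis (\<eta> * b / s) * complex_of_real (exp (- \<eta>\<^sup>2 / 2))) =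
      complex_of_real (sqrt (2 * pi)) * (LINT \<eta>|lborel. std_normal_density \<eta> *\<^sub>R iexp (b / s * \<eta>))"
    unfolding integral_mult_right_zero[symmetric]
    by (intro Bochner_Integration.integral_cong refl)
       (simp add: std_normal_density_def scaleR_conv_of_real cis_conv_exp mult_ac)
  also have "(LINT \<eta>|lborel. std_normal_density \<eta> *\<^sub>R iexp (b / s * \<eta>)) =
      char std_normal_distribution (b / s)"
    unfolding char_def by (subst integral_density) auto
  also have "\<dots> = complex_of_real (exp (- (b / s)\<^sup>2 / 2))"
    by (simp add: char_std_normal_distribution)
  finally show ?thesis by (simp add: scaleR_conv_of_real)
qed

definition fourier :: "(real \<Rightarrow> real) \<Rightarrow> real \<Rightarrow> complex" where
  "fourier f \<xi> = (LINT y|lborel. cis (- (\<xi> * y)) * complex_of_real (f y))"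

lemma fourier_measurable [measurable]:
  assumes [measurable]: "f \<in> borel_measurable borel"
  shows "fourier f \<in> borel_measurable borel"
  unfolding fourier_def by measurable

text \<open>One integration by parts gives the decay. Together with the equal factor in the Bessel
  symbol it yields an integrable bound of order \<open>1 / (1 + \<xi>\<^sup>2)\<close>, which
  licenses the exchange of integrals in \<open>bessel_x_eq\<close>.\<close>

lemma fourier_decay:
  assumes d: "\<And>x. (f has_real_derivative f' x) (at x)" and f': "continuous_on UNIV f'"
    and c: "csupp f"
  obtains C where "C \<ge> 0" "\<And>\<xi>. norm (fourier f \<xi>) \<le> C / sqrt (1 + \<xi>\<^sup>2)"
proof -
  have cf: "continuous_on UNIV f"
    using d by (meson DERIV_continuous_on has_field_derivative_at_within)
  have c': "csupp f'"
    by (rule integral_deriv_csupp(2)[OF _ f' c])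
       (use d in \<open>simp flip: has_real_derivative_iff_has_vector_derivative\<close>)
  have int: "integrable lborel f" "integrable lborel f'"
    using csupp_integrable cf f' c c' by auto
  have icis: "integrable lborel (\<lambda>y. cis (- (\<xi> * y)) * complex_of_real (h y))"
    if "integrable lborel h" for h :: "real \<Rightarrow> real" and \<xi>
    by (rule Bochner_Integration.integrable_bound[OF integrable_norm[OF that]])
       (use that in \<open>auto simp: norm_mult\<close>)
  define A where "A = (LINT y|lborel. \<bar>f y\<bar>)"
  define B where "B = (LINT y|lborel. \<bar>f' y\<bar>)"
  have A: "norm (fourier f \<xi>) \<le> A" for \<xi>
    unfolding fourier_def A_def
    by (rule order_trans[OF integral_norm_bound]) (simp add: norm_mult)
  have "\<bar>\<xi>\<bar> * norm (fourier f \<xi>) \<le> B" for \<xi>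
  proof -
    have D: "((\<lambda>y. cis (- (\<xi> * y)) * complex_of_real (f y)) has_vector_derivative
       - (\<i> * complex_of_real \<xi>) * (cis (- (\<xi> * y)) * complex_of_real (f y)) +
       cis (- (\<xi> * y)) * complex_of_real (f' y)) (at y)" for y
    proof -
      define A where "A = - (\<i> * complex_of_real \<xi>)"
      have "cis (- (\<xi> * y)) = exp (y *\<^sub>R A)" for y
        by (simp add: cis_conv_exp A_def scaleR_conv_of_real mult_ac)
      then have "((\<lambda>y. cis (- (\<xi> * y))) has_vector_derivative A * cis (- (\<xi> * y))) (at y)"
        using exp_scaleR_has_vector_derivative_left[of A y] by simp
      moreover have "((\<lambda>y. complex_of_real (f y)) has_vector_derivative complex_of_real (f' y)) (at y)"
        using d[of y] by (intro has_vector_derivative_of_real)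
          (simp add: has_real_derivative_iff_has_vector_derivative)
      ultimately show ?thesis
        unfolding A_def[symmetric] by (auto dest: has_vector_derivative_mult simp: algebra_simps)
    qed
    have "(LINT y|lborel. - (\<i> * complex_of_real \<xi>) * (cis (- (\<xi> * y)) * complex_of_real (f y)) +
       cis (- (\<xi> * y)) * complex_of_real (f' y)) = 0"
      by (rule integral_deriv_csupp(1)[OF D])
         (auto intro!: continuous_intros cf f' csupp_mono[OF c] simp: cis_conv_exp)
    then have "\<i> * complex_of_real \<xi> * fourier f \<xi> = fourier f' \<xi>"
      unfolding fourier_def using icis[OF int(1)] icis[OF int(2)]
      by (subst (asm) Bochner_Integration.integral_add) auto
    then have "\<bar>\<xi>\<bar> * norm (fourier f \<xi>) = norm (fourier f' \<xi>)"
      by (metis abs_norm_cancel norm_mult norm_ii norm_of_real mult_1)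
    also have "\<dots> \<le> B"
      unfolding fourier_def B_def
      by (rule order_trans[OF integral_norm_bound]) (simp add: norm_mult)
    finally show ?thesis .
  qed
  note B = this
  have "norm (fourier f \<xi>) \<le> (A + B) / sqrt (1 + \<xi>\<^sup>2)" for \<xi>
  proof -
    have "sqrt (1 + \<xi>\<^sup>2) \<le> 1 + \<bar>\<xi>\<bar>"
      by (rule real_le_lsqrt) (auto simp: power2_eq_square algebra_simps)
    then have "sqrt (1 + \<xi>\<^sup>2) * norm (fourier f \<xi>) \<le> (1 + \<bar>\<xi>\<bar>) * norm (fourier f \<xi>)"
      by (rule mult_right_mono) simp
    also have "\<dots> \<le> A + B" using A[of \<xi>] B[of \<xi>] by (simp add: algebra_simps)
    finally show ?thesis
      by (subst pos_le_divide_eq) (auto simp: mult.commute add_pos_nonneg)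
  qed
  moreover have "A + B \<ge> 0"
    unfolding A_def B_def by (intro add_nonneg_nonneg Bochner_Integration.integral_nonneg) auto
  ultimately show ?thesis by (rule that[rotated])
qed

text \<open>A Gaussian symbol acts as convolution with a normal density of standard deviation
  \<open>\<bar>s\<bar>\<close>; substituting \<open>y = x + s * z\<close> turns the convolution into
  an expectation.\<close>

lemma gaussian_fourier_conv:
  assumes "continuous_on UNIV f" "csupp f" "s \<noteq> 0"
  shows "(LINT \<xi>|lborel. cis (\<xi> * x) * (complex_of_real (exp (- (s\<^sup>2 * \<xi>\<^sup>2) / 2)) * fourier f \<xi>)) =
    complex_of_real (2 * pi * (LINT z|std_normal_distribution. f (x + s * z)))"
proof -
  have fm [measurable]: "f \<in> borel_measurable borel"
    using assms by (simp add: borel_measurable_continuous_onI)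
  have fi: "integrable lborel f" by (rule csupp_integrable) fact+
  define G where "G \<xi> = exp (- (s\<^sup>2 * \<xi>\<^sup>2) / 2)" for \<xi> :: real
  have [measurable]: "G \<in> borel_measurable borel" unfolding G_def by measurable
  have Gi: "integrable lborel G"
  proof -
    have "G = (\<lambda>\<xi>. sqrt (2 * pi * (1/s)\<^sup>2) * normal_density 0 (1/\<bar>s\<bar>) \<xi>)"
      using assms(3) by (auto simp: G_def normal_density_def power_divide fun_eq_iff field_simps)
    then show ?thesis using assms(3) by simp
  qed
  define h where "h = (\<lambda>(\<xi>, y). cis (\<xi> * (x - y)) * complex_of_real (G \<xi>) * complex_of_real (f y))"
  have hm [measurable]: "h \<in> borel_measurable (lborel \<Otimes>\<^sub>M lborel)"
    unfolding h_def by measurable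
  have hi: "integrable (lborel \<Otimes>\<^sub>M lborel) h"
  proof (rule lborel_pair.Fubini_integrable)
    have "(LINT y|lborel. norm (h (\<xi>, y))) = G \<xi> * (LINT y|lborel. \<bar>f y\<bar>)" for \<xi>
      by (simp add: h_def norm_mult G_def)
    then show "integrable lborel (\<lambda>\<xi>. LINT y|lborel. norm (h (\<xi>, y)))"
      using Gi by simp
    have "integrable lborel (\<lambda>y. h (\<xi>, y))" for \<xi>
      by (rule Bochner_Integration.integrable_bound[OF integrable_mult_right[OF integrable_norm[OF fi], of "G \<xi>"]])
         (auto simp: h_def norm_mult G_def)
    then show "AE \<xi> in lborel. integrable lborel (\<lambda>y. h (\<xi>, y))" by simp
  qed measurable
  have "(LINT \<xi>|lborel. cis (\<xi> * x) * (complex_of_real (G \<xi>) * fourier f \<xi>)) =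
     (LINT \<xi>|lborel. LINT y|lborel. h (\<xi>, y))"
  proof (intro Bochner_Integration.integral_cong refl)
    fix \<xi> :: real
    have "h (\<xi>, y) = cis (\<xi> * x) * (complex_of_real (G \<xi>) * (cis (- (\<xi> * y)) * complex_of_real (f y)))" for y
      by (simp add: h_def cis_mult right_diff_distrib)
    then show "cis (\<xi> * x) * (complex_of_real (G \<xi>) * fourier f \<xi>) = (LINT y|lborel. h (\<xi>, y))"
      unfolding fourier_def by simp
  qed
  also have "\<dots> = (LINT y|lborel. LINT \<xi>|lborel. h (\<xi>, y))"
    using lborel_pair.Fubini_integral[of "\<lambda>\<xi> y. h (\<xi>, y)"] hi by simp
  also have "\<dots> = (LINT y|lborel. complex_of_real (f y * (sqrt (2 * pi) / \<bar>s\<bar> * exp (- ((x - y) / s)\<^sup>2 / 2))))"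
    using gaussian_fourier[OF assms(3)]
    by (intro Bochner_Integration.integral_cong refl) (simp add: h_def G_def)
  also have "\<dots> = complex_of_real (LINT y|lborel. f y * (sqrt (2 * pi) / \<bar>s\<bar> * exp (- ((x - y) / s)\<^sup>2 / 2)))"
    by (rule integral_complex_of_real)
  also have "(LINT y|lborel. f y * (sqrt (2 * pi) / \<bar>s\<bar> * exp (- ((x - y) / s)\<^sup>2 / 2))) =
      \<bar>s\<bar> * (LINT z|lborel. f (x + s * z) * (sqrt (2 * pi) / \<bar>s\<bar> * exp (- z\<^sup>2 / 2)))"
    by (subst lborel_integral_real_affine[of s _ x]) (use assms(3) in auto)
  also have "\<dots> = (LINT z|lborel. 2 * pi * (std_normal_density z * f (x + s * z)))"
    unfolding integral_mult_right_zero[symmetric]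
  proof (intro Bochner_Integration.integral_cong refl)
    fix z :: real
    have "2 * pi * (std_normal_density z * f (x + s * z)) =
        (2 * pi / sqrt (2 * pi)) * (exp (- z\<^sup>2 / 2) * f (x + s * z))"
      by (simp add: std_normal_density_def)
    also have "2 * pi / sqrt (2 * pi) = sqrt (2 * pi)"
      by (rule real_div_sqrt) simp
    finally show "\<bar>s\<bar> * (f (x + s * z) * (sqrt (2 * pi) / \<bar>s\<bar> * exp (- z\<^sup>2 / 2))) =
        2 * pi * (std_normal_density z * f (x + s * z))"
      using assms(3) by auto
  qed
  also have "\<dots> = 2 * pi * (LINT z|std_normal_distribution. f (x + s * z))"
    by (subst integral_density) auto
  finally show ?thesis unfolding G_def .
qed

text \<open>The multiplier \<open>(1 + \<xi>\<^sup>2)\<^sup>-\<^sup>1\<^sup>/\<^sup>2\<close> is the characteristic function of the product of two independent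
  standard normal variables.\<close>

definition bessel_distr :: "real measure" where
  "bessel_distr = distr (std_normal_distribution \<Otimes>\<^sub>M std_normal_distribution) borel (\<lambda>(s, z). s * z)"

interpretation std_normal: prob_space std_normal_distribution
  by (rule prob_space_normal_density) simp

interpretation std_normal_pair: pair_prob_space std_normal_distribution std_normal_distribution ..

interpretation bessel_distr: prob_space bessel_distr
  unfolding bessel_distr_def by (rule std_normal_pair.prob_space_distr) measurable

lemma sets_bessel_distr [simp, measurable_cong]: "sets bessel_distr = sets borel"
  by (simp add: bessel_distr_def)

lemma integrable_inverse_square: "integrable lborel (\<lambda>\<xi>::real. 1 / (1 + \<xi>\<^sup>2))"
  using integrable_inverse_1_plus_square
  by (simp add: set_integrable_def einterval_def inverse_eq_divide)

text \<open>Average \<open>gaussian_fourier_conv\<close> over a standard normal \<open>s\<close>: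
  \<open>gaussian_mixture\<close> rebuilds the Bessel symbol on the Fourier side, and the
  translation becomes the product of two independent normal variables. In this form the operator is
  easy to transpose.\<close>

lemma bessel_x_eq:
  assumes "Ck 1 \<psi>" "csupp \<psi>"
  shows "bessel_x \<psi> (t, x) = (LINT y|bessel_distr. \<psi> (t, x + y))"
proof -
  let ?N = "std_normal_distribution"
  define f where "f y = \<psi> (t, y)" for y
  have cf: "continuous_on UNIV f" and sf: "csupp f"
    unfolding f_def
    by (rule continuous_on_slice[OF Ck_continuous[OF assms(1)]] csupp_slice[OF assms(2)])+
  have [measurable]: "f \<in> borel_measurable borel"
    using cf by (simp add: borel_measurable_continuous_onI)
  obtain C where C: "C \<ge> 0" "\<And>\<xi>. norm (fourier f \<xi>) \<le> C / sqrt (1 + \<xi>\<^sup>2)"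
  proof (rule fourier_decay[of f "\<lambda>y. dx \<psi> (t, y)"])
    show "(f has_real_derivative dx \<psi> (t, x)) (at x)" for x
      unfolding f_def by (rule dx_DERIV) (rule Ck1D[OF assms(1)])
    show "continuous_on UNIV (\<lambda>y. dx \<psi> (t, y))"
      by (rule continuous_on_slice) (rule Ck1D[OF assms(1)])
  qed (use sf that in auto)
  define G where "G s \<xi> = exp (- (s\<^sup>2 * \<xi>\<^sup>2) / 2)" for s \<xi> :: real
  have [measurable]: "(\<lambda>p. G (fst p) (snd p)) \<in> borel_measurable (borel \<Otimes>\<^sub>M borel)"
    unfolding G_def by measurable
  have Gm [measurable]: "(\<lambda>\<xi>. G s \<xi>) \<in> borel_measurable borel" "(\<lambda>s. G s \<xi>) \<in> borel_measurable borel" for s \<xi>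
    unfolding G_def by measurable
  define h where "h = (\<lambda>(\<xi>, s). cis (\<xi> * x) * (complex_of_real (G s \<xi>) * fourier f \<xi>))"
  interpret P: pair_sigma_finite lborel ?N ..
  have hm [measurable]: "h \<in> borel_measurable (lborel \<Otimes>\<^sub>M ?N)"
    unfolding h_def G_def by measurable
  have Gi: "integrable ?N (\<lambda>s. G s \<xi>)" for \<xi>
    by (rule std_normal.integrable_const_bound[of _ 1]) (auto simp: G_def)
  have hi: "integrable (lborel \<Otimes>\<^sub>M ?N) h"
  proof (rule P.Fubini_integrable)
    have "(LINT s|?N. norm (h (\<xi>, s))) = 1 / sqrt (1 + \<xi>\<^sup>2) * norm (fourier f \<xi>)" for \<xi>
      by (simp add: h_def norm_mult flip: gaussian_mixture) (simp add: G_def)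
    moreover have "integrable lborel (\<lambda>\<xi>. 1 / sqrt (1 + \<xi>\<^sup>2) * norm (fourier f \<xi>))"
    proof (rule Bochner_Integration.integrable_bound)
      show "integrable lborel (\<lambda>\<xi>. C * (1 / (1 + \<xi>\<^sup>2)))"
        by (intro integrable_mult_right integrable_inverse_square)
      have "1 / sqrt (1 + \<xi>\<^sup>2) * norm (fourier f \<xi>) \<le> C * (1 / (1 + \<xi>\<^sup>2))" for \<xi>
      proof -
        have "1 / sqrt (1 + \<xi>\<^sup>2) * norm (fourier f \<xi>) \<le> 1 / sqrt (1 + \<xi>\<^sup>2) * (C / sqrt (1 + \<xi>\<^sup>2))"
          by (rule mult_left_mono[OF C(2)]) simp
        also have "\<dots> = C * (1 / (1 + \<xi>\<^sup>2))"
          by (simp add: add_nonneg_nonneg)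
        finally show ?thesis .
      qed
      then show "AE \<xi> in lborel. norm (1 / sqrt (1 + \<xi>\<^sup>2) * norm (fourier f \<xi>)) \<le> norm (C * (1 / (1 + \<xi>\<^sup>2)))"
        using C(1) by (intro AE_I2) (simp add: add_nonneg_nonneg abs_mult)
    qed measurable
    ultimately show "integrable lborel (\<lambda>\<xi>. LINT s|?N. norm (h (\<xi>, s)))" by simp
    show "AE \<xi> in lborel. integrable ?N (\<lambda>s. h (\<xi>, s))"
      unfolding h_def using Gi by (auto intro!: integrable_mult_right integrable_mult_left integrable_of_real)
  qed measurable
  have "(LINT \<xi>|lborel. cis (\<xi> * x) * (complex_of_real (1 / sqrt (1 + \<xi>\<^sup>2)) * fourier f \<xi>)) =
     (LINT \<xi>|lborel. LINT s|?N. h (\<xi>, s))"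
    by (intro Bochner_Integration.integral_cong refl)
       (simp add: h_def G_def integral_complex_of_real flip: gaussian_mixture)
  also have "\<dots> = (LINT s|?N. LINT \<xi>|lborel. h (\<xi>, s))"
    using P.Fubini_integral[of "\<lambda>\<xi> s. h (\<xi>, s)"] hi by simp
  also have "\<dots> = (LINT s|?N. complex_of_real (2 * pi * (LINT z|?N. f (x + s * z))))"
  proof (intro integral_cong_AE)
    \<comment> \<open>The Gaussian formula requires \<open>s \<noteq> 0\<close>; the exception is a
      null set for the normal law.\<close>
    have "AE s in lborel. s \<noteq> (0::real)" by (rule AE_lborel_singleton)
    then have "AE s in ?N. s \<noteq> 0"
      by (subst AE_density) auto
    then show "AE s in ?N. (LINT \<xi>|lborel. h (\<xi>, s)) = complex_of_real (2 * pi * (LINT z|?N. f (x + s * z)))"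
      by eventually_elim (use gaussian_fourier_conv[OF cf sf] in \<open>simp add: h_def G_def\<close>)
  qed measurable
  also have "\<dots> = complex_of_real (2 * pi * (LINT s|?N. LINT z|?N. f (x + s * z)))"
    by (simp add: integral_complex_of_real)
  finally have *: "bessel_x \<psi> (t, x) = (LINT s|?N. LINT z|?N. f (x + s * z))"
    by (simp add: bessel_x_def fourier_x_def fourier_def f_def)
  obtain B where B: "\<And>y. norm (f y) \<le> B" using csupp_bounded[OF cf sf] by blast
  have "integrable (?N \<Otimes>\<^sub>M ?N) (\<lambda>(s, z). f (x + s * z))"
    by (rule std_normal_pair.integrable_const_bound[of _ B]) (use B in auto)
  from std_normal_pair.integral_fst[OF this]
  have "(LINT s|?N. LINT z|?N. f (x + s * z)) = (LINT p|(?N \<Otimes>\<^sub>M ?N). f (x + fst p * snd p))"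
    unfolding case_prod_beta by simp
  also have "\<dots> = (LINT y|bessel_distr. f (x + y))"
    unfolding bessel_distr_def by (subst integral_distr) (auto simp: case_prod_beta)
  finally show ?thesis using * by (simp add: f_def)
qed

section \<open>Smooth solutions\<close>

lemma Q_borel [measurable, simp]: "Q \<in> sets borel"
  unfolding Q_def by (simp add: borel_open open_Times)

lemma measurable_MQ: "f \<in> borel_measurable borel \<Longrightarrow> f \<in> borel_measurable MQ"
  unfolding MQ_def by (intro measurable_restrict_space1) simp

lemma integral_MQ:
  fixes h :: "real \<times> real \<Rightarrow> real"
  assumes "\<And>z. z \<notin> Q \<Longrightarrow> h z = 0"
  shows "(LINT z|MQ. h z) = (LINT z|lborel. h z)"
  unfolding MQ_def
  by (subst integral_restrict_space)
     (use assms in \<open>auto intro!: Bochner_Integration.integral_cong simp: indicator_def\<close>)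

lemma nn_integral_MQ_le: "(\<integral>\<^sup>+ z. h z \<partial>MQ) \<le> (\<integral>\<^sup>+ z. h z \<partial>lborel)"
  unfolding MQ_def
  by (subst nn_integral_restrict_space) (auto intro!: nn_integral_mono simp: indicator_def)

lemma Lp_space_MQ_I:
  assumes "f \<in> borel_measurable borel" "integrable lborel (\<lambda>z. \<bar>f z\<bar> powr q)"
  shows "f \<in> Lp_space q MQ"
proof -
  have "(\<integral>\<^sup>+ z. ennreal (\<bar>f z\<bar> powr q) \<partial>MQ) \<le> (\<integral>\<^sup>+ z. ennreal (\<bar>f z\<bar> powr q) \<partial>lborel)"
    by (rule nn_integral_MQ_le)
  also have "\<dots> < \<infinity>"
    using assms(2) by (subst nn_integral_eq_integral) auto
  finally show ?thesis using assms(1) by (simp add: Lp_space_def measurable_MQ)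
qed

lemma Lp_norm_MQ_eq:
  assumes "f \<in> borel_measurable borel" "integrable lborel (\<lambda>z. \<bar>f z\<bar> powr q)"
    "\<And>z. z \<notin> Q \<Longrightarrow> f z = 0"
  shows "Lp_norm q MQ f = ennreal ((LINT z|lborel. \<bar>f z\<bar> powr q) powr (1 / q))"
proof -
  have "(\<integral>\<^sup>+ z. ennreal (\<bar>f z\<bar> powr q) \<partial>MQ) = (\<integral>\<^sup>+ z. ennreal (\<bar>f z\<bar> powr q) \<partial>lborel)"
    unfolding MQ_def
    by (subst nn_integral_restrict_space)
       (use assms(3) in \<open>auto intro!: nn_integral_cong simp: indicator_def\<close>)
  also have "\<dots> = ennreal (LINT z|lborel. \<bar>f z\<bar> powr q)"
    using assms(2) by (subst nn_integral_eq_integral) auto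
  finally show ?thesis
    using Lp_space_MQ_I[OF assms(1,2)] by (simp add: Lp_norm_def)
qed

lemma csupp_powr_integrable:
  fixes f :: "'a::euclidean_space \<Rightarrow> real"
  assumes "f \<in> borel_measurable borel" "csupp f" "\<And>z. \<bar>f z\<bar> \<le> B" "q > 0"
  shows "integrable lborel (\<lambda>z. \<bar>f z\<bar> powr q)"
proof (rule csupp_integrable_bounded)
  show "csupp (\<lambda>z. \<bar>f z\<bar> powr q)" by (rule csupp_mono[OF assms(2)]) auto
  show "\<bar>\<bar>f z\<bar> powr q\<bar> \<le> B powr q" for z
    using assms(3,4) by (simp add: powr_mono2)
qed (use assms(1) in measurable)

lemma csupp_Lp_space:
  assumes "continuous_on UNIV f" "csupp f" "q > 0"
  shows "f \<in> Lp_space q MQ"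
proof -
  obtain B where "\<And>z. norm (f z) \<le> B" using csupp_bounded[OF assms(1,2)] by blast
  then show ?thesis
    using assms by (intro Lp_space_MQ_I csupp_powr_integrable[where B = B])
      (auto intro: borel_measurable_continuous_onI)
qed

lemma locally_integrable_Q_continuous:
  "continuous_on UNIV u \<Longrightarrow> locally_integrable_Q u"
  unfolding locally_integrable_Q_def set_integrable_def
  by (blast intro: borel_integrable_compact continuous_on_subset)

lemma test_QD:
  assumes "\<phi> \<in> test_Q"
  shows "Ck k \<phi>" "csupp \<phi>" "z \<notin> Q \<Longrightarrow> \<phi> z = 0"
proof -
  show "Ck k \<phi>" "csupp \<phi>"
    using assms compact_supp_csupp by (auto simp: test_Q_def test_plane_def)
  show "\<phi> z = 0" if "z \<notin> Q"
    using assms that closure_subset[of "{z. \<phi> z \<noteq> 0}"] by (auto simp: test_Q_def supp_def)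
qed

lemma dt_dx_zero:
  assumes "closed C" "\<And>z. z \<notin> C \<Longrightarrow> u z = 0" "z \<notin> C"
  shows "dt u z = 0" "dx u z = 0"
proof -
  have "dt u z = dt (\<lambda>z. 0) z" "dx u z = dx (\<lambda>z. 0) z"
    using assms by (auto intro!: dt_cong_open[of "- C"] dx_cong_open[of "- C"])
  then show "dt u z = 0" "dx u z = 0" by (simp_all add: dt_def dx_def case_prod_beta)
qed

text \<open>The function is C^1 on the whole plane and lives on a closed subset of \<open>Q\<close>,
  so its derivatives do too; integrals over \<open>Q\<close> are integrals over the plane and no
  boundary terms arise.\<close>

lemma weak_derivatives:
  assumes "Ck 1 u" "csupp u"
    and C: "closed C" "C \<subseteq> Q" "\<And>z. z \<notin> C \<Longrightarrow> u z = 0"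
  shows "weak_dt u (dt u)" "weak_dx u (dx u)"
proof -
  have z: "u z = 0" "dt u z = 0" "dx u z = 0" if "z \<notin> Q" for z
  proof -
    from that C(2) have "z \<notin> C" by auto
    then show "u z = 0" by (rule C(3))
    show "dt u z = 0" by (rule dt_dx_zero(1)[OF C(1,3) \<open>z \<notin> C\<close>])
    show "dx u z = 0" by (rule dt_dx_zero(2)[OF C(1,3) \<open>z \<notin> C\<close>])
  qed
  have "(LINT z|MQ. u z * dt \<phi> z) = - (LINT z|MQ. dt u z * \<phi> z)"
    "(LINT z|MQ. u z * dx \<phi> z) = - (LINT z|MQ. dx u z * \<phi> z)" if "\<phi> \<in> test_Q" for \<phi>
    using integral_by_parts_plane[OF assms(1,2) test_QD(1)[OF that]] z
    by (simp_all add: integral_MQ)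
  then show "weak_dt u (dt u)" "weak_dx u (dx u)"
    using Ck1D(2-4)[OF assms(1)]
    by (simp_all add: weak_dt_def weak_dx_def locally_integrable_Q_continuous)
qed

lemma lborel_integral_shift_snd:
  fixes h :: "real \<times> real \<Rightarrow> real"
  assumes [measurable]: "h \<in> borel_measurable borel"
  shows "(LINT z|lborel. h (fst z, snd z - y)) = (LINT z|lborel. h z)"
    "integrable lborel h \<Longrightarrow> integrable lborel (\<lambda>z. h (fst z, snd z - y))"
proof -
  have e: "(\<lambda>z. h (fst z, snd z - y)) = (\<lambda>z. h ((0, - y) + z))"
    by (simp add: fun_eq_iff plus_prod_def)
  show "(LINT z|lborel. h (fst z, snd z - y)) = (LINT z|lborel. h z)"
    unfolding e by (subst (2) lborel_distr_plus[of "(0, -y)", symmetric], subst integral_distr) auto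
  show "integrable lborel (\<lambda>z. h (fst z, snd z - y))" if "integrable lborel h"
    using that unfolding e
    by (subst (asm) lborel_distr_plus[of "(0, -y)", symmetric], subst (asm) integrable_distr_eq) auto
qed

text \<open>The operator averages translations over \<open>bessel_distr\<close>, so its transpose
  averages the opposite translations. The witness \<open>g\<close> is that average of
  \<open>dt v\<close>.\<close>

lemma bessel_weak_dt_exists:
  assumes "Ck 1 v" "csupp v" "\<And>z. z \<notin> Q \<Longrightarrow> v z = 0"
  shows "\<exists>g\<in>Lp_space 2 MQ. bessel_weak_dt v g"
proof -
  let ?B = bessel_distr
  interpret P: pair_sigma_finite "lborel :: (real \<times> real) measure" ?B ..
  define w where "w = dt v"
  have cw: "continuous_on UNIV w" "csupp w" and cv: "continuous_on UNIV v"
    unfolding w_def by (fact Ck1D[OF assms(1)] csupp_dt[OF assms(2)])+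
  have [measurable]: "w \<in> borel_measurable borel" "v \<in> borel_measurable borel"
    using cw cv by (simp_all add: borel_measurable_continuous_onI)
  obtain W where W: "W \<ge> 0" "\<And>z. norm (w z) \<le> W" using csupp_bounded[OF cw] by blast
  define g where "g = (\<lambda>z. LINT y|?B. w (fst z, snd z - y))"
  have wi: "integrable lborel w" by (rule csupp_integrable[OF cw])
  note shift = lborel_integral_shift_snd
  have wyi: "integrable ?B (\<lambda>y. w (fst z, snd z - y))" for z
    by (rule bessel_distr.integrable_const_bound[of _ W]) (use W in auto)
  \<comment> \<open>Measurability is transferred from the Borel sets of the triple product;
    \<open>c = -1\<close> serves \<open>w\<close> and \<open>c = 1\<close> serves the test
    function.\<close>
  have hm: "(\<lambda>p. h (fst (fst p), snd (fst p) + c * snd p)) \<in> borel_measurable (lborel \<Otimes>\<^sub>M ?B)"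
    if "h \<in> borel_measurable borel" for h :: "real \<times> real \<Rightarrow> real" and c
  proof -
    have "sets ((lborel :: (real \<times> real) measure) \<Otimes>\<^sub>M ?B) = sets (borel \<Otimes>\<^sub>M borel)"
      by (intro sets_pair_measure_cong) auto
    then have "sets (lborel \<Otimes>\<^sub>M ?B) = sets (borel :: ((real \<times> real) \<times> real) measure)"
      by (simp only: borel_prod)
    moreover have "(\<lambda>p::(real \<times> real) \<times> real. (fst (fst p), snd (fst p) + c * snd p)) \<in> borel_measurable borel"
      by (intro borel_measurable_continuous_onI continuous_intros)
    ultimately show ?thesis
      using measurable_compose[OF _ that] by (simp cong: measurable_cong_sets)
  qed
  have mh [measurable]: "(\<lambda>p. w (fst (fst p), snd (fst p) - snd p)) \<in> borel_measurable (lborel \<Otimes>\<^sub>M ?B)"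
    using hm[of w "-1"] by simp
  have wint: "integrable (lborel \<Otimes>\<^sub>M ?B) (\<lambda>p. w (fst (fst p), snd (fst p) - snd p))"
    unfolding P.integrable_product_swap_iff[symmetric]
  proof -
    interpret P': pair_sigma_finite ?B "lborel :: (real \<times> real) measure" ..
    show "integrable (?B \<Otimes>\<^sub>M lborel) (\<lambda>(x, y). w (fst (fst (y, x)), snd (fst (y, x)) - snd (y, x)))"
    proof (rule P'.Fubini_integrable)
      have "(LINT y|lborel. norm (w (fst y, snd y - x))) = (LINT y|lborel. \<bar>w y\<bar>)" for x
        using shift(1)[of "\<lambda>z. \<bar>w z\<bar>" x] by simp
      then show "integrable ?B (\<lambda>x. LINT y|lborel. norm (case (x, y) of (x, y) \<Rightarrow> w (fst (fst (y, x)), snd (fst (y, x)) - snd (y, x))))"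
        by simp
      show "AE x in ?B. integrable lborel (\<lambda>y. case (x, y) of (x, y) \<Rightarrow> w (fst (fst (y, x)), snd (fst (y, x)) - snd (y, x)))"
        using shift(2)[OF _ wi] by simp
    qed measurable
  qed
  have gi: "integrable lborel g"
    using P.integrable_fst'[OF wint] by (simp add: g_def)
  have gW: "\<bar>g z\<bar> \<le> W" for z
  proof -
    have "\<bar>g z\<bar> \<le> (LINT y|?B. norm (w (fst z, snd z - y)))"
      unfolding g_def using integral_norm_bound[of ?B "\<lambda>y. w (fst z, snd z - y)"] by simp
    also have "\<dots> \<le> (LINT y|?B. W)"
      by (rule integral_mono) (use W wyi in auto)
    also have "\<dots> = W" using bessel_distr.prob_space by simp
    finally show ?thesis .
  qed
  have [measurable]: "g \<in> borel_measurable borel" using gi by simp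
  \<comment> \<open>\<open>g\<close> is integrable and bounded by \<open>W\<close>, so its square is
    dominated by \<open>W * \<bar>g\<bar>\<close>.\<close>
  have "integrable lborel (\<lambda>z. \<bar>g z\<bar> powr 2)"
  proof (rule Bochner_Integration.integrable_bound)
    show "integrable lborel (\<lambda>z. W * g z)" using gi by simp
    show "AE z in lborel. norm (\<bar>g z\<bar> powr 2) \<le> norm (W * g z)"
    proof (intro AE_I2)
      fix z
      have "\<bar>g z\<bar> * \<bar>g z\<bar> \<le> W * \<bar>g z\<bar>" by (intro mult_right_mono gW) simp
      then show "norm (\<bar>g z\<bar> powr 2) \<le> norm (W * g z)"
        using W(1) by (simp add: abs_mult power2_eq_square)
    qed
  qed measurable
  then have "g \<in> Lp_space 2 MQ" by (intro Lp_space_MQ_I) auto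
  moreover have "bessel_weak_dt v g"
    unfolding bessel_weak_dt_def
  proof
    fix \<phi> assume p: "\<phi> \<in> test_Q"
    have Ck1p: "Ck 1 \<phi>" and Ck1t: "Ck 1 (dt \<phi>)" and sp: "csupp \<phi>" and zp: "\<And>z. z \<notin> Q \<Longrightarrow> \<phi> z = 0"
      using test_QD[OF p] Ck2D(3)[OF test_QD(1)[OF p]] by blast+
    have [measurable]: "\<phi> \<in> borel_measurable borel" "dt \<phi> \<in> borel_measurable borel"
      by (intro borel_measurable_continuous_onI Ck1D[OF Ck1p])+
    obtain A where A: "A \<ge> 0" "\<And>z. norm (\<phi> z) \<le> A"
      using csupp_bounded[OF Ck1D(2)[OF Ck1p] sp] by blast
    obtain A' where A': "A' \<ge> 0" "\<And>z. norm (dt \<phi> z) \<le> A'"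
      using csupp_bounded[OF Ck1D(3)[OF Ck1p] csupp_dt[OF sp]] by blast
    have vi: "integrable lborel v" by (rule csupp_integrable[OF cv assms(2)])
    have "(\<lambda>p. v (fst p) * dt \<phi> (fst (fst p), snd (fst p) + 1 * snd p)) \<in> borel_measurable (lborel \<Otimes>\<^sub>M ?B)"
      by (intro borel_measurable_times hm measurable_compose[OF measurable_fst]) auto
    then have mi [measurable]: "(\<lambda>(z, y). v z * dt \<phi> (fst z, snd z + y)) \<in> borel_measurable (lborel \<Otimes>\<^sub>M ?B)"
      by (simp add: case_prod_beta)
    have i1: "integrable (lborel \<Otimes>\<^sub>M ?B) (\<lambda>(z, y). v z * dt \<phi> (fst z, snd z + y))"
    proof (rule P.Fubini_integrable[OF mi])
      have i: "integrable ?B (\<lambda>y. dt \<phi> (fst z, snd z + y))" for z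
        by (rule bessel_distr.integrable_const_bound[of _ A']) (use A' in auto)
      show "integrable lborel (\<lambda>z. LINT y|?B. norm (case (z, y) of (z, y) \<Rightarrow> v z * dt \<phi> (fst z, snd z + y)))"
      proof (rule Bochner_Integration.integrable_bound)
        show "integrable lborel (\<lambda>z. A' * v z)" using vi by simp
        have "(LINT y|?B. \<bar>dt \<phi> (fst z, snd z + y)\<bar>) \<le> (LINT y|?B. A')" for z
          by (rule integral_mono) (use A' i in auto)
        then have "(LINT y|?B. \<bar>dt \<phi> (fst z, snd z + y)\<bar>) \<le> A'" for z
          using bessel_distr.prob_space by simp
        then show "AE z in lborel. norm (LINT y|?B. norm (case (z, y) of (z, y) \<Rightarrow> v z * dt \<phi> (fst z, snd z + y)))
            \<le> norm (A' * v z)"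
          using A'(1) mult_left_mono[of _ A' "\<bar>v _\<bar>"]
          by (intro AE_I2) (simp add: abs_mult mult.commute[of A'])
      qed measurable
      show "AE z in lborel. integrable ?B (\<lambda>y. case (z, y) of (z, y) \<Rightarrow> v z * dt \<phi> (fst z, snd z + y))"
        using i by simp
    qed
    have i2: "integrable (lborel \<Otimes>\<^sub>M ?B) (\<lambda>(z, y). w (fst z, snd z - y) * \<phi> z)"
      by (rule Bochner_Integration.integrable_bound[OF integrable_mult_right[OF wint, of A]])
         (use A mult_left_mono[of "\<bar>\<phi> _\<bar>" A "\<bar>w _\<bar>"] in
           \<open>auto simp: abs_mult mult.commute[of A] intro!: AE_I2\<close>)
    have "(LINT z|MQ. v z * bessel_x (dt \<phi>) z) = (LINT z|lborel. v z * bessel_x (dt \<phi>) z)"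
      using assms(3) by (simp add: integral_MQ)
    also have "\<dots> = (LINT z|lborel. LINT y|?B. v z * dt \<phi> (fst z, snd z + y))"
      using bessel_x_eq[OF Ck1t csupp_dt[OF sp]] by (intro Bochner_Integration.integral_cong refl) (auto simp: split_beta)
    also have "\<dots> = (LINT y|?B. LINT z|lborel. v z * dt \<phi> (fst z, snd z + y))"
      using P.Fubini_integral[OF i1] by simp
    \<comment> \<open>For each fixed shift \<open>y\<close> the time derivative moves from the
      translated test function to \<open>v\<close>, and a change of variables then moves the shift
      to \<open>w\<close>.\<close>
    also have "\<dots> = (LINT y|?B. - (LINT z|lborel. w (fst z, snd z - y) * \<phi> z))"
    proof (intro Bochner_Integration.integral_cong refl)
      fix y
      have d: "\<And>z. \<phi> differentiable (at z)" by (rule Ck1D[OF Ck1p])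
      define \<phi>' where "\<phi>' = (\<lambda>z. \<phi> (1 * fst z + 0, 1 * snd z + y))"
      have cp: "Ck 1 \<phi>'" unfolding \<phi>'_def by (rule Ck_affine[OF Ck1p])
      have mp: "(\<lambda>z. w z * \<phi>' z) \<in> borel_measurable borel"
        by (intro borel_measurable_continuous_onI continuous_intros cw Ck_continuous[OF cp])
      note cp
      moreover have "dt \<phi>' = (\<lambda>z. dt \<phi> (fst z, snd z + y))"
        unfolding \<phi>'_def dt_affine[OF d] by simp
      ultimately have "(LINT z|lborel. v z * dt \<phi> (fst z, snd z + y)) = - (LINT z|lborel. w z * \<phi>' z)"
        using integral_by_parts_plane(1)[OF assms(1,2), of \<phi>'] by (simp add: w_def)
      also have "(LINT z|lborel. w z * \<phi>' z) = (LINT z|lborel. w (fst z, snd z - y) * \<phi>' (fst z, snd z - y))"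
        using shift(1)[OF mp, of y] by simp
      also have "\<dots> = (LINT z|lborel. w (fst z, snd z - y) * \<phi> z)"
        by (simp add: \<phi>'_def)
      finally show "(LINT z|lborel. v z * dt \<phi> (fst z, snd z + y)) = - (LINT z|lborel. w (fst z, snd z - y) * \<phi> z)" .
    qed
    also have "\<dots> = - (LINT y|?B. LINT z|lborel. w (fst z, snd z - y) * \<phi> z)" by simp
    also have "(LINT y|?B. LINT z|lborel. w (fst z, snd z - y) * \<phi> z) =
        (LINT z|lborel. LINT y|?B. w (fst z, snd z - y) * \<phi> z)"
      using P.Fubini_integral[OF i2] by simp
    also have "\<dots> = (LINT z|lborel. g z * \<phi> z)" by (simp add: g_def)
    also have "\<dots> = (LINT z|MQ. g z * \<phi> z)" using zp by (simp add: integral_MQ)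
    finally show "- (LINT z|MQ. v z * bessel_x (dt \<phi>) z) = (LINT z|MQ. g z * \<phi> z)" by simp
  qed
  ultimately show ?thesis by blast
qed

lemma Lp2_norm_le:
  assumes "h \<in> borel_measurable borel" "\<And>x. \<bar>h x\<bar> \<le> c * indicator {-R..R} x" "c \<ge> 0" "R \<ge> 0"
  shows "h \<in> Lp_space 2 lborel" "Lp_norm 2 lborel h \<le> ennreal (c * sqrt (2 * R))"
proof -
  have "(\<integral>\<^sup>+ x. ennreal (\<bar>h x\<bar> powr 2) \<partial>lborel) \<le> (\<integral>\<^sup>+ x. ennreal (c\<^sup>2) * indicator {-R..R} x \<partial>lborel)"
  proof (rule nn_integral_mono)
    fix x show "ennreal (\<bar>h x\<bar> powr 2) \<le> ennreal (c\<^sup>2) * indicator {-R..R} x"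
      using assms(2)[of x] assms(3)
      by (auto simp: indicator_def abs_le_square_iff[symmetric] intro!: ennreal_leI split: if_splits)
  qed
  also have "\<dots> = ennreal (c\<^sup>2 * (2 * R))"
    using assms(4) by (subst nn_integral_cmult_indicator) (auto simp: ennreal_mult)
  finally have *: "(\<integral>\<^sup>+ x. ennreal (\<bar>h x\<bar> powr 2) \<partial>lborel) \<le> ennreal (c\<^sup>2 * (2 * R))" .
  then show L: "h \<in> Lp_space 2 lborel"
    using assms(1) by (auto simp: Lp_space_def intro: le_less_trans)
  have "enn2real (\<integral>\<^sup>+ x. ennreal (\<bar>h x\<bar> powr 2) \<partial>lborel) \<le> c\<^sup>2 * (2 * R)"
    using enn2real_mono[OF *] assms(4) by simp
  then have "enn2real (\<integral>\<^sup>+ x. ennreal (\<bar>h x\<bar> powr 2) \<partial>lborel) powr (1 / 2) \<le> (c\<^sup>2 * (2 * R)) powr (1 / 2)"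
    by (intro powr_mono2) auto
  also have "\<dots> = c * sqrt (2 * R)"
    using assms(3,4) by (simp add: powr_half_sqrt real_sqrt_mult)
  finally show "Lp_norm 2 lborel h \<le> ennreal (c * sqrt (2 * R))"
    using L by (simp add: Lp_norm_def ennreal_leI)
qed

text \<open>The pointwise values of \<open>u\<close> already form the continuous representative:
  \<open>u\<close> is Lipschitz in \<open>t\<close> uniformly in \<open>x\<close>, and all time
  slices live in one bounded interval, so the slices are Lipschitz in L2.\<close>

lemma initial_value_zero:
  assumes "Ck 1 u" "csupp u" "\<And>x. u (0, x) = 0"
  shows "initial_value u (\<lambda>x. 0)"
proof -
  obtain R0 where R0: "\<And>z. u z \<noteq> 0 \<Longrightarrow> norm z \<le> R0" using assms unfolding csupp_def by blast
  define R where "R = max R0 0"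
  have R: "u (t, x) = 0" if "x \<notin> {-R..R}" for t x
  proof (rule ccontr)
    assume "u (t, x) \<noteq> 0"
    from R0[OF this] have "\<bar>x\<bar> \<le> R" using norm_snd_le[of x t] by (auto simp: R_def)
    with that show False by auto
  qed
  have cu: "continuous_on UNIV u" "continuous_on UNIV (dt u)" by (rule Ck1D[OF assms(1)])+
  obtain L where L: "L \<ge> 0" "\<And>z. norm (dt u z) \<le> L"
    using csupp_bounded[OF cu(2) csupp_dt[OF assms(2)]] by blast
  obtain B where B: "B \<ge> 0" "\<And>z. norm (u z) \<le> B"
    using csupp_bounded[OF cu(1) assms(2)] by blast
  have m [measurable]: "(\<lambda>x. u (t, x)) \<in> borel_measurable borel" for t
    by (intro borel_measurable_continuous_onI continuous_on_slice cu)
  have Lip: "\<bar>u (s, x) - u (t, x)\<bar> \<le> L * \<bar>s - t\<bar>" for s t x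
  proof -
    have "norm (u (s, x) - u (t, x)) \<le> L * norm (s - t)"
      by (rule field_differentiable_bound[of UNIV "\<lambda>s. u (s, x)" "\<lambda>s. dt u (s, x)"])
         (use dt_DERIV[OF Ck1D(1)[OF assms(1)]] L in auto)
    then show ?thesis by simp
  qed
  show ?thesis unfolding initial_value_def
  proof (intro exI[of _ "\<lambda>t x. u (t, x)"] conjI ballI)
    fix t :: real
    show "(\<lambda>x. u (t, x)) \<in> Lp_space 2 lborel"
      by (rule Lp2_norm_le(1)[of _ B R]) (use B R in \<open>auto simp: R_def indicator_def\<close>)
    have le: "Lp_norm 2 lborel (\<lambda>x. u (s, x) - u (t, x)) \<le> ennreal (L * \<bar>s - t\<bar> * sqrt (2 * R))" for s
      by (rule Lp2_norm_le(2)) (use Lip R L in \<open>auto simp: R_def indicator_def\<close>)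
    have "((\<lambda>s. L * \<bar>s - t\<bar> * sqrt (2 * R)) \<longlongrightarrow> L * \<bar>t - t\<bar> * sqrt (2 * R)) (at t within {0..1})"
      by (intro tendsto_intros)
    then have lim: "((\<lambda>s. ennreal (L * \<bar>s - t\<bar> * sqrt (2 * R))) \<longlongrightarrow> 0) (at t within {0..1})"
      using tendsto_ennrealI by fastforce
    show "((\<lambda>s. Lp_norm 2 lborel (\<lambda>x. u (s, x) - u (t, x))) \<longlongrightarrow> 0) (at t within {0..1})"
      by (rule tendsto_sandwich[OF _ _ tendsto_const lim]) (use le in auto)
  qed (use assms(3) in auto)
qed

text \<open>For the divergence form, \<open>integral_dx_dt_swap\<close> replaces
  \<open>u_x \<phi>_t\<close> by \<open>u_t \<phi>_x\<close>, after which the integrand is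
  \<open>(u_t - a u_xx) \<phi>_x\<close>. Boundary terms at \<open>t = 0\<close> and
  \<open>t = 1\<close> are absent because \<open>u\<close> vanishes off a closed subset of the open
  strip. The coefficient is never differentiated, so it may be discontinuous.\<close>

lemma smooth_solutions:
  assumes u: "Ck 2 u" "csupp u"
    and C: "closed C" "C \<subseteq> Q" "\<And>z. z \<notin> C \<Longrightarrow> u z = 0"
    and a: "a \<in> borel_measurable borel" "\<And>z. \<bar>a z\<bar> \<le> K"
    and f: "f = (\<lambda>z. dt u z - a z * dx (dx u) z)"
  shows "strong_solution a f u (dt u) (dx u) (dx (dx u))"
    "weak_solution a f (dx u) (dx (dx u))"
proof -
  note C1 = Ck2D(1)[OF u(1)] Ck2D(4)[OF u(1)]
  note cont = Ck1D[OF C1(1)] Ck1D[OF C1(2)]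
  note s = u(2) csupp_dt[OF u(2)] csupp_dx[OF u(2)] csupp_dx[OF csupp_dx[OF u(2)]]
  have z: "dx u z = 0" if "z \<notin> C" for z by (rule dt_dx_zero(2)[OF C(1,3) that])
  have zz: "dx (dx u) z = 0" if "z \<notin> C" for z using dt_dx_zero(2)[OF C(1) z that] .
  have zt: "dt u z = 0" if "z \<notin> C" for z by (rule dt_dx_zero(1)[OF C(1,3) that])
  have W: "weak_dt u (dt u)" "weak_dx u (dx u)" "weak_dx (dx u) (dx (dx u))"
    using weak_derivatives[OF C1(1) u(2) C] weak_derivatives[OF C1(2) s(3) C(1,2) z] by auto
  have L: "u \<in> Lp_space 2 MQ" "dt u \<in> Lp_space 2 MQ" "dx u \<in> Lp_space 2 MQ" "dx (dx u) \<in> Lp_space 2 MQ"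
    by (intro csupp_Lp_space cont s; simp)+
  have u0: "u (0, x) = 0" for x
    by (rule C(3)) (use C(2) in \<open>auto simp: Q_def\<close>)
  show "strong_solution a f u (dt u) (dx u) (dx (dx u))"
    using W L initial_value_zero[OF C1(1) u(2) u0]
    by (simp add: strong_solution_def W12_2_def f)
  have "(LINT z|MQ. dx u z * dt \<phi> z - a z * dx (dx u) z * dx \<phi> z) = (LINT z|MQ. f z * dx \<phi> z)"
    if p: "\<phi> \<in> test_plane" for \<phi>
  proof -
    have p2: "Ck 2 \<phi>" using p by (auto simp: test_plane_def)
    note cp = Ck1D[OF Ck2D(1)[OF p2]]
    have m: "dx (dx u) \<in> borel_measurable borel" "dx \<phi> \<in> borel_measurable borel"
      by (intro borel_measurable_continuous_onI cont cp)+
    have i: "integrable lborel (\<lambda>z. dx u z * dt \<phi> z)" "integrable lborel (\<lambda>z. dt u z * dx \<phi> z)"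
      by (intro csupp_integrable continuous_intros cont cp; rule csupp_mono[OF s(2)] csupp_mono[OF s(3)]; simp)+
    have ii: "integrable lborel (\<lambda>z. dx (dx u) z * dx \<phi> z)"
      by (intro csupp_integrable continuous_intros cont cp; rule csupp_mono[OF s(4)]; simp)
    have i3: "integrable lborel (\<lambda>z. a z * dx (dx u) z * dx \<phi> z)"
    proof (rule Bochner_Integration.integrable_bound[OF integrable_mult_right[OF ii, of K]])
      show "(\<lambda>z. a z * dx (dx u) z * dx \<phi> z) \<in> borel_measurable lborel"
        using a(1) m by simp
      have "\<bar>a z\<bar> * \<bar>dx (dx u) z * dx \<phi> z\<bar> \<le> \<bar>K\<bar> * \<bar>dx (dx u) z * dx \<phi> z\<bar>" for z
        using a(2)[of z] by (intro mult_right_mono) auto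
      then show "AE z in lborel. norm (a z * dx (dx u) z * dx \<phi> z) \<le> norm (K * (dx (dx u) z * dx \<phi> z))"
        by (intro AE_I2) (simp add: abs_mult mult.assoc)
    qed
    have "(LINT z|MQ. dx u z * dt \<phi> z - a z * dx (dx u) z * dx \<phi> z) =
        (LINT z|lborel. dx u z * dt \<phi> z - a z * dx (dx u) z * dx \<phi> z)"
      using z zz C(2) by (intro integral_MQ) (metis diff_self mult_zero_left mult_zero_right subsetD)
    also have "\<dots> = (LINT z|lborel. dx u z * dt \<phi> z) - (LINT z|lborel. a z * dx (dx u) z * dx \<phi> z)"
      using i i3 by simp
    also have "(LINT z|lborel. dx u z * dt \<phi> z) = (LINT z|lborel. dt u z * dx \<phi> z)"
      by (rule integral_dx_dt_swap[OF C1(1) u(2) p2])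
    also have "\<dots> - (LINT z|lborel. a z * dx (dx u) z * dx \<phi> z) = (LINT z|lborel. f z * dx \<phi> z)"
      using i i3 by (simp add: f left_diff_distrib)
    also have "\<dots> = (LINT z|MQ. f z * dx \<phi> z)"
      using zt zz C(2) by (intro integral_MQ[symmetric]) (metis diff_self mult_zero_left mult_zero_right subsetD f)
    finally show ?thesis .
  qed
  then show "weak_solution a f (dx u) (dx (dx u))"
    using W L bessel_weak_dt_exists[OF C1(2) s(3) z[OF contra_subsetD[OF C(2)]]]
    by (simp add: weak_solution_def H1_2_def)
qed

section \<open>Fast oscillations\<close>

definition unit_periodic :: "(real \<times> real \<Rightarrow> 'a) \<Rightarrow> bool" where
  "unit_periodic u \<longleftrightarrow> (\<forall>t x. u (t + 1, x) = u (t, x) \<and> u (t, x + 1) = u (t, x))"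

definition periodic1 :: "(real \<Rightarrow> 'a) \<Rightarrow> bool" where
  "periodic1 g \<longleftrightarrow> (\<forall>t. g (t + 1) = g t)"

lemma periodic1_int: "periodic1 g \<Longrightarrow> g (t + of_int k) = g t"
proof -
  assume "periodic1 g"
  then interpret periodic_fun_simple' g by unfold_locales (simp add: periodic1_def)
  show ?thesis by (rule plus_of_int)
qed

lemma periodic1_nat: "periodic1 g \<Longrightarrow> g (t + of_nat k) = g t"
  using periodic1_int[of g t "int k"] by simp

lemma periodic1_frac: "periodic1 g \<Longrightarrow> g t = g (frac t)"
  using periodic1_int[of g "frac t" "\<lfloor>t\<rfloor>"] by (simp add: frac_def)

lemma unit_periodic_slice:
  assumes "unit_periodic u"
  shows "periodic1 (\<lambda>t. u (t, x))" "periodic1 (\<lambda>x. u (t, x))"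
  using assms by (auto simp: unit_periodic_def periodic1_def)

lemma unit_periodic_bounded:
  fixes u :: "real \<times> real \<Rightarrow> real"
  assumes "unit_periodic u" "continuous_on UNIV u"
  obtains B where "B \<ge> 0" "\<And>z. \<bar>u z\<bar> \<le> B"
proof -
  have "compact (u ` ({0..1} \<times> {0..1}))"
    by (intro compact_continuous_image continuous_on_subset[OF assms(2)] compact_Times) auto
  then obtain B where B: "\<And>z. z \<in> {0..1} \<times> {0..1} \<Longrightarrow> \<bar>u z\<bar> \<le> B"
    by (force dest!: compact_imp_bounded simp: bounded_iff)
  have "\<bar>u z\<bar> \<le> B" for z
  proof -
    obtain t x where z: "z = (t, x)" by (cases z)
    have "u z = u (frac t, frac x)"
      using periodic1_frac[OF unit_periodic_slice(1)[OF assms(1)], of t x]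
        periodic1_frac[OF unit_periodic_slice(2)[OF assms(1)], of "frac t" x] z by simp
    then show ?thesis
      using B[of "(frac t, frac x)"] by (simp add: frac_ge_0 frac_lt_1 less_imp_le)
  qed
  then show ?thesis using that[of B] by (meson abs_ge_zero order_trans)
qed

lemma unit_periodic_dt:
  assumes "unit_periodic u" shows "unit_periodic (dt u)" "unit_periodic (dx u)"
proof -
  have *: "deriv g (t + 1) = deriv g t" if "periodic1 g" for g :: "real \<Rightarrow> real" and t
  proof -
    have "deriv g (t + 1) = deriv (\<lambda>s. g (s + 1)) t"
      by (simp add: deriv_def DERIV_shift)
    then show ?thesis using that by (simp add: periodic1_def)
  qed
  have e: "(\<lambda>s. u (s, x + 1)) = (\<lambda>s. u (s, x))" "(\<lambda>y. u (t + 1, y)) = (\<lambda>y. u (t, y))" for t x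
    using assms by (simp_all add: unit_periodic_def)
  show "unit_periodic (dt u)" "unit_periodic (dx u)"
    unfolding unit_periodic_def dt_def dx_def prod.case e
    by (intro allI conjI refl *[OF unit_periodic_slice(1)[OF assms]] *[OF unit_periodic_slice(2)[OF assms]])+
qed

text \<open>Mean zero makes the antiderivative periodic: \<open>F (t + 1) - F t\<close> is constant
  and equals the integral over a period. Subtracting the mean permits a second application, as
  oscillations in \<open>x\<close> require.\<close>

lemma periodic_antiderivative:
  assumes "continuous_on UNIV g" "periodic1 g" "integral {0..1} g = (0::real)"
  obtains G where "\<And>t. (G has_real_derivative g t) (at t)" "periodic1 G" "integral {0..1} G = 0"
proof -
  have "\<exists>F. \<forall>x. -\<infinity> < ereal x \<longrightarrow> ereal x < \<infinity> \<longrightarrow> (F has_vector_derivative g x) (at x)"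
    using assms(1) by (intro einterval_antiderivative) (auto simp: continuous_on_eq_continuous_at)
  then obtain F where F: "\<And>t. (F has_real_derivative g t) (at t)"
    by (auto simp: has_real_derivative_iff_has_vector_derivative)
  have "((\<lambda>t. F (t + 1) - F t) has_real_derivative 0) (at t)" for t
    using DERIV_diff[of "\<lambda>t. F (t + 1)" "g (t + 1)" t UNIV F "g t"] F[of "t + 1"] F[of t] assms(2)
    by (simp add: DERIV_shift periodic1_def)
  then have c: "F (t + 1) - F t = F (0 + 1) - F 0" for t
    using DERIV_isconst_all[of "\<lambda>t. F (t + 1) - F t"] by blast
  have "(g has_integral F 1 - F 0) {0..1}"
    using F by (intro fundamental_theorem_of_calculus)
      (simp_all add: has_real_derivative_iff_has_vector_derivative has_vector_derivative_at_within)
  then have "F 1 - F 0 = 0" using assms(3) by (metis integral_unique)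
  then have p: "F (t + 1) = F t" for t using c[of t] by simp
  define m where "m = integral {0..1} F"
  have "continuous_on {0..1} F"
    using F by (meson DERIV_continuous_on has_field_derivative_at_within)
  then have "integral {0..1} (\<lambda>t. F t - m) = 0"
    by (subst Henstock_Kurzweil_Integration.integral_diff) (auto simp: m_def intro: integrable_continuous_real)
  moreover have "((\<lambda>t. F t - m) has_real_derivative g t) (at t)" for t
    using F by (auto intro!: derivative_eq_intros)
  ultimately show ?thesis using that[of "\<lambda>t. F t - m"] p by (simp add: periodic1_def)
qed

text \<open>After removal of its mean, \<open>g\<close> has a periodic antiderivative
  \<open>D\<close>, which stays within \<open>2 * K\<close> of \<open>D 0\<close>. The oscillating
  part therefore integrates to a difference of two values of \<open>D\<close> divided by
  \<open>N\<close>.\<close>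

lemma oscillation_interval:
  fixes g :: "real \<Rightarrow> real"
  assumes g: "continuous_on UNIV g" "periodic1 g" "\<And>t. \<bar>g t\<bar> \<le> K" and "a \<le> b" "N > 0"
  shows "\<bar>(LINT s:{a<..<b}|lborel. g (N * s)) - (b - a) * integral {0..1} g\<bar> \<le> 4 * K / N"
proof -
  define m where "m = integral {0..1} g"
  have gi: "g integrable_on {0..1}"
    using g(1) by (intro integrable_continuous_real) (rule continuous_on_subset, auto)
  have mK: "\<bar>m\<bar> \<le> K"
    using integral_bound[of 0 1 g K] continuous_on_subset[OF g(1)] g(3) by (simp add: m_def)
  obtain D where D: "\<And>t. (D has_real_derivative g t - m) (at t)" "periodic1 D"
  proof (rule periodic_antiderivative[of "\<lambda>t. g t - m"])
    show "integral {0..1} (\<lambda>t. g t - m) = 0"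
      using gi by (subst Henstock_Kurzweil_Integration.integral_diff) (auto simp: m_def)
  qed (use g that in \<open>auto intro!: continuous_intros simp: periodic1_def\<close>)
  have Db: "\<bar>D y - D 0\<bar> \<le> 2 * K" for y
  proof -
    have "norm (D (frac y) - D 0) \<le> 2 * K * norm (frac y - 0)"
    proof (rule field_differentiable_bound[of UNIV D "\<lambda>t. g t - m"])
      show "norm (g z - m) \<le> 2 * K" for z using g(3)[of z] mK by simp
    qed (use D in auto)
    also have "\<dots> \<le> 2 * K * 1"
      using mK by (intro mult_left_mono) (auto simp: frac_ge_0 frac_lt_1 less_imp_le)
    finally show ?thesis using periodic1_frac[OF D(2), of y] by simp
  qed
  have "((\<lambda>s. g (N * s)) has_integral (D (N * b) / N + m * b) - (D (N * a) / N + m * a)) {a..b}"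
  proof (rule fundamental_theorem_of_calculus[OF \<open>a \<le> b\<close>])
    fix s
    have "((\<lambda>s. D (N * s) / N + m * s) has_real_derivative g (N * s)) (at s)"
      using \<open>N > 0\<close> by (auto intro!: derivative_eq_intros DERIV_chain2[OF D(1)])
    then show "((\<lambda>s. D (N * s) / N + m * s) has_vector_derivative g (N * s)) (at s within {a..b})"
      by (simp add: has_real_derivative_iff_has_vector_derivative has_vector_derivative_at_within)
  qed
  then have "integral {a..b} (\<lambda>s. g (N * s)) = (D (N * b) / N + m * b) - (D (N * a) / N + m * a)"
    by (rule integral_unique)
  then have "integral {a<..<b} (\<lambda>s. g (N * s)) = (D (N * b) - D (N * a)) / N + (b - a) * m"
    by (simp add: integral_open_interval_real algebra_simps diff_divide_distrib)
  moreover have "(LINT s:{a<..<b}|lborel. g (N * s)) = integral {a<..<b} (\<lambda>s. g (N * s))"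
  proof (rule set_borel_integral_eq_integral)
    have "set_integrable lborel {a..b} (\<lambda>s. g (N * s))"
      by (intro borel_integrable_atLeastAtMost' continuous_intros continuous_on_compose2[OF g(1)]) auto
    then show "set_integrable lborel {a<..<b} (\<lambda>s. g (N * s))"
      by (rule set_integrable_subset) auto
  qed
  ultimately have "(LINT s:{a<..<b}|lborel. g (N * s)) - (b - a) * m = (D (N * b) - D (N * a)) / N"
    by simp
  moreover have "\<bar>(D (N * b) - D (N * a)) / N\<bar> \<le> 4 * K / N"
    using Db[of "N * b"] Db[of "N * a"] \<open>N > 0\<close> by (auto simp: abs_divide intro!: divide_right_mono)
  ultimately show ?thesis by (simp add: m_def)
qed

abbreviation cell :: "(real \<times> real) set" where
  "cell \<equiv> {0..1} \<times> {0..1}"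

lemma set_integrable_bounded_continuous:
  fixes f :: "'a::euclidean_space \<Rightarrow> real"
  assumes "continuous_on UNIV f" "A \<in> sets borel" "bounded A"
  shows "set_integrable lborel A f"
proof -
  obtain R where "\<forall>x\<in>A. norm x \<le> R" using assms(3) by (auto simp: bounded_iff)
  then have R: "A \<subseteq> cball 0 R" by auto
  have "set_integrable lborel (cball 0 R) f"
    unfolding set_integrable_def
    by (intro borel_integrable_compact continuous_on_subset[OF assms(1)]) auto
  then show ?thesis by (rule set_integrable_subset) (use assms R in auto)
qed

lemma set_integral_Times:
  fixes f :: "real \<times> real \<Rightarrow> real"
  assumes "set_integrable lborel (A \<times> B) f"
  shows "(LINT z:A \<times> B|lborel. f z) = (LINT t:A|lborel. LINT x:B|lborel. f (t, x))"
proof -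
  have "(LINT z:A \<times> B|lborel. f z) =
      (LINT t|lborel. LINT x|lborel. indicator (A \<times> B) (t, x) *\<^sub>R f (t, x))"
    using integral_plane(1)[OF assms[unfolded set_integrable_def]]
    by (simp add: set_lebesgue_integral_def)
  then show ?thesis
    by (simp add: set_lebesgue_integral_def indicator_times mult.assoc)
qed

text \<open>Average in \<open>x\<close> first, at frequency \<open>n\<close> and uniformly in
  \<open>t\<close>; then average the mean \<open>fb\<close> in \<open>t\<close> at frequency
  \<open>n\<^sup>2\<close>. Each of the two steps costs at most \<open>4 * K / n\<close>.\<close>

lemma oscillation_box:
  fixes f :: "real \<times> real \<Rightarrow> real"
  assumes f: "continuous_on UNIV f" "unit_periodic f" "\<And>z. \<bar>f z\<bar> \<le> K"
    and ab: "0 \<le> a" "a \<le> b" "b \<le> 1" "0 \<le> c" "c \<le> d" "d \<le> 1" and "n \<ge> 1"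
  shows "\<bar>(LINT z:{a<..<b} \<times> {c<..<d}|lborel. f (n\<^sup>2 * fst z, n * snd z)) -
      (b - a) * (d - c) * (LINT z:cell|lborel. f z)\<bar> \<le> 8 * K / n"
proof -
  define fb where "fb t = integral {0..1} (\<lambda>x. f (t, x))" for t
  have K: "K \<ge> 0" using f(3)[of 0] by (meson abs_ge_zero order_trans)
  note n = \<open>n \<ge> 1\<close>
  have cfx: "continuous_on UNIV (\<lambda>x. f (t, x))" for t by (rule continuous_on_slice[OF f(1)])
  have cfb: "continuous_on UNIV fb"
    unfolding fb_def
    using integral_continuous_on_param[of UNIV 0 1 "\<lambda>t x. f (t, x)"] f(1)
    by (simp add: case_prod_beta continuous_on_subset)
  have pfb: "periodic1 fb"
    using f(2) by (simp add: fb_def periodic1_def unit_periodic_def)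
  have bfb: "\<bar>fb t\<bar> \<le> K" for t
    using integral_bound[of 0 1 "\<lambda>x. f (t, x)" K] continuous_on_subset[OF cfx] f(3)
    by (simp add: fb_def)
  have int_eq: "(LINT s:{0..1}|lborel. g s) = integral {0..1} g" if "continuous_on UNIV g" for g :: "real \<Rightarrow> real"
    using that by (intro set_borel_integral_eq_integral set_integrable_bounded_continuous) auto
  have A: "(LINT z:cell|lborel. f z) = integral {0..1} fb"
  proof (subst set_integral_Times)
    show "set_integrable lborel cell f"
      by (intro set_integrable_bounded_continuous f bounded_Times borel_closed closed_Times) auto
    show "(LINT t:{0..1}|lborel. LINT x:{0..1}|lborel. f (t, x)) = integral {0..1} fb"
      unfolding int_eq[OF cfx] fb_def[symmetric] by (rule int_eq[OF cfb])
  qed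
  define g where "g z = f (n\<^sup>2 * fst z, n * snd z)" for z
  have cg: "continuous_on UNIV g"
    unfolding g_def by (intro continuous_on_compose2[OF f(1)] continuous_intros) auto
  define G where "G = (\<lambda>t. LINT x:{c<..<d}|lborel. f (n\<^sup>2 * t, n * x))"
  have G: "\<bar>G t - (d - c) * fb (n\<^sup>2 * t)\<bar> \<le> 4 * K / n" for t
    unfolding G_def fb_def
    using oscillation_interval[OF cfx unit_periodic_slice(2)[OF f(2)] f(3) ab(5)] n by auto
  have gi: "set_integrable lborel ({a<..<b} \<times> {c<..<d}) g"
    by (intro set_integrable_bounded_continuous cg) (auto intro!: bounded_Times borel_open open_Times)
  have I: "(LINT z:{a<..<b} \<times> {c<..<d}|lborel. g z) = (LINT t:{a<..<b}|lborel. G t)"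
    by (subst set_integral_Times[OF gi]) (simp add: g_def G_def)
  have Gi: "set_integrable lborel {a<..<b} G"
  proof -
    have "integrable lborel (\<lambda>t. LINT x|lborel. indicator ({a<..<b} \<times> {c<..<d}) (t, x) *\<^sub>R g (t, x))"
      using gi unfolding set_integrable_def
      by (intro lborel_pair.integrable_fst') (simp add: lborel_prod)
    then show ?thesis
      by (simp add: set_integrable_def G_def g_def set_lebesgue_integral_def indicator_times mult.assoc)
  qed
  have fi: "set_integrable lborel {a<..<b} (\<lambda>t. (d - c) * fb (n\<^sup>2 * t))"
    by (intro set_integrable_bounded_continuous continuous_intros continuous_on_compose2[OF cfb]) auto
  have ci: "set_integrable lborel {a<..<b} (\<lambda>t. 4 * K / n)"
    by (intro set_integrable_bounded_continuous) auto
  have cI: "(LINT t:{a<..<b}|lborel. 4 * K / n) = (b - a) * (4 * K / n)"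
    using ab by (simp add: set_lebesgue_integral_def)
  have "(LINT t:{a<..<b}|lborel. G t) \<le> (LINT t:{a<..<b}|lborel. (d - c) * fb (n\<^sup>2 * t) + 4 * K / n)"
    by (rule set_integral_mono[OF Gi set_integral_add(1)[OF fi ci]])
       (use G in \<open>simp add: abs_le_iff algebra_simps\<close>)
  moreover have "(LINT t:{a<..<b}|lborel. (d - c) * fb (n\<^sup>2 * t)) \<le> (LINT t:{a<..<b}|lborel. G t + 4 * K / n)"
    by (rule set_integral_mono[OF fi set_integral_add(1)[OF Gi ci]])
       (use G in \<open>simp add: abs_le_iff algebra_simps\<close>)
  ultimately have 1: "\<bar>(LINT t:{a<..<b}|lborel. G t) - (d - c) * (LINT t:{a<..<b}|lborel. fb (n\<^sup>2 * t))\<bar>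
      \<le> (b - a) * (4 * K / n)"
    unfolding set_integral_add(2)[OF fi ci] set_integral_add(2)[OF Gi ci] cI by simp
  also have "\<dots> \<le> 1 * (4 * K / n)"
    using ab K n by (intro mult_right_mono) auto
  finally have 1: "\<bar>(LINT t:{a<..<b}|lborel. G t) - (d - c) * (LINT t:{a<..<b}|lborel. fb (n\<^sup>2 * t))\<bar> \<le> 4 * K / n"
    by simp
  have "\<bar>(LINT t:{a<..<b}|lborel. fb (n\<^sup>2 * t)) - (b - a) * integral {0..1} fb\<bar> \<le> 4 * K / n\<^sup>2"
    using n by (intro oscillation_interval cfb pfb bfb ab) auto
  also have "\<dots> \<le> 4 * K / n"
    using n K by (intro divide_left_mono) (auto simp: power2_eq_square)
  finally have "\<bar>(d - c) * ((LINT t:{a<..<b}|lborel. fb (n\<^sup>2 * t)) - (b - a) * integral {0..1} fb)\<bar> \<le> 1 * (4 * K / n)"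
    unfolding abs_mult using ab by (intro mult_mono) auto
  then have 2: "\<bar>(d - c) * ((LINT t:{a<..<b}|lborel. fb (n\<^sup>2 * t)) - (b - a) * integral {0..1} fb)\<bar> \<le> 4 * K / n"
    by simp
  have "(LINT t:{a<..<b}|lborel. G t) - (b - a) * (d - c) * integral {0..1} fb =
      ((LINT t:{a<..<b}|lborel. G t) - (d - c) * (LINT t:{a<..<b}|lborel. fb (n\<^sup>2 * t))) +
      (d - c) * ((LINT t:{a<..<b}|lborel. fb (n\<^sup>2 * t)) - (b - a) * integral {0..1} fb)"
    by (simp add: algebra_simps)
  also have "\<bar>\<dots>\<bar> \<le> 4 * K / n + 4 * K / n"
    using 1 2 by (intro order_trans[OF abs_triangle_ineq] add_mono)
  finally show ?thesis
    unfolding A I[unfolded g_def] by simp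
qed

text \<open>Parabolic scaling: \<open>u_t\<close> and \<open>u_xx\<close> keep their size, while for
  bounded \<open>u\<close> and \<open>u_x\<close> the function is of order
  \<open>1 / n\<^sup>2\<close> and its \<open>x\<close>-derivative of order \<open>1 / n\<close>.
  Derivatives falling on a fixed cut-off thus cost only \<open>O(1 / n)\<close>. The added zeros
  match the affine chain rules.\<close>

definition osc :: "(real \<times> real \<Rightarrow> real) \<Rightarrow> real \<Rightarrow> real \<times> real \<Rightarrow> real" where
  "osc u n z = 1 / n\<^sup>2 * u (n\<^sup>2 * fst z + 0, n * snd z + 0)"

lemma osc:
  assumes "Ck 2 u" "n \<noteq> 0"
  shows "Ck 2 (osc u n)"
    "dt (osc u n) = (\<lambda>z. dt u (n\<^sup>2 * fst z, n * snd z))"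
    "dx (osc u n) = (\<lambda>z. 1 / n * dx u (n\<^sup>2 * fst z, n * snd z))"
    "dx (dx (osc u n)) = (\<lambda>z. dx (dx u) (n\<^sup>2 * fst z, n * snd z))"
proof -
  let ?U = "\<lambda>z. u (n\<^sup>2 * fst z + 0, n * snd z + 0)"
  have e: "osc u n = (\<lambda>z. (1 / n\<^sup>2) * ?U z)" by (simp add: osc_def fun_eq_iff)
  have c: "Ck 2 ?U" by (rule Ck_affine[OF assms(1)])
  show "Ck 2 (osc u n)" unfolding e by (intro Ck_mult c Ck_const)
  have d: "\<And>z. u differentiable (at z)" "\<And>z. dx u differentiable (at z)"
    by (rule Ck2D(2)[OF assms(1)], rule Ck1D(1)[OF Ck2D(4)[OF assms(1)]])
  have dU: "\<And>z. ?U differentiable (at z)" by (rule Ck2D(2)[OF c])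
  have dc: "\<And>z. (\<lambda>z::real\<times>real. 1 / n\<^sup>2) differentiable (at z)" "\<And>z. (\<lambda>z::real\<times>real. 1 / n) differentiable (at z)"
    by simp_all
  have k: "dt (\<lambda>z. c) = (\<lambda>z. 0)" "dx (\<lambda>z. c) = (\<lambda>z. 0)" for c
    by (simp_all add: dt_def dx_def fun_eq_iff)
  show "dt (osc u n) = (\<lambda>z. dt u (n\<^sup>2 * fst z, n * snd z))"
    unfolding e dt_mult[OF dc(1) dU] k dt_affine[OF d(1)] using assms(2) by (simp add: fun_eq_iff)
  show x: "dx (osc u n) = (\<lambda>z. 1 / n * dx u (n\<^sup>2 * fst z, n * snd z))"
    unfolding e dx_mult[OF dc(1) dU] k dx_affine[OF d(1)]
    using assms(2) by (simp add: fun_eq_iff power2_eq_square)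
  have x': "dx (osc u n) = (\<lambda>z. 1 / n * dx u (n\<^sup>2 * fst z + 0, n * snd z + 0))"
    unfolding x by simp
  have "\<And>z. (\<lambda>z. dx u (n\<^sup>2 * fst z + 0, n * snd z + 0)) differentiable (at z)"
    by (rule differentiable_affine[OF d(2)])
  from dx_mult[OF dc(2) this]
  show "dx (dx (osc u n)) = (\<lambda>z. dx (dx u) (n\<^sup>2 * fst z, n * snd z))"
    unfolding x' k dx_affine[OF d(2)] using assms(2) by (simp add: fun_eq_iff)
qed

lemma unit_periodic_osc:
  assumes "unit_periodic u"
  shows "unit_periodic (osc u (real n))"
proof -
  have "u (real n ^ 2 * (t + 1), x) = u (real n ^ 2 * t, x)" "u (t, real n * (x + 1)) = u (t, real n * x)" for t x
    using periodic1_nat[OF unit_periodic_slice(1)[OF assms], of "real n ^ 2 * t" "n\<^sup>2" x]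
      periodic1_nat[OF unit_periodic_slice(2)[OF assms], of t "real n * x" n]
    by (simp_all add: algebra_simps)
  then show ?thesis by (simp add: unit_periodic_def osc_def)
qed

lemma bounded_on_cell:
  fixes f :: "real \<times> real \<Rightarrow> real"
  assumes "continuous_on UNIV f"
  obtains B where "B \<ge> 0" "\<And>z. z \<in> cell \<Longrightarrow> \<bar>f z\<bar> \<le> B"
proof -
  have "compact (f ` cell)"
    by (intro compact_continuous_image continuous_on_subset[OF assms] compact_Times) auto
  then obtain B where "\<And>z. z \<in> cell \<Longrightarrow> \<bar>f z\<bar> \<le> B"
    by (force dest!: compact_imp_bounded simp: bounded_iff)
  then have "\<And>z. z \<in> cell \<Longrightarrow> \<bar>f z\<bar> \<le> max B 0" by (simp add: max.coboundedI1)
  then show ?thesis using that[of "max B 0"] by simp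
qed

text \<open>For periodic \<open>u\<close> both derivatives have mean zero over the cell, so
  \<open>\<alpha>\<close> and \<open>\<beta>\<close> are the prescribed means of the pair to which
  \<open>F\<close> is applied.\<close>

definition energy :: "(real \<Rightarrow> real \<Rightarrow> real) \<Rightarrow> real \<Rightarrow> real \<Rightarrow> (real \<times> real \<Rightarrow> real) \<Rightarrow> real" where
  "energy F \<alpha> \<beta> u = (LINT z:cell|lborel. F (\<alpha> + dt u z) (\<beta> + dx (dx u) z))"

lemma continuous_energy_density:
  assumes "continuous_on UNIV (\<lambda>z. F (fst z) (snd z))" "Ck 2 u"
  shows "continuous_on UNIV (\<lambda>z. F (\<alpha> + dt u z) (\<beta> + dx (dx u) z))"
proof -
  have "continuous_on UNIV (\<lambda>z. (\<alpha> + dt u z, \<beta> + dx (dx u) z))"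
    using Ck1D(3)[OF Ck2D(1)[OF assms(2)]] Ck1D(4)[OF Ck2D(4)[OF assms(2)]]
    by (intro continuous_intros)
  from continuous_on_compose2[OF assms(1) this] show ?thesis by simp
qed

lemma measure_cell: "measure lborel cell = 1"
proof -
  have "emeasure lborel cell = ennreal 1 * ennreal 1"
    by (simp add: lborel_prod[symmetric] lborel.emeasure_pair_measure_Times)
  then show ?thesis by (simp add: measure_def)
qed

lemma measure_cell_box:
  assumes "0 \<le> a" "a \<le> b" "b \<le> 1" "0 \<le> c" "c \<le> d" "d \<le> 1"
  shows "measure lborel ({a<..<b} \<times> {c<..<d}) = (b - a) * (d - c)"
proof -
  have "emeasure lborel ({a<..<b} \<times> {c<..<d}) = ennreal (b - a) * ennreal (d - c)"
    using assms by (simp add: lborel_prod[symmetric] lborel.emeasure_pair_measure_Times)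
  then show ?thesis using assms by (simp add: measure_def enn2real_mult)
qed

text \<open>On the box \<open>E\<close> the correction is a pure oscillation, whose energy averages out, and on \<open>E2\<close>
  it vanishes; the transition region costs at most \<open>B\<close> times its area.\<close>

lemma localized_oscillation:
  fixes F :: "real \<Rightarrow> real \<Rightarrow> real"
  assumes F: "continuous_on UNIV (\<lambda>z. F (fst z) (snd z))"
    and u: "Ck 2 u" "unit_periodic u" and w: "Ck 2 w"
    and \<eta>: "Ck 2 \<eta>" "\<And>z. 0 \<le> \<eta> z" "\<And>z. \<eta> z \<le> 1"
    and E: "0 \<le> a" "a \<le> b" "b \<le> 1" "0 \<le> c" "c \<le> d" "d \<le> 1"
    and onE: "\<And>z. z \<in> {a<..<b} \<times> {c<..<d} \<Longrightarrow> \<eta> z = 1 \<and> \<alpha> + dt w z = \<alpha>1 \<and> \<beta> + dx (dx w) z = \<beta>1"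
    and E2: "open E2" "E2 \<subseteq> cell" "E2 \<inter> {a<..<b} \<times> {c<..<d} = {}"
    and onE2: "\<And>z. z \<in> E2 \<Longrightarrow> \<eta> z = 0 \<and> F (\<alpha> + dt w z) (\<beta> + dx (dx w) z) \<le> c2"
    and W: "\<And>z. \<bar>\<alpha> + dt w z\<bar> \<le> W" "\<And>z. \<bar>\<beta> + dx (dx w) z\<bar> \<le> W"
    and S: "\<And>z. \<bar>dt u z\<bar> \<le> S" "\<And>z. \<bar>dx (dx u) z\<bar> \<le> S"
    and B: "\<And>x y. \<bar>x\<bar> \<le> W + S + 1 \<Longrightarrow> \<bar>y\<bar> \<le> W + S + 1 \<Longrightarrow> F x y \<le> B"
    and "e > 0"
  shows "\<exists>n::nat. n \<ge> 1 \<and> energy F \<alpha> \<beta> (\<lambda>z. w z + \<eta> z * osc u n z) \<le>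
    (b - a) * (d - c) * energy F \<alpha>1 \<beta>1 u + c2 * measure lborel E2 +
    B * (1 - (b - a) * (d - c) - measure lborel E2) + e"
proof -
  let ?E = "{a<..<b} \<times> {c<..<d}"
  have S0: "S \<ge> 0" using S(1)[of 0] abs_ge_zero[of "dt u 0"] by linarith
  define f where "f = (\<lambda>z. F (\<alpha>1 + dt u z) (\<beta>1 + dx (dx u) z))"
  have f: "continuous_on UNIV f" "unit_periodic f"
    using unit_periodic_dt(1)[OF u(2)] unit_periodic_dt(2)[OF unit_periodic_dt(2)[OF u(2)]]
    unfolding f_def by (auto simp: unit_periodic_def intro: continuous_energy_density[OF F u(1)])
  obtain K where K: "K \<ge> 0" "\<And>z. \<bar>f z\<bar> \<le> K" using unit_periodic_bounded[OF f(2,1)] by blast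
  note cu = Ck1D[OF Ck2D(1)[OF u(1)]] and ce = Ck1D[OF Ck2D(1)[OF \<eta>(1)]]
    and cex = Ck1D[OF Ck2D(4)[OF \<eta>(1)]]
  obtain u0 where u0: "u0 \<ge> 0" "\<And>z. \<bar>u z\<bar> \<le> u0" using unit_periodic_bounded[OF u(2) cu(2)] by blast
  obtain ux where ux: "ux \<ge> 0" "\<And>z. \<bar>dx u z\<bar> \<le> ux"
    using unit_periodic_bounded[OF unit_periodic_dt(2)[OF u(2)] cu(4)] by blast
  obtain Ht where Ht: "Ht \<ge> 0" "\<And>z. z \<in> cell \<Longrightarrow> \<bar>dt \<eta> z\<bar> \<le> Ht" using bounded_on_cell[OF ce(3)] by blast
  obtain Hx where Hx: "Hx \<ge> 0" "\<And>z. z \<in> cell \<Longrightarrow> \<bar>dx \<eta> z\<bar> \<le> Hx" using bounded_on_cell[OF ce(4)] by blast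
  obtain Hxx where Hxx: "Hxx \<ge> 0" "\<And>z. z \<in> cell \<Longrightarrow> \<bar>dx (dx \<eta>) z\<bar> \<le> Hxx" using bounded_on_cell[OF cex(4)] by blast
  \<comment> \<open>The first three terms keep the errors from differentiating the cut-off at most
    one; the last brings the averaging error \<open>8 * K / n\<close> down to
    \<open>e\<close>.\<close>
  obtain n :: nat where n: "real n \<ge> max 1 (Ht * u0 + Hxx * u0 + 2 * Hx * ux + 8 * K / e)"
    using real_arch_simple by blast
  define N where "N = real n"
  have N1: "N \<ge> 1" "N \<noteq> 0" "N > 0" and NH: "N \<ge> Ht * u0 + Hxx * u0 + 2 * Hx * ux + 8 * K / e"
    using n by (auto simp: N_def)
  have nn: "Ht * u0 \<ge> 0" "Hxx * u0 \<ge> 0" "Hx * ux \<ge> 0" "8 * K / e \<ge> 0"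
    using Ht Hxx Hx u0 ux K \<open>e > 0\<close> by auto
  define v where "v = (\<lambda>z. w z + \<eta> z * osc u N z)"
  note U = osc[OF u(1) N1(2)]
  have ev: "Ck 2 (\<lambda>z. \<eta> z * osc u N z)" by (intro Ck_mult \<eta> U)
  have cv: "Ck 2 v" unfolding v_def by (intro Ck_add w ev)
  have dtv: "dt v z = dt w z + (dt \<eta> z * osc u N z + \<eta> z * dt (osc u N) z)" for z
    unfolding v_def dt_add[OF Ck2D(2)[OF w] Ck2D(2)[OF ev]] dt_mult[OF Ck2D(2)[OF \<eta>(1)] Ck2D(2)[OF U(1)]] ..
  have dxv: "dx v = (\<lambda>z. dx w z + (dx \<eta> z * osc u N z + \<eta> z * dx (osc u N) z))"
    unfolding v_def dx_add[OF Ck2D(2)[OF w] Ck2D(2)[OF ev]] dx_mult[OF Ck2D(2)[OF \<eta>(1)] Ck2D(2)[OF U(1)]] ..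
  have c1: "Ck 1 (\<lambda>z. dx \<eta> z * osc u N z)" "Ck 1 (\<lambda>z. \<eta> z * dx (osc u N) z)"
    by (intro Ck_mult Ck2D[OF \<eta>(1)] Ck2D[OF U(1)])+
  have dxxv: "dx (dx v) z = dx (dx w) z + ((dx (dx \<eta>) z * osc u N z + dx \<eta> z * dx (osc u N) z) +
      (dx \<eta> z * dx (osc u N) z + \<eta> z * dx (dx (osc u N)) z))" for z
    unfolding dxv dx_add[OF Ck1D(1)[OF Ck2D(4)[OF w]] Ck1D(1)[OF Ck_add[OF c1]]]
      dx_add[OF Ck1D(1)[OF c1(1)] Ck1D(1)[OF c1(2)]]
      dx_mult[OF Ck1D(1)[OF Ck2D(4)[OF \<eta>(1)]] Ck2D(2)[OF U(1)]]
      dx_mult[OF Ck2D(2)[OF \<eta>(1)] Ck1D(1)[OF Ck2D(4)[OF U(1)]]] ..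
  have oE: "open ?E" by (intro open_Times) auto
  define \<Phi> where "\<Phi> z = F (\<alpha> + dt v z) (\<beta> + dx (dx v) z)" for z
  have \<Phi>E: "\<Phi> z = f (N\<^sup>2 * fst z, N * snd z)" if "z \<in> ?E" for z
  proof -
    have wU: "Ck 2 (\<lambda>z. w z + osc u N z)" by (intro Ck_add w U)
    have "dt v z = dt (\<lambda>z. w z + osc u N z) z" "dx (dx v) z = dx (dx (\<lambda>z. w z + osc u N z)) z"
      by (rule dt_cong_open[OF oE that] dxx_cong_open[OF oE that]; use onE in \<open>simp add: v_def\<close>)+
    then have "dt v z = dt w z + dt (osc u N) z" "dx (dx v) z = dx (dx w) z + dx (dx (osc u N)) z"
      unfolding dt_add[OF Ck2D(2)[OF w] Ck2D(2)[OF U(1)]] dx_add[OF Ck2D(2)[OF w] Ck2D(2)[OF U(1)]]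
        dx_add[OF Ck1D(1)[OF Ck2D(4)[OF w]] Ck1D(1)[OF Ck2D(4)[OF U(1)]]] by simp_all
    then show ?thesis using onE[OF that] unfolding \<Phi>_def f_def U(2,4)
      by (simp add: add.assoc[symmetric])
  qed
  have \<Phi>E2: "\<Phi> z \<le> c2" if "z \<in> E2" for z
  proof -
    have "dt v z = dt w z" "dx (dx v) z = dx (dx w) z"
      by (rule dt_cong_open[OF E2(1) that] dxx_cong_open[OF E2(1) that]; use onE2 in \<open>simp add: v_def\<close>)+
    then show ?thesis using onE2[OF that] by (simp add: \<Phi>_def)
  qed
  have \<Phi>B: "\<Phi> z \<le> B" if "z \<in> cell" for z
  proof -
    let ?z = "(N\<^sup>2 * fst z, N * snd z)"
    have "\<bar>osc u N z\<bar> = \<bar>u ?z\<bar> / N\<^sup>2" by (simp add: osc_def abs_mult)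
    also have "\<dots> \<le> \<bar>u ?z\<bar> / N"
      using N1 by (intro divide_left_mono) (auto simp: power2_eq_square)
    also have "\<dots> \<le> u0 / N" using u0 N1 by (intro divide_right_mono) auto
    finally have o: "\<bar>osc u N z\<bar> \<le> u0 / N" .
    have ox: "\<bar>dx (osc u N) z\<bar> \<le> ux / N"
      unfolding U(3) using ux(2)[of ?z] N1 by (simp add: abs_mult divide_right_mono)
    have p1: "\<bar>dt \<eta> z * osc u N z\<bar> \<le> Ht * (u0 / N)" "\<bar>dx (dx \<eta>) z * osc u N z\<bar> \<le> Hxx * (u0 / N)"
      "\<bar>dx \<eta> z * dx (osc u N) z\<bar> \<le> Hx * (ux / N)"
      unfolding abs_mult by (intro mult_mono Ht Hx Hxx that o ox abs_ge_zero)+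
    have p2: "\<bar>\<eta> z * dt (osc u N) z\<bar> \<le> 1 * S" "\<bar>\<eta> z * dx (dx (osc u N)) z\<bar> \<le> 1 * S"
      unfolding abs_mult U(2,4)
      by (intro mult_mono S abs_ge_zero; use \<eta>(2,3)[of z] in simp)+
    \<comment> \<open>This accounts for the \<open>1\<close> in \<open>W + S + 1\<close>.\<close>
    have "Ht * (u0 / N) \<le> 1" "Hxx * (u0 / N) + 2 * (Hx * (ux / N)) \<le> 1"
      using NH nn N1 by (auto simp: field_simps)
    then have "\<bar>\<alpha> + dt v z\<bar> \<le> W + S + 1" "\<bar>\<beta> + dx (dx v) z\<bar> \<le> W + S + 1"
      unfolding dtv dxxv using p1 p2 W[of z] by linarith+
    then show ?thesis unfolding \<Phi>_def by (rule B)
  qed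
  have ms: "?E \<in> sets borel" "E2 \<in> sets borel" using oE E2(1) by auto
  have fin: "emeasure lborel A < \<infinity>" if "A \<subseteq> cell" "A \<in> sets borel" for A
  proof -
    have "bounded A" by (rule bounded_subset[OF _ that(1)]) (intro bounded_Times, auto)
    then show ?thesis by (rule emeasure_bounded_finite)
  qed
  have Ec: "?E \<subseteq> cell" using E by auto
  define g where "g = (\<lambda>z. f (N\<^sup>2 * fst z, N * snd z))"
  have cg: "continuous_on UNIV g"
    unfolding g_def by (intro continuous_on_compose2[OF f(1)] continuous_intros) auto
  have bE: "bounded ?E" "bounded cell" by (auto intro!: bounded_Times)
  have cell_m: "cell \<in> sets borel" by (intro borel_closed closed_Times) auto
  have i1: "integrable lborel (\<lambda>z. indicator ?E z * g z)"
    using set_integrable_bounded_continuous[OF cg ms(1) bE(1)] by (simp add: set_integrable_def)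
  have i2: "integrable lborel (\<lambda>z. c2 * indicat_real E2 z)" "integrable lborel (\<lambda>z. B * indicat_real cell z)"
    "integrable lborel (\<lambda>z. B * indicat_real ?E z)" "integrable lborel (\<lambda>z. B * indicat_real E2 z)"
    using fin[OF Ec ms(1)] fin[OF E2(2) ms(2)] fin[OF order_refl cell_m] ms cell_m
    by (intro integrable_mult_right integrable_real_indicator; simp)+
  have "energy F \<alpha> \<beta> v = (LINT z:cell|lborel. \<Phi> z)" by (simp add: energy_def \<Phi>_def)
  also have "\<dots> \<le> (LINT z|lborel. indicator ?E z * g z + c2 * indicator E2 z +
      (B * indicator cell z - B * indicator ?E z - B * indicator E2 z))"
    unfolding set_lebesgue_integral_def
  proof (rule integral_mono)
    show "integrable lborel (\<lambda>z. indicat_real cell z *\<^sub>R \<Phi> z)"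
      using set_integrable_bounded_continuous[OF continuous_energy_density[OF F cv] cell_m bE(2)]
      by (simp add: \<Phi>_def[abs_def] set_integrable_def)
    show "integrable lborel (\<lambda>z. indicator ?E z * g z + c2 * indicator E2 z +
      (B * indicator cell z - B * indicator ?E z - B * indicator E2 z))"
      by (intro Bochner_Integration.integrable_add Bochner_Integration.integrable_diff i1 i2)
    fix z :: "real \<times> real"
    consider "z \<in> ?E" | "z \<in> E2" | "z \<notin> ?E" "z \<notin> E2" "z \<in> cell" | "z \<notin> cell" by blast
    then show "indicat_real cell z *\<^sub>R \<Phi> z \<le> indicator ?E z * g z + c2 * indicator E2 z +
      (B * indicator cell z - B * indicator ?E z - B * indicator E2 z)"
    proof cases
      case 1
      then have "z \<in> cell" "z \<notin> E2" using Ec E2(3) by blast+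
      then show ?thesis using 1 \<Phi>E[OF 1] by (simp only: indicator_simps) (simp add: g_def)
    next
      case 2
      then have "z \<in> cell" "z \<notin> ?E" using E2 by blast+
      then show ?thesis using 2 \<Phi>E2[OF 2] by (simp only: indicator_simps) simp
    next
      case 3
      then show ?thesis using \<Phi>B[OF 3(3)] by (simp only: indicator_simps) simp
    next
      case 4
      then have "z \<notin> ?E" "z \<notin> E2" using Ec E2 by blast+
      then show ?thesis using 4 by (simp add: indicator_def)
    qed
  qed
  also have "\<dots> = (LINT z:?E|lborel. g z) + c2 * measure lborel E2 +
      (B * 1 - B * ((b - a) * (d - c)) - B * measure lborel E2)"
    using i1 i2 by (simp add: set_lebesgue_integral_def measure_cell measure_cell_box[OF E])
  finally have en: "energy F \<alpha> \<beta> v \<le> (LINT z:?E|lborel. g z) + c2 * measure lborel E2 +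
      (B * 1 - B * ((b - a) * (d - c)) - B * measure lborel E2)" .
  have gE: "(LINT z:?E|lborel. g z) \<le> (b - a) * (d - c) * energy F \<alpha>1 \<beta>1 u + 8 * K / N"
    using oscillation_box[OF f K(2) E N1(1)] by (simp add: g_def energy_def f_def abs_le_iff)
  have "8 * K / e \<le> N" using NH nn by linarith
  then have "8 * K / N \<le> e"
    using N1 \<open>e > 0\<close> by (simp add: pos_divide_le_eq mult.commute)
  with en gE have "energy F \<alpha> \<beta> v \<le> (b - a) * (d - c) * energy F \<alpha>1 \<beta>1 u + c2 * measure lborel E2 +
    B * (1 - (b - a) * (d - c) - measure lborel E2) + e"
    unfolding right_diff_distrib by linarith
  then show ?thesis using N1 by (intro exI[of _ n]) (simp add: v_def N_def)
qed

section \<open>Cut-off functions and periodic layer profiles\<close>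

lemma C1_2I:
  assumes "\<And>x. (g has_real_derivative g' x) (at x)" "\<And>x. (g' has_real_derivative g'' x) (at x)"
    "continuous_on UNIV g''"
  shows "C1 2 g"
  unfolding numeral_2_eq_2 using assms by (intro C1_SucI[of g g'] C1_SucI[of g' g'']) auto

text \<open>Away from the corners the clamp is locally constant or the identity. At a corner the
  clamped function moves no more than \<open>q\<close>, whose difference quotients already tend to
  zero there.\<close>

lemma DERIV_clamp:
  fixes q q' :: "real \<Rightarrow> real"
  assumes q: "\<And>x. (q has_real_derivative q' x) (at x)" and "q' 0 = 0" "q' 1 = 0"
  shows "((\<lambda>x. q (max 0 (min 1 x))) has_real_derivative q' (max 0 (min 1 x))) (at x)"
proof -
  have flat: "(f has_real_derivative 0) (at c)"
    if "(g has_real_derivative 0) (at c)" "\<forall>\<^sub>F y in at c. \<bar>f y - f c\<bar> \<le> \<bar>g y - g c\<bar>"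
    for f g :: "real \<Rightarrow> real" and c
  proof -
    have "((\<lambda>y. (g y - g c) / (y - c)) \<longlongrightarrow> 0) (at c)"
      using that(1) by (simp add: has_field_derivative_iff)
    then have "((\<lambda>y. norm ((g y - g c) / (y - c))) \<longlongrightarrow> 0) (at c)"
      by (rule tendsto_norm_zero)
    moreover have "\<forall>\<^sub>F y in at c. norm ((f y - f c) / (y - c)) \<le> norm ((g y - g c) / (y - c))"
      using that(2) by eventually_elim (simp add: divide_right_mono)
    ultimately have "((\<lambda>y. (f y - f c) / (y - c)) \<longlongrightarrow> 0) (at c)"
      by (rule Lim_null_comparison[rotated])
    then show ?thesis by (simp add: has_field_derivative_iff)
  qed
  let ?f = "\<lambda>x. q (max 0 (min 1 x))"
  have near: "\<forall>\<^sub>F y in at c. \<bar>y - c\<bar> < 1" for c :: real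
    using eventually_at_ball[of 1 c UNIV] by (simp add: dist_real_def abs_minus_commute)
  consider "x < 0" | "x = 0" | "0 < x" "x < 1" | "x = 1" | "x > 1" by linarith
  then show ?thesis
  proof cases
    case 1
    have "(?f has_real_derivative 0) (at x)"
      by (rule has_field_derivative_transform_within_open[of "\<lambda>x. q 0" _ _ "{..<0}"]) (use 1 in auto)
    then show ?thesis using 1 assms by simp
  next
    case 2
    have "(?f has_real_derivative 0) (at 0)"
    proof (rule flat)
      show "(q has_real_derivative 0) (at 0)" using q[of 0] assms by simp
      show "\<forall>\<^sub>F y in at 0. \<bar>?f y - ?f 0\<bar> \<le> \<bar>q y - q 0\<bar>"
        using near[of 0] by eventually_elim (auto simp: max_def min_def)
    qed
    then show ?thesis using 2 assms by simp
  next
    case 3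
    have "(?f has_real_derivative q' x) (at x)"
      by (rule has_field_derivative_transform_within_open[OF q[of x], where S = "{0<..<1}"]) (use 3 in auto)
    then show ?thesis using 3 by simp
  next
    case 4
    have "(?f has_real_derivative 0) (at 1)"
    proof (rule flat)
      show "(q has_real_derivative 0) (at 1)" using q[of 1] assms by simp
      show "\<forall>\<^sub>F y in at 1. \<bar>?f y - ?f 1\<bar> \<le> \<bar>q y - q 1\<bar>"
        using near[of 1] by eventually_elim (auto simp: max_def min_def)
    qed
    then show ?thesis using 4 assms by simp
  next
    case 5
    have "(?f has_real_derivative 0) (at x)"
      by (rule has_field_derivative_transform_within_open[of "\<lambda>x. q 1" _ _ "{1<..}"]) (use 5 in auto)
    then show ?thesis using 5 assms by simp
  qed
qed

text \<open>The quintic has first derivative \<open>30 y^2 (1 - y)^2\<close> and second derivative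
  \<open>60 y (1 - y) (1 - 2 y)\<close>; both vanish at 0 and 1, so clamping the argument preserves
  C^2.\<close>

definition smoothstep :: "real \<Rightarrow> real" where
  "smoothstep x = (\<lambda>y. 6 * y ^ 5 - 15 * y ^ 4 + 10 * y ^ 3) (max 0 (min 1 x))"

lemma smoothstep:
  shows "C1 2 smoothstep" "0 \<le> smoothstep x" "smoothstep x \<le> 1"
    "x \<le> 0 \<Longrightarrow> smoothstep x = 0" "x \<ge> 1 \<Longrightarrow> smoothstep x = 1"
proof -
  define q1 where "q1 y = 30 * y ^ 4 - 60 * y ^ 3 + 30 * y ^ 2" for y :: real
  define q2 where "q2 y = 120 * y ^ 3 - 180 * y ^ 2 + 60 * y" for y :: real
  have "(smoothstep has_real_derivative q1 (max 0 (min 1 x))) (at x)" for x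
    unfolding smoothstep_def[abs_def]
    by (rule DERIV_clamp) (auto intro!: derivative_eq_intros simp: q1_def)
  moreover have "((\<lambda>x. q1 (max 0 (min 1 x))) has_real_derivative q2 (max 0 (min 1 x))) (at x)" for x
    by (rule DERIV_clamp) (auto intro!: derivative_eq_intros simp: q1_def[abs_def] q2_def)
  moreover have "continuous_on UNIV (\<lambda>x. q2 (max 0 (min 1 x)))"
    by (auto simp: q2_def intro!: continuous_intros)
  ultimately show "C1 2 smoothstep" by (rule C1_2I)
  define y where "y = max 0 (min 1 x)"
  have y: "0 \<le> y" "y \<le> 1" by (auto simp: y_def)
  have e: "smoothstep x = 6 * y ^ 5 - 15 * y ^ 4 + 10 * y ^ 3" by (simp add: smoothstep_def y_def)
  also have "\<dots> = y ^ 3 * (6 * (y - 5/4)\<^sup>2 + 5/8)" by algebra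
  finally show "0 \<le> smoothstep x" using y by simp
  have "1 - smoothstep x = (1 - y) ^ 3 * (6 * y\<^sup>2 + 3 * y + 1)" unfolding e by algebra
  moreover have "\<dots> \<ge> 0" using y by (intro mult_nonneg_nonneg) auto
  ultimately show "smoothstep x \<le> 1" by simp
  show "x \<le> 0 \<Longrightarrow> smoothstep x = 0" "x \<ge> 1 \<Longrightarrow> smoothstep x = 1"
    by (simp_all add: smoothstep_def)
qed

text \<open>Composing \<open>smoothstep\<close> with an affine function of
  \<open>- cos (2 * pi * t)\<close> gives smoothness and periodicity together. The cosine term
  increases on \<open>[0, 1/2]\<close> and is symmetric about \<open>1/2\<close>, so the thresholds
  \<open>k l\<close> and \<open>k (l + \<epsilon>)\<close> decide where the profile is 0 and where
  it is 1.\<close>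

lemma periodic_plateau:
  assumes "0 < l" "0 < \<epsilon>" "l + \<epsilon> < 1 / 2"
  obtains \<rho> where "C1 2 \<rho>" "periodic1 \<rho>" "\<And>t. 0 \<le> \<rho> t" "\<And>t. \<rho> t \<le> 1"
    "\<And>t. l + \<epsilon> < t \<Longrightarrow> t < 1 - l - \<epsilon> \<Longrightarrow> \<rho> t = 1"
    "\<And>t. 0 < t \<Longrightarrow> t < l \<Longrightarrow> \<rho> t = 0" "\<And>t. 1 - l < t \<Longrightarrow> t < 1 \<Longrightarrow> \<rho> t = 0"
proof -
  define k where "k t = - cos (2 * pi * t)" for t
  have kmono: "k s \<le> k t" if "0 \<le> s" "s \<le> t" "t \<le> 1 / 2" for s t
    unfolding k_def neg_le_iff_le using that by (intro cos_monotone_0_pi_le) auto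
  have kstrict: "k l < k (l + \<epsilon>)"
    unfolding k_def neg_less_iff_less using assms by (intro cos_monotone_0_pi) auto
  have ksym: "k (1 - t) = k t" for t
    unfolding k_def right_diff_distrib by (simp add: cos_diff)
  define \<rho> where "\<rho> t = smoothstep (1 / (k (l + \<epsilon>) - k l) * k t + (- k l / (k (l + \<epsilon>) - k l)))" for t
  have \<rho>: "\<rho> t = smoothstep ((k t - k l) / (k (l + \<epsilon>) - k l))" for t
    by (simp add: \<rho>_def diff_divide_distrib)
  have "C1 2 k"
  proof -
    have "(k has_real_derivative 2 * pi * sin (2 * pi * t)) (at t)" for t
      unfolding k_def[abs_def] by (auto intro!: derivative_eq_intros)
    moreover have "((\<lambda>t. 2 * pi * sin (2 * pi * t)) has_real_derivative (2 * pi)\<^sup>2 * cos (2 * pi * t)) (at t)" for t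
      by (auto intro!: derivative_eq_intros simp: power2_eq_square)
    moreover have "continuous_on UNIV (\<lambda>t. (2 * pi)\<^sup>2 * cos (2 * pi * t))"
      by (auto intro!: continuous_intros)
    ultimately show ?thesis by (rule C1_2I)
  qed
  then have "C1 2 (\<lambda>t. 1 / (k (l + \<epsilon>) - k l) * k t + (- k l / (k (l + \<epsilon>) - k l)))"
    by (rule C1_compose[OF C1_affine])
  then have c: "C1 2 \<rho>" unfolding \<rho>_def[abs_def] by (rule C1_compose[OF smoothstep(1)])
  have p: "periodic1 \<rho>"
    unfolding periodic1_def \<rho>_def k_def by (simp add: distrib_left cos_add)
  have one: "\<rho> t = 1" if "k t \<ge> k (l + \<epsilon>)" for t
    unfolding \<rho> using that kstrict by (intro smoothstep(5)) (simp add: field_simps)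
  have zero: "\<rho> t = 0" if "k t \<le> k l" for t
    unfolding \<rho> using that kstrict by (intro smoothstep(4)) (simp add: divide_le_0_iff)
  show ?thesis
  proof (rule that[OF c p])
    show "0 \<le> \<rho> t" "\<rho> t \<le> 1" for t unfolding \<rho> by (rule smoothstep)+
    show "\<rho> t = 1" if "l + \<epsilon> < t" "t < 1 - l - \<epsilon>" for t
    proof (cases "t \<le> 1 / 2")
      case True then show ?thesis using that assms by (intro one kmono) auto
    next
      case False then show ?thesis
        using that assms by (intro one) (subst (2) ksym[symmetric], intro kmono, auto)
    qed
    show "\<rho> t = 0" if "0 < t" "t < l" for t using that assms by (intro zero kmono) auto
    show "\<rho> t = 0" if "1 - l < t" "t < 1" for t
      using that assms by (intro zero) (subst ksym[symmetric], intro kmono, auto)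
  qed
qed

text \<open>Since \<open>\<integral> \<rho>\<close> need not be exactly \<open>\<theta>\<close>, the value \<open>a2\<close> is moved slightly so that the profile keeps
  the mean \<open>a\<close>.\<close>

lemma layer_profile:
  fixes a a1 a2 :: real
  assumes "0 < \<theta>" "\<theta> < 1" "a = \<theta> * a1 + (1 - \<theta>) * a2" "0 < \<delta>" "0 < \<epsilon>0"
  obtains \<epsilon> a2' \<rho> where "0 < \<epsilon>" "\<epsilon> < \<epsilon>0" "2 * \<epsilon> < \<theta>" "\<bar>a2' - a2\<bar> < \<delta>"
    "C1 2 \<rho>" "periodic1 \<rho>" "\<And>t. 0 \<le> \<rho> t" "\<And>t. \<rho> t \<le> 1"
    "\<And>t. (1 - \<theta>) / 2 + \<epsilon> < t \<Longrightarrow> t < 1 - (1 - \<theta>) / 2 - \<epsilon> \<Longrightarrow> \<rho> t = 1"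
    "\<And>t. 0 < t \<Longrightarrow> t < (1 - \<theta>) / 2 \<Longrightarrow> \<rho> t = 0"
    "\<And>t. 1 - (1 - \<theta>) / 2 < t \<Longrightarrow> t < 1 \<Longrightarrow> \<rho> t = 0"
    "integral {0..1} (\<lambda>t. (a1 - a2') * \<rho> t + (a2' - a)) = 0"
proof -
  define l where "l = (1 - \<theta>) / 2"
  \<comment> \<open>\<open>h s\<close> solves \<open>a = s * a1 + (1 - s) * h s\<close>: it is the
    second value required when the first one has total weight \<open>s\<close>.\<close>
  define h where "h s = (a - s * a1) / (1 - s)" for s
  have "h \<theta> = a2" using assms by (simp add: h_def)
  moreover have "isCont h \<theta>" unfolding h_def[abs_def] using assms by (intro continuous_intros) auto
  ultimately obtain d where d: "d > 0" "\<And>s. \<bar>s - \<theta>\<bar> < d \<Longrightarrow> \<bar>h s - a2\<bar> < \<delta>"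
    using \<open>0 < \<delta>\<close> unfolding continuous_at_eps_delta dist_real_def by metis
  \<comment> \<open>The two ramps change the weight \<open>\<theta>\<close> by at most
    \<open>2 * \<epsilon>\<close>, which must stay below the continuity radius \<open>d\<close>;
    staying below \<open>\<theta>\<close> keeps the plateau nonempty.\<close>
  define \<epsilon> where "\<epsilon> = min (\<epsilon>0 / 2) (min (\<theta> / 4) (d / 4))"
  have \<epsilon>: "0 < \<epsilon>" "\<epsilon> < \<epsilon>0" "2 * \<epsilon> < \<theta>" "2 * \<epsilon> < d" using assms d by (auto simp: \<epsilon>_def min_def)
  have l: "0 < l" "l + \<epsilon> < 1 / 2" 
  proof -
    have "2 * l = 1 - \<theta>" by (simp add: l_def)
    then show "0 < l" "l + \<epsilon> < 1 / 2" using assms \<epsilon> by linarith+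
  qed
  obtain \<rho> where \<rho>: "C1 2 \<rho>" "periodic1 \<rho>" "\<And>t. 0 \<le> \<rho> t" "\<And>t. \<rho> t \<le> 1"
    "\<And>t. l + \<epsilon> < t \<Longrightarrow> t < 1 - l - \<epsilon> \<Longrightarrow> \<rho> t = 1"
    "\<And>t. 0 < t \<Longrightarrow> t < l \<Longrightarrow> \<rho> t = 0" "\<And>t. 1 - l < t \<Longrightarrow> t < 1 \<Longrightarrow> \<rho> t = 0"
    using periodic_plateau[OF l(1) \<epsilon>(1) l(2)] by blast
  have ri: "\<rho> integrable_on {x..y}" for x y
    using C1_continuous[OF \<rho>(1)] by (intro integrable_continuous_real) (rule continuous_on_subset, auto)
  define \<theta>' where "\<theta>' = integral {0..1} \<rho>"
  have split: "\<theta>' = integral {0..l} \<rho> + integral {l..1-l} \<rho> + integral {1-l..1} \<rho>"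
    using l \<epsilon> ri by (simp add: \<theta>'_def Henstock_Kurzweil_Integration.integral_combine)
  have z: "integral {0..l} \<rho> = 0" "integral {1-l..1} \<rho> = 0"
  proof -
    have "integral {0<..<l} \<rho> = integral {0<..<l} (\<lambda>_. 0)"
      "integral {1-l<..<1} \<rho> = integral {1-l<..<1} (\<lambda>_. 0)"
      by (rule Henstock_Kurzweil_Integration.integral_cong; use \<rho>(6,7) in simp)+
    then show "integral {0..l} \<rho> = 0" "integral {1-l..1} \<rho> = 0"
      by (simp_all add: integral_open_interval_real)
  qed
  have up: "integral {l..1-l} \<rho> \<le> integral {l..1-l} (\<lambda>_. 1)"
    using ri \<rho>(4) by (intro integral_le) auto
  have "integral {l+\<epsilon><..<1-l-\<epsilon>} \<rho> = integral {l+\<epsilon><..<1-l-\<epsilon>} (\<lambda>_. 1)"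
    by (rule Henstock_Kurzweil_Integration.integral_cong) (use \<rho>(5) in simp)
  then have "integral {l+\<epsilon>..1-l-\<epsilon>} \<rho> = integral {l+\<epsilon>..1-l-\<epsilon>} (\<lambda>_. 1)"
    by (simp only: integral_open_interval_real)
  moreover have "integral {l+\<epsilon>..1-l-\<epsilon>} \<rho> \<le> integral {l..1-l} \<rho>"
    using ri \<rho>(3) \<epsilon> by (intro integral_subset_le) auto
  ultimately have "\<theta> - 2 * \<epsilon> \<le> \<theta>'" "\<theta>' \<le> \<theta>"
    using split z up l \<epsilon> by (auto simp: integral_open_interval_real l_def field_simps)
  then have t: "\<bar>\<theta>' - \<theta>\<bar> < d" "\<theta>' < 1" using \<epsilon> assms by auto
  define a2' where "a2' = h \<theta>'"
  have "integral {0..1} (\<lambda>t. (a1 - a2') * \<rho> t + (a2' - a)) = (a1 - a2') * \<theta>' + (a2' - a)"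
    using ri by (subst Henstock_Kurzweil_Integration.integral_add) (auto simp: \<theta>'_def intro: integrable_on_mult_right)
  also have "\<dots> = \<theta>' * a1 + (1 - \<theta>') * a2' - a" by (simp add: algebra_simps)
  also have "\<dots> = 0" using t by (simp add: a2'_def h_def)
  finally show ?thesis
    using that[of \<epsilon> a2' \<rho>] \<epsilon> \<rho> d(2)[OF t(1)] unfolding l_def a2'_def by blast
qed

section \<open>Laminates\<close>

text \<open>It says that \<open>c\<close> exceeds the infimum of the energy over periodic
  perturbations, that is, a relaxed value of \<open>F\<close>. Strictness absorbs the errors of
  layering, so costs combine as exact convex combinations.\<close>

definition attains :: "(real \<Rightarrow> real \<Rightarrow> real) \<Rightarrow> real \<Rightarrow> real \<Rightarrow> real \<Rightarrow> bool" where
  "attains F \<alpha> \<beta> c \<longleftrightarrow> (\<exists>u. Ck 2 u \<and> unit_periodic u \<and> energy F \<alpha> \<beta> u < c)"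

lemma C2_periodic_bounded:
  assumes "Ck 2 u" "unit_periodic u"
  obtains S where "\<And>z. \<bar>dt u z\<bar> \<le> S" "\<And>z. \<bar>dx (dx u) z\<bar> \<le> S"
proof -
  obtain S1 where S1: "\<And>z. \<bar>dt u z\<bar> \<le> S1"
    using unit_periodic_bounded[OF unit_periodic_dt(1)[OF assms(2)] Ck1D(3)[OF Ck2D(1)[OF assms(1)]]] by metis
  obtain S2 where S2: "\<And>z. \<bar>dx (dx u) z\<bar> \<le> S2"
    using unit_periodic_bounded[OF unit_periodic_dt(2)[OF unit_periodic_dt(2)[OF assms(2)]]
      Ck1D(4)[OF Ck2D(4)[OF assms(1)]]] by metis
  show ?thesis
    by (rule that[of "max S1 S2"]) (use S1 S2 in \<open>simp_all add: max.coboundedI1 max.coboundedI2\<close>)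
qed

lemma continuous_square_bound:
  fixes F :: "real \<Rightarrow> real \<Rightarrow> real"
  assumes "continuous_on UNIV (\<lambda>z. F (fst z) (snd z))"
  obtains B where "B \<ge> 0" "\<And>x y. \<bar>x\<bar> \<le> R \<Longrightarrow> \<bar>y\<bar> \<le> R \<Longrightarrow> F x y \<le> B"
proof -
  have "compact ((\<lambda>z. F (fst z) (snd z)) ` ({-R..R} \<times> {-R..R}))"
    by (intro compact_continuous_image continuous_on_subset[OF assms] compact_Times) auto
  then obtain B where B: "\<And>z. z \<in> {-R..R} \<times> {-R..R} \<Longrightarrow> \<bar>F (fst z) (snd z)\<bar> \<le> B"
    by (force dest!: compact_imp_bounded simp: bounded_iff)
  have "F x y \<le> max B 0" if "\<bar>x\<bar> \<le> R" "\<bar>y\<bar> \<le> R" for x y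
    using B[of "(x, y)"] that by (auto simp: abs_le_iff)
  then show ?thesis using that[of "max B 0"] by simp
qed

lemma continuous_less_nearby:
  fixes h :: "real \<Rightarrow> real"
  assumes "continuous_on UNIV h" "h a < c"
  obtains \<delta> where "\<delta> > 0" "\<delta> \<le> 1" "\<And>x. \<bar>x - a\<bar> < \<delta> \<Longrightarrow> h x < c"
proof -
  have "open (h -` {..<c})" using assms(1) by (intro open_vimage) auto
  then obtain d where d: "d > 0" "ball a d \<subseteq> h -` {..<c}"
    using assms(2) openE[of "h -` {..<c}" a] by auto
  have "h x < c" if "\<bar>x - a\<bar> < min d 1" for x
    using that d(2) by (auto simp: dist_real_def abs_minus_commute subset_eq)
  then show ?thesis using that[of "min d 1"] d(1) by auto
qed

lemma dt_dx_const [simp]: "dt (\<lambda>z. c) = (\<lambda>z. 0)" "dx (\<lambda>z. c) = (\<lambda>z. 0)"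
  by (simp_all add: dt_def dx_def fun_eq_iff)

lemma attains_point: "F \<alpha> \<beta> < c \<Longrightarrow> attains F \<alpha> \<beta> c"
  unfolding attains_def energy_def
  by (intro exI[of _ "\<lambda>z. 0"]) (simp add: unit_periodic_def set_lebesgue_integral_def measure_cell)

lemma attains_mono: "attains F \<alpha> \<beta> c \<Longrightarrow> c \<le> c' \<Longrightarrow> attains F \<alpha> \<beta> c'"
  unfolding attains_def by (meson order_less_le_trans)

lemma attains_scale:
  assumes "attains F \<alpha> \<beta> c" "\<And>x y. F (r * x) (r * y) = \<mu> * F x y" "\<mu> > 0"
  shows "attains F (r * \<alpha>) (r * \<beta>) (\<mu> * c)"
proof -
  obtain u where u: "Ck 2 u" "unit_periodic u" "energy F \<alpha> \<beta> u < c"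
    using assms(1) unfolding attains_def by blast
  have k: "\<And>z. (\<lambda>z::real\<times>real. r) differentiable (at z)" by simp
  have d: "dt (\<lambda>z. r * u z) = (\<lambda>z. r * dt u z)" "dx (\<lambda>z. r * u z) = (\<lambda>z. r * dx u z)"
    unfolding dt_mult[OF k Ck2D(2)[OF u(1)]] dx_mult[OF k Ck2D(2)[OF u(1)]] by simp_all
  have dd: "dx (\<lambda>z. r * dx u z) = (\<lambda>z. r * dx (dx u) z)"
    unfolding dx_mult[OF k Ck1D(1)[OF Ck2D(4)[OF u(1)]]] by simp
  have "energy F (r * \<alpha>) (r * \<beta>) (\<lambda>z. r * u z) = \<mu> * energy F \<alpha> \<beta> u"
    unfolding energy_def d dd by (simp add: assms(2) flip: distrib_left)
  then have "energy F (r * \<alpha>) (r * \<beta>) (\<lambda>z. r * u z) < \<mu> * c" using u(3) assms(3) by simp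
  moreover have "Ck 2 (\<lambda>z. r * u z)" by (intro Ck_mult Ck_const u)
  moreover have "unit_periodic (\<lambda>z. r * u z)" using u(2) by (simp add: unit_periodic_def)
  ultimately show ?thesis unfolding attains_def by blast
qed

text \<open>This lets one argument in \<open>attains_layer\<close> treat layers in time and layers
  in space: a strip in either coordinate is a box.\<close>

lemma strip_box:
  fixes x y :: real and \<pi> :: "real \<times> real \<Rightarrow> real"
  assumes "\<pi> = fst \<or> \<pi> = snd" "0 \<le> x" "x \<le> y" "y \<le> 1"
  obtains a b c d where "0 \<le> a" "a \<le> b" "b \<le> 1" "0 \<le> c" "c \<le> d" "d \<le> 1"
    "{a<..<b} \<times> {c<..<d} = {z. x < \<pi> z \<and> \<pi> z < y \<and> z \<in> {0<..<1} \<times> {0<..<1}}"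
    "(b - a) * (d - c) = y - x"
  using assms(1)
proof
  assume "\<pi> = fst"
  then show ?thesis using assms by (intro that[of x y 0 1]) auto
next
  assume "\<pi> = snd"
  then show ?thesis using assms by (intro that[of 0 1 x y]) auto
qed

text \<open>The background \<open>w\<close> moves the pair along \<open>(p, q)\<close> between the
  value for \<open>a1\<close> and one close to that for \<open>a2\<close>, and a fast copy of
  \<open>u\<close> is inserted in the \<open>a1\<close> layer. One part carries a relaxed value and
  the other only a point value of \<open>F\<close>; this suffices for a staircase, where each
  splitting peels off a single point.\<close>

lemma attains_layer:
  assumes F: "continuous_on UNIV (\<lambda>z. F (fst z) (snd z))"
    and \<pi>: "\<pi> = fst \<or> \<pi> = snd" and pq: "\<bar>p\<bar> \<le> 1" "\<bar>q\<bar> \<le> 1"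
    and prof: "\<And>g. C1 2 g \<Longrightarrow> periodic1 g \<Longrightarrow> integral {0..1} g = 0 \<Longrightarrow>
      \<exists>w. Ck 2 w \<and> unit_periodic w \<and> (\<forall>z. dt w z = p * g (\<pi> z) \<and> dx (dx w) z = q * g (\<pi> z))"
    and at: "attains F (\<alpha> + p * a1) (\<beta> + q * a1) c1"
    and triv: "F (\<alpha> + p * a2) (\<beta> + q * a2) < c2" and \<theta>: "0 < \<theta>" "\<theta> < 1"
    and a: "a = \<theta> * a1 + (1 - \<theta>) * a2"
  shows "attains F (\<alpha> + p * a) (\<beta> + q * a) (\<theta> * c1 + (1 - \<theta>) * c2)"
proof -
  obtain u where u: "Ck 2 u" "unit_periodic u" "energy F (\<alpha> + p * a1) (\<beta> + q * a1) u < c1"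
    using at unfolding attains_def by blast
  define E where "E = energy F (\<alpha> + p * a1) (\<beta> + q * a1) u"
  obtain S where S: "\<And>z. \<bar>dt u z\<bar> \<le> S" "\<And>z. \<bar>dx (dx u) z\<bar> \<le> S"
    using C2_periodic_bounded[OF u(1,2)] by metis
  define W where "W = \<bar>\<alpha>\<bar> + \<bar>\<beta>\<bar> + \<bar>a1\<bar> + \<bar>a2\<bar> + 1"
  obtain B where B: "B \<ge> 0" "\<And>x y. \<bar>x\<bar> \<le> W + S + 1 \<Longrightarrow> \<bar>y\<bar> \<le> W + S + 1 \<Longrightarrow> F x y \<le> B"
    using continuous_square_bound[OF F] by metis
  have "continuous_on UNIV (\<lambda>x. (\<alpha> + p * x, \<beta> + q * x))" by (intro continuous_intros)
  from continuous_on_compose2[OF F this]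
  have "continuous_on UNIV (\<lambda>x. F (\<alpha> + p * x) (\<beta> + q * x))" by simp
  from continuous_less_nearby[OF this triv]
  obtain \<delta> where \<delta>: "\<delta> > 0" "\<delta> \<le> 1" "\<And>x. \<bar>x - a2\<bar> < \<delta> \<Longrightarrow> F (\<alpha> + p * x) (\<beta> + q * x) < c2"
    by metis
  \<comment> \<open>Half of the gap \<open>\<theta> * (c1 - E)\<close> pays for the ramps, of total
    area \<open>2 * \<epsilon>\<close>; the other half pays for the averaging error.\<close>
  define \<epsilon>0 where "\<epsilon>0 = \<theta> * (c1 - E) / (4 * (\<bar>E\<bar> + B + 1))"
  have gap: "\<theta> * (c1 - E) > 0" using \<theta> u(3) by (simp add: E_def)
  have e0: "\<epsilon>0 > 0" unfolding \<epsilon>0_def using gap B(1) by (intro divide_pos_pos) auto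
  obtain \<epsilon> a2' \<rho> where \<epsilon>: "0 < \<epsilon>" "\<epsilon> < \<epsilon>0" "2 * \<epsilon> < \<theta>" and a2': "\<bar>a2' - a2\<bar> < \<delta>"
    and \<rho>: "C1 2 \<rho>" "periodic1 \<rho>" "\<And>t. 0 \<le> \<rho> t" "\<And>t. \<rho> t \<le> 1"
    "\<And>t. (1 - \<theta>) / 2 + \<epsilon> < t \<Longrightarrow> t < 1 - (1 - \<theta>) / 2 - \<epsilon> \<Longrightarrow> \<rho> t = 1"
    "\<And>t. 0 < t \<Longrightarrow> t < (1 - \<theta>) / 2 \<Longrightarrow> \<rho> t = 0"
    "\<And>t. 1 - (1 - \<theta>) / 2 < t \<Longrightarrow> t < 1 \<Longrightarrow> \<rho> t = 0"
    and mean: "integral {0..1} (\<lambda>t. (a1 - a2') * \<rho> t + (a2' - a)) = 0"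
    by (rule layer_profile[OF \<theta> a \<delta>(1) e0]) (rule that; assumption)
  define l where "l = (1 - \<theta>) / 2"
  have l: "0 < l" "2 * l = 1 - \<theta>" using \<theta> by (auto simp: l_def)
  note \<rho>' = \<rho>(5-7)[folded l_def]
  define g where "g = (\<lambda>t. (a1 - a2') * \<rho> t + (a2' - a))"
  have cg: "C1 2 g" unfolding g_def by (intro C1_add C1_mult \<rho> C1_const)
  have pg: "periodic1 g" using \<rho>(2) by (simp add: g_def periodic1_def)
  obtain w where w: "Ck 2 w" "unit_periodic w"
    and dw: "\<And>z. dt w z = p * g (\<pi> z)" "\<And>z. dx (dx w) z = q * g (\<pi> z)"
    using prof[OF cg pg] mean unfolding g_def by blast
  \<comment> \<open>The profile doubles as the cut-off: the inserted oscillation has full strength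
    on the \<open>a1\<close> plateau and is absent from the layers with value
    \<open>a2'\<close>.\<close>
  define \<eta> where "\<eta> = (\<lambda>z. \<rho> (\<pi> z))"
  have "Ck 2 \<eta>" unfolding \<eta>_def using \<pi> Ck_fst[OF \<rho>(1)] Ck_snd[OF \<rho>(1)] by auto
  then have \<eta>: "Ck 2 \<eta>" "\<And>z. 0 \<le> \<eta> z" "\<And>z. \<eta> z \<le> 1" using \<rho>(3,4) by (auto simp: \<eta>_def)
  \<comment> \<open>\<open>W\<close> and \<open>B\<close> were fixed before the profile, so the
    bound must not depend on it; it does not, because \<open>a + g t\<close> is a convex combination
    of \<open>a1\<close> and \<open>a2'\<close>.\<close>
  have aW: "\<bar>a + g t\<bar> \<le> \<bar>a1\<bar> + \<bar>a2\<bar> + 1" for t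
  proof -
    have "a + g t = \<rho> t * a1 + (1 - \<rho> t) * a2'" by (simp add: g_def algebra_simps)
    also have "\<bar>\<dots>\<bar> \<le> \<bar>\<rho> t * a1\<bar> + \<bar>(1 - \<rho> t) * a2'\<bar>" by (rule abs_triangle_ineq)
    also have "\<dots> \<le> 1 * \<bar>a1\<bar> + 1 * \<bar>a2'\<bar>"
      unfolding abs_mult using \<rho>(3,4)[of t] by (intro add_mono mult_right_mono) auto
    also have "\<dots> \<le> \<bar>a1\<bar> + \<bar>a2\<bar> + 1" using a2' \<delta>(2) by simp
    finally show ?thesis .
  qed
  have gW: "\<bar>\<alpha> + p * a + p * g t\<bar> \<le> W" "\<bar>\<beta> + q * a + q * g t\<bar> \<le> W" for t
  proof -
    have "\<bar>r * (a + g t)\<bar> \<le> \<bar>a1\<bar> + \<bar>a2\<bar> + 1" if "\<bar>r\<bar> \<le> 1" for r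
      using mult_mono[OF that aW] by (simp add: abs_mult)
    from this[OF pq(1)] this[OF pq(2)]
    show "\<bar>\<alpha> + p * a + p * g t\<bar> \<le> W" "\<bar>\<beta> + q * a + q * g t\<bar> \<le> W"
      unfolding W_def distrib_left by linarith+
  qed
  have l1: "0 \<le> l" "l \<le> 1" "0 \<le> 1 - l" "1 - l \<le> 1" "l \<le> 1 - l" using l \<theta> by auto
  have lb: "0 \<le> l + \<epsilon>" "l + \<epsilon> \<le> 1 - l - \<epsilon>" "1 - l - \<epsilon> \<le> 1" using l \<theta> \<epsilon> by auto
  obtain b1 b2 b3 b4 where box: "0 \<le> b1" "b1 \<le> b2" "b2 \<le> 1" "0 \<le> b3" "b3 \<le> b4" "b4 \<le> 1"
    and boxE: "{b1<..<b2} \<times> {b3<..<b4} = {z. l + \<epsilon> < \<pi> z \<and> \<pi> z < 1 - l - \<epsilon> \<and> z \<in> {0<..<1} \<times> {0<..<1}}"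
    and areaE: "(b2 - b1) * (b4 - b3) = 1 - l - \<epsilon> - (l + \<epsilon>)"
    by (rule strip_box[OF \<pi> lb]) (rule that; assumption)
  have strip: "open A" "measure lborel A = y - x" "emeasure lborel A < \<infinity>"
    if "A = {z. x < \<pi> z \<and> \<pi> z < y \<and> z \<in> {0<..<1} \<times> {0<..<1}}" "0 \<le> x" "x \<le> y" "y \<le> 1" for A x y
  proof -
    note A = that
    obtain a b c d where *: "0 \<le> a" "a \<le> b" "b \<le> 1" "0 \<le> c" "c \<le> d" "d \<le> 1"
      "{a<..<b} \<times> {c<..<d} = {z. x < \<pi> z \<and> \<pi> z < y \<and> z \<in> {0<..<1} \<times> {0<..<1}}" "(b - a) * (d - c) = y - x"
      by (rule strip_box[OF \<pi> A(2-4)]) (rule that; assumption)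
    show "open A" unfolding A(1) *(7)[symmetric] by (intro open_Times) auto
    show "measure lborel A = y - x" unfolding A(1) *(7)[symmetric] measure_cell_box[OF *(1-6)] by (rule *)
    show "emeasure lborel A < \<infinity>" unfolding A(1) *(7)[symmetric]
      by (intro emeasure_bounded_finite bounded_Times) auto
  qed
  define E1 where "E1 = {z. 0 < \<pi> z \<and> \<pi> z < l \<and> z \<in> {0<..<1} \<times> {0<..<1}}"
  define E2 where "E2 = {z. 1 - l < \<pi> z \<and> \<pi> z < 1 \<and> z \<in> {0<..<1} \<times> {0<..<1}}"
  note s1 = strip[OF E1_def order_refl l1(1,2)] and s2 = strip[OF E2_def l1(3,4) order_refl]
  have mE: "measure lborel (E1 \<union> E2) = 1 - \<theta>"
  proof -
    have "measure lborel (E1 \<union> E2) = measure lborel E1 + measure lborel E2"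
      using s1 s2 l1 by (intro measure_Union) (auto simp: E1_def E2_def)
    then show ?thesis using s1(2) s2(2) l by simp
  qed
  have "\<exists>n::nat. n \<ge> 1 \<and> energy F (\<alpha> + p * a) (\<beta> + q * a) (\<lambda>z. w z + \<eta> z * osc u n z) \<le>
    (b2 - b1) * (b4 - b3) * energy F (\<alpha> + p * a1) (\<beta> + q * a1) u + c2 * measure lborel (E1 \<union> E2) +
    B * (1 - (b2 - b1) * (b4 - b3) - measure lborel (E1 \<union> E2)) + \<theta> * (c1 - E) / 2"
  proof (rule localized_oscillation[OF F u(1,2) w(1) \<eta> box, where W = W and S = S])
    show "\<eta> z = 1 \<and> \<alpha> + p * a + dt w z = \<alpha> + p * a1 \<and> \<beta> + q * a + dx (dx w) z = \<beta> + q * a1"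
      if "z \<in> {b1<..<b2} \<times> {b3<..<b4}" for z
    proof -
      have "\<rho> (\<pi> z) = 1" using that unfolding boxE by (intro \<rho>'(1)) auto
      then show ?thesis by (simp add: \<eta>_def dw g_def algebra_simps)
    qed
    show "open (E1 \<union> E2)" using s1(1) s2(1) by (rule open_Un)
    show "E1 \<union> E2 \<subseteq> cell" by (auto simp: E1_def E2_def)
    show "(E1 \<union> E2) \<inter> {b1<..<b2} \<times> {b3<..<b4} = {}"
      unfolding boxE using \<epsilon>(1) by (auto simp: E1_def E2_def)
    show "\<eta> z = 0 \<and> F (\<alpha> + p * a + dt w z) (\<beta> + q * a + dx (dx w) z) \<le> c2" if "z \<in> E1 \<union> E2" for z
    proof -
      have "\<rho> (\<pi> z) = 0" using that \<rho>'(2,3)[of "\<pi> z"] by (auto simp: E1_def E2_def)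
      then show ?thesis using \<delta>(3)[OF a2'] by (simp add: \<eta>_def dw g_def algebra_simps)
    qed
    show "\<bar>\<alpha> + p * a + dt w z\<bar> \<le> W" "\<bar>\<beta> + q * a + dx (dx w) z\<bar> \<le> W" for z
      unfolding dw by (rule gW)+
  qed (use S B gap in auto)
  then obtain n :: nat where n: "real n \<ge> 1" and "energy F (\<alpha> + p * a) (\<beta> + q * a) (\<lambda>z. w z + \<eta> z * osc u n z) \<le>
    (b2 - b1) * (b4 - b3) * E + c2 * (1 - \<theta>) + B * (1 - (b2 - b1) * (b4 - b3) - (1 - \<theta>)) + \<theta> * (c1 - E) / 2"
    unfolding mE E_def[symmetric] by (elim exE conjE) (rule that; assumption)
  moreover have "(b2 - b1) * (b4 - b3) = \<theta> - 2 * \<epsilon>" using areaE l by simp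
  ultimately have en: "energy F (\<alpha> + p * a) (\<beta> + q * a) (\<lambda>z. w z + \<eta> z * osc u n z) \<le>
    (\<theta> - 2 * \<epsilon>) * E + c2 * (1 - \<theta>) + B * (2 * \<epsilon>) + \<theta> * (c1 - E) / 2"
    by simp
  have "2 * \<epsilon> * (B - E) \<le> 2 * \<epsilon> * (\<bar>E\<bar> + B + 1)" using \<epsilon>(1) by (intro mult_left_mono) auto
  also have "\<dots> < 2 * \<epsilon>0 * (\<bar>E\<bar> + B + 1)" using \<epsilon> B(1) by (intro mult_strict_right_mono) auto
  also have "\<dots> = \<theta> * (c1 - E) / 2"
  proof -
    have "\<bar>E\<bar> + B + 1 \<noteq> 0" using B(1) abs_ge_zero[of E] by linarith
    then show ?thesis unfolding \<epsilon>0_def by (simp add: divide_simps)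
  qed
  finally have small: "2 * \<epsilon> * (B - E) < \<theta> * (c1 - E) / 2" .
  have "(\<theta> - 2 * \<epsilon>) * E + c2 * (1 - \<theta>) + B * (2 * \<epsilon>) + \<theta> * (c1 - E) / 2 =
      \<theta> * c1 + (1 - \<theta>) * c2 + (2 * \<epsilon> * (B - E) - \<theta> * (c1 - E) / 2)"
    by (simp add: field_simps)
  with en small have "energy F (\<alpha> + p * a) (\<beta> + q * a) (\<lambda>z. w z + \<eta> z * osc u n z) < \<theta> * c1 + (1 - \<theta>) * c2"
    by linarith
  moreover have "Ck 2 (\<lambda>z. w z + \<eta> z * osc u n z)"
    using n by (intro Ck_add w Ck_mult \<eta> osc(1) u) auto
  moreover have "unit_periodic (\<lambda>z. w z + \<eta> z * osc u n z)"
    using unit_periodic_osc[OF u(2), of n] w(2) \<rho>(2) \<pi>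
    by (auto simp: unit_periodic_def \<eta>_def periodic1_def)
  ultimately show ?thesis unfolding attains_def by blast
qed

text \<open>A function of \<open>t\<close> alone has \<open>u_xx = 0\<close>, so layers in time
  split \<open>\<alpha>\<close> and leave \<open>\<beta>\<close> fixed.\<close>

lemma attains_t:
  assumes "continuous_on UNIV (\<lambda>z. F (fst z) (snd z))"
    "attains F \<alpha>1 \<beta> c1" "F \<alpha>2 \<beta> < c2" "0 < \<theta>" "\<theta> < 1"
  shows "attains F (\<theta> * \<alpha>1 + (1 - \<theta>) * \<alpha>2) \<beta> (\<theta> * c1 + (1 - \<theta>) * c2)"
proof -
  have prof: "\<exists>w. Ck 2 w \<and> unit_periodic w \<and> (\<forall>z. dt w z = 1 * g (fst z) \<and> dx (dx w) z = 0 * g (fst z))"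
    if g: "C1 2 g" "periodic1 g" "integral {0..1} g = 0" for g
  proof -
    obtain G where G: "\<And>t. (G has_real_derivative g t) (at t)" "periodic1 G"
      using periodic_antiderivative[OF C1_continuous[OF g(1)] g(2,3)] by metis
    have Gd: "deriv G = g" using G(1) by (auto intro: DERIV_imp_deriv)
    have cG: "C1 2 G" by (rule C1_SucD, rule C1_SucI[OF G(1) g(1)])
    note d = dt_fst[OF cG[unfolded numeral_2_eq_2]]
    show ?thesis
      using Ck_fst[OF cG] G(2)
      by (intro exI[of _ "\<lambda>z. G (fst z)"]) (auto simp: d Gd unit_periodic_def periodic1_def)
  qed
  have "attains F (0 + 1 * (\<theta> * \<alpha>1 + (1 - \<theta>) * \<alpha>2)) (\<beta> + 0 * (\<theta> * \<alpha>1 + (1 - \<theta>) * \<alpha>2))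
      (\<theta> * c1 + (1 - \<theta>) * c2)"
    by (rule attains_layer[OF assms(1) _ _ _ prof _ _ assms(4,5) refl]) (use assms(2,3) in simp_all)
  then show ?thesis by simp
qed

text \<open>A function of \<open>x\<close> alone has \<open>u_t = 0\<close>. Here the second
  derivative is prescribed, hence two successive periodic antiderivatives, the first normalized to
  mean zero.\<close>

lemma attains_x:
  assumes "continuous_on UNIV (\<lambda>z. F (fst z) (snd z))"
    "attains F \<alpha> \<beta>1 c1" "F \<alpha> \<beta>2 < c2" "0 < \<theta>" "\<theta> < 1"
  shows "attains F \<alpha> (\<theta> * \<beta>1 + (1 - \<theta>) * \<beta>2) (\<theta> * c1 + (1 - \<theta>) * c2)"
proof -
  have prof: "\<exists>w. Ck 2 w \<and> unit_periodic w \<and> (\<forall>z. dt w z = 0 * g (snd z) \<and> dx (dx w) z = 1 * g (snd z))"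
    if g: "C1 2 g" "periodic1 g" "integral {0..1} g = 0" for g
  proof -
    obtain G where G: "\<And>t. (G has_real_derivative g t) (at t)" "periodic1 G" "integral {0..1} G = 0"
      using periodic_antiderivative[OF C1_continuous[OF g(1)] g(2,3)] by metis
    have cG: "C1 2 G" by (rule C1_SucD, rule C1_SucI[OF G(1) g(1)])
    obtain H where H: "\<And>t. (H has_real_derivative G t) (at t)" "periodic1 H"
      using periodic_antiderivative[OF C1_continuous[OF cG] G(2,3)] by metis
    have Gd: "deriv G = g" "deriv H = G" using G(1) H(1) by (auto intro: DERIV_imp_deriv)
    have cH: "C1 2 H" by (rule C1_SucD, rule C1_SucI[OF H(1) cG])
    note d = dt_snd[OF cG[unfolded numeral_2_eq_2]] dt_snd[OF cH[unfolded numeral_2_eq_2]]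
    show ?thesis
      using Ck_snd[OF cH] H(2)
      by (intro exI[of _ "\<lambda>z. H (snd z)"]) (auto simp: d Gd unit_periodic_def periodic1_def)
  qed
  have "attains F (\<alpha> + 0 * (\<theta> * \<beta>1 + (1 - \<theta>) * \<beta>2)) (0 + 1 * (\<theta> * \<beta>1 + (1 - \<theta>) * \<beta>2))
      (\<theta> * c1 + (1 - \<theta>) * c2)"
    by (rule attains_layer[OF assms(1) _ _ _ prof _ _ assms(4,5) refl]) (use assms(2,3) in simp_all)
  then show ?thesis by simp
qed

text \<open>At mean \<open>(0, 0)\<close> the background can be taken to be zero, so a fast copy of
  \<open>u\<close> may be cut off near the boundary of the cell at the price of a thin
  frame.\<close>

lemma attains_csupp:
  assumes F: "continuous_on UNIV (\<lambda>z. F (fst z) (snd z))" and at: "attains F 0 0 0"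
  obtains v \<epsilon> where "\<epsilon> > 0" "Ck 2 v" "\<And>z. z \<notin> {\<epsilon>..1-\<epsilon>} \<times> {\<epsilon>..1-\<epsilon>} \<Longrightarrow> v z = 0" "energy F 0 0 v < 0"
proof -
  obtain u where u: "Ck 2 u" "unit_periodic u" "energy F 0 0 u < 0"
    using at unfolding attains_def by blast
  define A where "A = - energy F 0 0 u"
  obtain S where S: "\<And>z. \<bar>dt u z\<bar> \<le> S" "\<And>z. \<bar>dx (dx u) z\<bar> \<le> S"
    using C2_periodic_bounded[OF u(1,2)] by metis
  obtain B where B: "B \<ge> 0" "\<And>x y. \<bar>x\<bar> \<le> 0 + S + 1 \<Longrightarrow> \<bar>y\<bar> \<le> 0 + S + 1 \<Longrightarrow> F x y \<le> B"
    using continuous_square_bound[OF F] by metis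
  have A: "A > 0" using u by (simp add: A_def)
  \<comment> \<open>The frame has area at most \<open>8 * \<epsilon>\<close>, and replacing the
    average \<open>-A\<close> by \<open>B\<close> on it loses at most
    \<open>8 * \<epsilon> * (A + B) = A / 4\<close>. The averaging error takes another
    \<open>A / 4\<close>, which leaves a negative total.\<close>
  define \<epsilon> where "\<epsilon> = A / (32 * (A + B))"
  have \<epsilon>: "\<epsilon> > 0" "32 * \<epsilon> * (A + B) = A" "\<epsilon> \<le> 1 / 32"
    using A B(1) by (auto simp: \<epsilon>_def field_simps)
  define b where "b = (\<lambda>t. smoothstep (1 / \<epsilon> * t + (- 1)) * smoothstep ((- 1 / \<epsilon>) * t + (1 / \<epsilon> - 1)))"
  have b1: "b t = smoothstep ((t - \<epsilon>) / \<epsilon>) * smoothstep ((1 - \<epsilon> - t) / \<epsilon>)" for t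
  proof -
    have "1 / \<epsilon> * t + (- 1) = (t - \<epsilon>) / \<epsilon>" "(- 1 / \<epsilon>) * t + (1 / \<epsilon> - 1) = (1 - \<epsilon> - t) / \<epsilon>"
      using \<epsilon>(1) by (simp_all add: field_simps)
    then show ?thesis by (simp only: b_def)
  qed
  have cb: "C1 2 b" unfolding b_def
    by (intro C1_mult C1_compose[OF smoothstep(1)] C1_affine)
  have b0: "0 \<le> b t" "b t \<le> 1" for t
    unfolding b_def by (auto intro: mult_nonneg_nonneg mult_le_one smoothstep)
  have bone: "b t = 1" if "2 * \<epsilon> < t" "t < 1 - 2 * \<epsilon>" for t
    unfolding b1 using that \<epsilon>(1) by (simp add: smoothstep(5) field_simps)
  have bzero: "b t = 0" if "t \<notin> {\<epsilon>..1-\<epsilon>}" for t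
    unfolding b1 using that \<epsilon>(1) by (auto simp: not_le smoothstep(4) divide_le_0_iff)
  define \<eta> where "\<eta> = (\<lambda>z::real\<times>real. b (fst z) * b (snd z))"
  have \<eta>: "Ck 2 \<eta>" "\<And>z. 0 \<le> \<eta> z" "\<And>z. \<eta> z \<le> 1"
    unfolding \<eta>_def using b0 by (auto intro!: Ck_mult Ck_fst Ck_snd cb mult_le_one)
  have "\<exists>n::nat. n \<ge> 1 \<and> energy F 0 0 (\<lambda>z. 0 + \<eta> z * osc u n z) \<le>
    (1 - 2 * \<epsilon> - 2 * \<epsilon>) * (1 - 2 * \<epsilon> - 2 * \<epsilon>) * energy F 0 0 u + 0 * measure lborel ({} :: (real \<times> real) set) +
    B * (1 - (1 - 2 * \<epsilon> - 2 * \<epsilon>) * (1 - 2 * \<epsilon> - 2 * \<epsilon>) - measure lborel ({} :: (real \<times> real) set)) + A / 4"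
  proof (rule localized_oscillation[OF F u(1,2) Ck_const \<eta>, where W = 0 and S = S])
    show "\<eta> z = 1 \<and> 0 + dt (\<lambda>z. 0) z = 0 \<and> 0 + dx (dx (\<lambda>z. 0)) z = 0"
      if "z \<in> {2 * \<epsilon><..<1 - 2 * \<epsilon>} \<times> {2 * \<epsilon><..<1 - 2 * \<epsilon>}" for z
      using that by (auto simp: \<eta>_def bone)
  qed (use \<epsilon> S B A in auto)
  then obtain n :: nat where n: "n \<ge> 1" "energy F 0 0 (\<lambda>z. \<eta> z * osc u n z) \<le>
    (1 - 4 * \<epsilon>)\<^sup>2 * (- A) + B * (1 - (1 - 4 * \<epsilon>)\<^sup>2) + A / 4"
    unfolding A_def by (auto simp: power2_eq_square)
  have "1 - (1 - 4 * \<epsilon>)\<^sup>2 \<le> 8 * \<epsilon>" by (simp add: power2_eq_square algebra_simps)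
  then have "(A + B) * (1 - (1 - 4 * \<epsilon>)\<^sup>2) \<le> (A + B) * (8 * \<epsilon>)"
    using A B(1) by (intro mult_left_mono) auto
  also have "\<dots> = A / 4" using \<epsilon>(2) by (simp add: algebra_simps)
  finally have "energy F 0 0 (\<lambda>z. \<eta> z * osc u n z) < 0"
    using n(2) A by (simp add: algebra_simps)
  moreover have "Ck 2 (\<lambda>z. \<eta> z * osc u n z)" using n(1) by (intro Ck_mult \<eta> osc(1) u) auto
  moreover have "\<eta> z * osc u n z = 0" if "z \<notin> {\<epsilon>..1-\<epsilon>} \<times> {\<epsilon>..1-\<epsilon>}" for z
    using that bzero[of "fst z"] bzero[of "snd z"] by (auto simp: \<eta>_def mem_Times_iff)
  ultimately show ?thesis using that[OF \<epsilon>(1)] by blast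
qed

section \<open>The staircase\<close>

text \<open>One step of the staircase moves \<open>(1, -1)\<close> to \<open>(1 + \<delta>, -(1 + \<delta>))\<close> by splitting first in the time
  direction and then in the space direction, each time into a point of the cone where \<open>f = 0\<close>.  The factor
  \<open>q \<delta>\<close> by which the optimal energy is multiplied satisfies \<open>q' 0 = 0\<close> exactly for
  \<open>p = 2 / (1 + \<kappa>)\<close>, whereas the split-off part contributes a negative amount of order \<open>\<delta>\<close>.\<close>

lemma staircase_unbounded:
  fixes \<kappa> p :: real
  assumes \<kappa>: "0 < \<kappa>" and p: "p = 2 / (1 + \<kappa>)"
    and F: "continuous_on UNIV (\<lambda>z. F (fst z) (snd z))"
    and hom: "\<And>s x y. 0 < s \<Longrightarrow> F (s * x) (s * y) = s powr p * F x y"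
    and cone1: "F (-\<kappa>) (-1) \<le> - 1" and cone2: "\<And>x. 0 < x \<Longrightarrow> F x (\<kappa> * x) < 0"
  shows "\<exists>c<K. attains F 1 (-1) c"
proof (rule ccontr)
  assume "\<not> ?thesis"
  then have K: "K \<le> c" if "attains F 1 (-1) c" for c using that by (meson not_le)
  define C where "C = {c. attains F 1 (-1) c}"
  define g where "g = Inf C"
  have C: "C \<noteq> {}" "bdd_below C"
    using attains_point[of F 1 "-1" "F 1 (-1) + 1"] K by (auto simp: C_def bdd_below_def)
  \<comment> \<open>The weights \<open>s\<close> and \<open>r\<close> are forced:
    \<open>(1, -1)\<close> splits in time into \<open>(1 + \<delta>, -1)\<close> and
    \<open>(-\<kappa>, -1)\<close>, then \<open>(1 + \<delta>, -1)\<close> splits in space into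
    \<open>(1 + \<delta>, -(1 + \<delta>))\<close> and
    \<open>(1 + \<delta>, \<kappa> * (1 + \<delta>))\<close>.\<close>
  define s where "s \<delta> = (1 + \<kappa>) / (1 + \<kappa> + \<delta>)" for \<delta>
  define r where "r \<delta> = 1 - \<delta> / ((1 + \<kappa>) * (1 + \<delta>))" for \<delta>
  define q where "q \<delta> = s \<delta> * (r \<delta> * (1 + \<delta>) powr p)" for \<delta>
  \<comment> \<open>One step together with homogeneity sends each \<open>c\<close> in
    \<open>C\<close> to \<open>q \<delta> * c - (1 - s \<delta>) / 2\<close>, again in
    \<open>C\<close>. Passing to the infimum bounds \<open>g\<close> by its own image.\<close>
  have step: "(1 - s \<delta>) / 2 \<le> (q \<delta> - 1) * g" if \<delta>: "0 < \<delta>" for \<delta>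
  proof -
    have s: "0 < s \<delta>" "s \<delta> < 1" using \<kappa> \<delta> by (auto simp: s_def)
    have "\<delta> < (1 + \<kappa>) * (1 + \<delta>)"
    proof -
      have "(1 + \<kappa>) * (1 + \<delta>) = \<delta> + (1 + \<kappa> + \<kappa> * \<delta>)" by (simp add: algebra_simps)
      then show ?thesis using \<kappa> mult_pos_pos[OF \<kappa> \<delta>] by linarith
    qed
    then have r: "0 < r \<delta>" "r \<delta> < 1" using \<kappa> \<delta> by (auto simp: r_def divide_less_eq_1)
    have q: "q \<delta> > 0" using s r \<delta> by (simp add: q_def)
    have "\<delta> / ((1 + \<kappa>) * (1 + \<delta>)) * ((1 + \<kappa>) * (1 + \<delta>)) = \<delta>" using \<kappa> \<delta> by simp
    then have "(1 - r \<delta>) * ((1 + \<kappa>) * (1 + \<delta>)) = \<delta>" by (simp add: r_def)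
    then have e1: "r \<delta> * (- (1 + \<delta>)) + (1 - r \<delta>) * (\<kappa> * (1 + \<delta>)) = -1"
      by (simp add: algebra_simps)
    have "s \<delta> * (1 + \<kappa> + \<delta>) = 1 + \<kappa>" using \<kappa> \<delta> by (simp add: s_def)
    then have e2: "s \<delta> * (1 + \<delta>) + (1 - s \<delta>) * (-\<kappa>) = 1"
      by (simp add: algebra_simps)
    have "q \<delta> * c - (1 - s \<delta>) / 2 \<in> C" if "c \<in> C" for c
    proof -
      have "attains F ((1 + \<delta>) * 1) ((1 + \<delta>) * -1) ((1 + \<delta>) powr p * c)"
        using that \<delta> by (intro attains_scale hom) (auto simp: C_def)
      then have a1: "attains F (1 + \<delta>) (- (1 + \<delta>)) ((1 + \<delta>) powr p * c)" by simp
      \<comment> \<open>This cone point is entered with cost 0; the gain of order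
        \<open>\<delta>\<close> comes from the point split off in time.\<close>
      have "F (1 + \<delta>) (\<kappa> * (1 + \<delta>)) < 0" using \<delta> by (intro cone2) simp
      from attains_x[OF F a1 this r]
      have a2: "attains F (1 + \<delta>) (-1) (r \<delta> * ((1 + \<delta>) powr p * c))"
        unfolding e1 by simp
      \<comment> \<open>A strict bound is required of the peeled-off point, so \<open>-1\<close> is
        weakened to \<open>-1/2\<close>; hence the factor 2 in the denominators.\<close>
      have "F (-\<kappa>) (-1) < - (1 / 2)" using cone1 by simp
      from attains_t[OF F a2 this s]
      have "attains F 1 (-1) (s \<delta> * (r \<delta> * ((1 + \<delta>) powr p * c)) + (1 - s \<delta>) * (- (1 / 2)))"
        unfolding e2 .
      then show ?thesis by (simp add: C_def q_def algebra_simps diff_divide_distrib)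
    qed
    then have "(g + (1 - s \<delta>) / 2) / q \<delta> \<le> c" if "c \<in> C" for c
      using cInf_lower[OF _ C(2), of "q \<delta> * c - (1 - s \<delta>) / 2"] that q
      by (simp add: g_def pos_divide_le_eq mult.commute algebra_simps)
    then have "(g + (1 - s \<delta>) / 2) / q \<delta> \<le> g"
      unfolding g_def by (intro cInf_greatest C(1))
    then show ?thesis using q by (simp add: pos_divide_le_eq algebra_simps)
  qed
  have k0: "1 + \<kappa> \<noteq> 0" using \<kappa> by simp
  have s0: "s 0 = 1" "r 0 = 1" "q 0 = 1" using \<kappa> by (simp_all add: s_def r_def q_def)
  have sD: "(s has_real_derivative - 1 / (1 + \<kappa>)) (at 0)"
  proof -
    have m: "- 1 - \<kappa> = - (1 + \<kappa>)" by simp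
    have "(- 1 - \<kappa>) / ((1 + \<kappa>) * (1 + \<kappa>)) = - ((1 + \<kappa>) / ((1 + \<kappa>) * (1 + \<kappa>)))"
      unfolding m by (rule minus_divide_left[symmetric])
    also have "\<dots> = - 1 / (1 + \<kappa>)" using k0 by simp
    finally have e: "(- 1 - \<kappa>) / ((1 + \<kappa>) * (1 + \<kappa>)) = - 1 / (1 + \<kappa>)" .
    have "(s has_real_derivative (- 1 - \<kappa>) / ((1 + \<kappa>) * (1 + \<kappa>))) (at 0)"
      unfolding s_def[abs_def] using k0 by (auto intro!: derivative_eq_intros)
    then show ?thesis unfolding e .
  qed
  have rD: "(r has_real_derivative - 1 / (1 + \<kappa>)) (at 0)"
    unfolding r_def[abs_def] using k0 by (auto intro!: derivative_eq_intros simp: power2_eq_square)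
  have pD: "((\<lambda>\<delta>. (1 + \<delta>) powr p) has_real_derivative p) (at 0)"
    by (auto intro!: derivative_eq_intros)
  \<comment> \<open>Each of the two splittings contributes \<open>-1 / (1 + \<kappa>)\<close> and
    the homogeneity contributes \<open>p\<close>.\<close>
  have "(q has_real_derivative (- 1 / (1 + \<kappa>)) * (r 0 * (1 + 0) powr p) +
      s 0 * ((- 1 / (1 + \<kappa>)) * (1 + 0) powr p + r 0 * p)) (at 0)"
    unfolding q_def[abs_def]
    using DERIV_mult[OF sD DERIV_mult[OF rD pD]] by (simp add: algebra_simps)
  also have "(- 1 / (1 + \<kappa>)) * (r 0 * (1 + 0) powr p) + s 0 * ((- 1 / (1 + \<kappa>)) * (1 + 0) powr p + r 0 * p) = 0"
    by (simp add: s0 p field_simps)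
  finally have qD: "(q has_real_derivative 0) (at 0)" .
  \<comment> \<open>The inequality \<open>step\<close> is divided by \<open>\<delta>\<close>: the
    gain tends to \<open>1 / (2 * (1 + \<kappa>))\<close>, whereas
    \<open>(q \<delta> - 1) / \<delta>\<close> times the finite number \<open>g\<close> tends to
    zero.\<close>
  have "((\<lambda>\<delta>. (q \<delta> - 1) / \<delta>) \<longlongrightarrow> 0) (at 0)"
    using qD by (simp add: has_field_derivative_iff s0)
  then have "((\<lambda>\<delta>. (q \<delta> - 1) / \<delta>) \<longlongrightarrow> 0) (at_right 0)"
    by (rule Lim_at_imp_Lim_at_within)
  then have "((\<lambda>\<delta>. (q \<delta> - 1) / \<delta> * g) \<longlongrightarrow> 0 * g) (at_right 0)"
    by (rule tendsto_mult_right)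
  moreover have "((\<lambda>\<delta>. 1 / (2 * (1 + \<kappa> + \<delta>))) \<longlongrightarrow> 1 / (2 * (1 + \<kappa> + 0))) (at_right 0)"
    using k0 by (intro tendsto_intros) auto
  moreover have "\<forall>\<^sub>F \<delta> in at_right 0. 1 / (2 * (1 + \<kappa> + \<delta>)) \<le> (q \<delta> - 1) / \<delta> * g"
    unfolding eventually_at_right_field
  proof (intro exI[of _ 1] conjI allI impI)
    fix \<delta> :: real assume \<delta>: "0 < \<delta>"
    have "(1 - s \<delta>) / 2 = \<delta> * (1 / (2 * (1 + \<kappa> + \<delta>)))"
      using \<kappa> \<delta> by (simp add: s_def divide_simps)
    with step[OF \<delta>] show "1 / (2 * (1 + \<kappa> + \<delta>)) \<le> (q \<delta> - 1) / \<delta> * g"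
      using \<delta> by (simp add: pos_le_divide_eq mult.commute)
  qed simp
  ultimately have "1 / (2 * (1 + \<kappa> + 0)) \<le> 0 * g"
    by (intro tendsto_le[OF trivial_limit_at_right_real])
  then show False using \<kappa> by (simp add: divide_le_0_iff)
qed

text \<open>Two splittings link \<open>(1, -1)\<close> to the origin: in time,
  \<open>(0, -1)\<close> is a mean of \<open>(1, -1)\<close> and the cone point
  \<open>(-\<kappa>, -1)\<close>; in space, the origin is the midpoint of \<open>(0, -1)\<close> and
  \<open>(0, 1)\<close>. The last point costs less than \<open>d\<close>, whence the threshold
  \<open>- d / s\<close> for \<open>c\<close>.\<close>

lemma staircase:
  fixes \<kappa> p :: real
  assumes \<kappa>: "0 < \<kappa>" and p: "p = 2 / (1 + \<kappa>)"
    and F: "continuous_on UNIV (\<lambda>z. F (fst z) (snd z))"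
    and hom: "\<And>s x y. 0 < s \<Longrightarrow> F (s * x) (s * y) = s powr p * F x y"
    and cone1: "F (-\<kappa>) (-1) \<le> - 1" and cone2: "\<And>x. 0 < x \<Longrightarrow> F x (\<kappa> * x) < 0"
  shows "attains F 0 0 0"
proof -
  define d where "d = \<bar>F 0 1\<bar> + 1"
  define s where "s = \<kappa> / (1 + \<kappa>)"
  have s: "0 < s" "s < 1" using \<kappa> by (auto simp: s_def)
  obtain c where c: "c < - d / s" "attains F 1 (-1) c"
    using staircase_unbounded[OF assms] by blast
  have e: "s * 1 + (1 - s) * (-\<kappa>) = 0" using \<kappa> by (simp add: s_def divide_simps)
  have "F (-\<kappa>) (-1) < 0" using cone1 by simp
  from attains_t[OF F c(2) this s]
  have "attains F 0 (-1) (s * c)" unfolding e by simp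
  moreover have "F 0 1 < d" by (simp add: d_def)
  ultimately have "attains F 0 ((1/2) * -1 + (1 - 1/2) * 1) ((1/2) * (s * c) + (1 - 1/2) * d)"
    by (intro attains_x[OF F]) auto
  moreover have "s * c < - d" using mult_strict_left_mono[OF c(1) s(1)] s(1) by simp
  ultimately show ?thesis by (intro attains_mono[of F 0 0 "(1/2) * (s * c) + (1 - 1/2) * d" 0]) auto
qed

section \<open>The optimal coefficient and the resulting energy density\<close>

definition cone_proj :: "real \<Rightarrow> real \<Rightarrow> real \<Rightarrow> real" where
  "cone_proj \<kappa> x y = max (min (\<kappa> * y) (y / \<kappa>)) (min (max (\<kappa> * y) (y / \<kappa>)) x)"

text \<open>\<open>cone_proj \<kappa> x y\<close> is the point nearest to \<open>x\<close> between
  \<open>\<kappa> * y\<close> and \<open>y / \<kappa>\<close>, whose order is reversed for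
  \<open>y < 0\<close>. The quotient is thus the admissible value of \<open>a\<close> that minimizes
  \<open>\<bar>x - a * y\<bar>\<close>. For \<open>y = 0\<close> every value is optimal, and
  \<open>1\<close> is admissible.\<close>

definition coefficient :: "real \<Rightarrow> real \<Rightarrow> real \<Rightarrow> real" where
  "coefficient \<kappa> x y = (if y = 0 then 1 else cone_proj \<kappa> x y / y)"

lemma cone_proj_0 [simp]: "cone_proj \<kappa> x 0 = 0"
  by (simp add: cone_proj_def)

lemma coefficient_mult: "coefficient \<kappa> x y * y = cone_proj \<kappa> x y"
  by (simp add: coefficient_def)

lemma coefficient_bounds:
  assumes "0 < \<kappa>" "\<kappa> < 1"
  shows "\<kappa> \<le> coefficient \<kappa> x y" "coefficient \<kappa> x y \<le> 1 / \<kappa>"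
proof -
  have k: "\<kappa> \<le> 1 / \<kappa>" "\<kappa> \<le> 1" "1 \<le> 1 / \<kappa>"
    using assms mult_mono[of \<kappa> 1 \<kappa> 1] by (auto simp: pos_le_divide_eq)
  have le: "\<kappa> * y \<le> y / \<kappa>" if "y > 0"
    using mult_right_mono[OF k(1), of y] that by simp
  have ge: "y / \<kappa> \<le> \<kappa> * y" if "y < 0"
    using mult_right_mono_neg[OF k(1), of y] that by simp
  have pos: "\<kappa> * y \<le> cone_proj \<kappa> x y" "cone_proj \<kappa> x y \<le> y / \<kappa>" if "y > 0"
    using le[OF that] by (auto simp: cone_proj_def)
  have neg: "y / \<kappa> \<le> cone_proj \<kappa> x y" "cone_proj \<kappa> x y \<le> \<kappa> * y" if "y < 0"
    using ge[OF that] by (auto simp: cone_proj_def)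
  have "\<kappa> \<le> coefficient \<kappa> x y \<and> coefficient \<kappa> x y \<le> 1 / \<kappa>"
  proof (cases y "0 :: real" rule: linorder_cases)
    case less
    then show ?thesis using neg[OF less]
      by (simp add: coefficient_def neg_le_divide_eq neg_divide_le_eq mult.commute)
  next
    case equal
    then show ?thesis using k by (simp add: coefficient_def)
  next
    case greater
    then show ?thesis using pos[OF greater]
      by (simp add: coefficient_def pos_le_divide_eq pos_divide_le_eq mult.commute)
  qed
  then show "\<kappa> \<le> coefficient \<kappa> x y" "coefficient \<kappa> x y \<le> 1 / \<kappa>" by blast+
qed

text \<open>With the optimal coefficient this integrates to \<open>M\<close> times the integral of
  \<open>\<bar>f\<bar> powr p\<close> minus that of \<open>\<bar>u_xx\<bar> powr p\<close>, so for
  \<open>M \<ge> 0\<close> a negative energy refutes the estimate with constant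
  \<open>M powr (1 / p)\<close>.\<close>

definition defect_density :: "real \<Rightarrow> real \<Rightarrow> real \<Rightarrow> real \<Rightarrow> real \<Rightarrow> real" where
  "defect_density \<kappa> p M x y = M * \<bar>x - cone_proj \<kappa> x y\<bar> powr p - \<bar>y\<bar> powr p"

lemma continuous_cone_proj:
  assumes "\<kappa> \<noteq> 0"
  shows "continuous_on UNIV (\<lambda>z. cone_proj \<kappa> (fst z) (snd z))"
  unfolding cone_proj_def using assms by (intro continuous_intros) auto

lemma cone_proj_scale: "0 < s \<Longrightarrow> cone_proj \<kappa> (s * x) (s * y) = s * cone_proj \<kappa> x y"
  unfolding cone_proj_def
  by (simp add: max_mult_distrib_left min_mult_distrib_left mult.left_commute)

text \<open>The peeled-off points lie on the two edges \<open>x = \<kappa> * y\<close> and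
  \<open>x = y / \<kappa>\<close> of the cone. The defect vanishes there, so only the negative term
  remains, whatever \<open>M\<close> is.\<close>

lemma attains_defect:
  assumes \<kappa>: "0 < \<kappa>" "\<kappa> < 1" and p: "p = 2 / (1 + \<kappa>)"
  shows "attains (defect_density \<kappa> p M) 0 0 0"
    "continuous_on UNIV (\<lambda>z. defect_density \<kappa> p M (fst z) (snd z))"
proof -
  have p0: "p > 0" using \<kappa> by (simp add: p)
  show c: "continuous_on UNIV (\<lambda>z. defect_density \<kappa> p M (fst z) (snd z))"
    unfolding defect_density_def using p0 \<kappa>
    by (intro continuous_intros continuous_on_powr' continuous_cone_proj) auto
  have \<kappa>1: "\<kappa> * \<kappa> < 1" using \<kappa> mult_strict_mono[of \<kappa> 1 \<kappa> 1] by simp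
  show "attains (defect_density \<kappa> p M) 0 0 0"
  proof (rule staircase[OF \<kappa>(1) p c])
    show "defect_density \<kappa> p M (s * x) (s * y) = s powr p * defect_density \<kappa> p M x y" if "0 < s" for s x y
    proof -
      have "s * x - s * cone_proj \<kappa> x y = s * (x - cone_proj \<kappa> x y)" by (simp add: algebra_simps)
      then show ?thesis
        using that unfolding defect_density_def cone_proj_scale[OF that]
        by (simp only: abs_mult) (simp add: powr_mult right_diff_distrib mult.left_commute)
    qed
    have "cone_proj \<kappa> (-\<kappa>) (-1) = -\<kappa>"
      using \<kappa> \<kappa>1 by (auto simp: cone_proj_def max_def min_def field_simps)
    then show "defect_density \<kappa> p M (-\<kappa>) (-1) \<le> -1" by (simp add: defect_density_def)
    show "defect_density \<kappa> p M x (\<kappa> * x) < 0" if "0 < x" for x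
    proof -
      have "\<kappa> * (\<kappa> * x) \<le> x" using mult_right_mono[of "\<kappa> * \<kappa>" 1 x] \<kappa>1 that by (simp add: mult.assoc)
      then have "cone_proj \<kappa> x (\<kappa> * x) = x" using \<kappa> by (simp add: cone_proj_def)
      then show ?thesis using that \<kappa> by (simp add: defect_density_def)
    qed
  qed
qed



section \<open>One bad function per strip, and the conclusion\<close>

lemma zero_off_closed:
  assumes "closed C" "\<And>z. z \<notin> C \<Longrightarrow> u z = 0" "z \<notin> C"
  shows "dt u z = 0" "dx (dx u) z = 0"
proof -
  show "dt u z = 0" by (rule dt_dx_zero(1)[OF assms])
  have "\<And>z. z \<notin> C \<Longrightarrow> dx u z = 0" by (rule dt_dx_zero(2)[OF assms(1,2)])
  from dt_dx_zero(2)[OF assms(1) this assms(3)] show "dx (dx u) z = 0" .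
qed

text \<open>The index \<open>j\<close> is both the number of the strip and the constant in the
  violated inequality. Translation in \<open>x\<close> carries a function supported inside the unit
  cell to its strip without changing the integrals.\<close>

lemma strip_counterexample:
  fixes \<kappa> p :: real and j :: nat
  assumes \<kappa>: "0 < \<kappa>" "\<kappa> < 1" and p: "p = 2 / (1 + \<kappa>)"
  obtains u C where "Ck 2 u" "closed C" "bounded C" "C \<subseteq> {0<..<1} \<times> {real j<..<real j + 1}"
    "\<And>z. z \<notin> C \<Longrightarrow> u z = 0"
    "real j * (LINT z|lborel. \<bar>dt u z - cone_proj \<kappa> (dt u z) (dx (dx u) z)\<bar> powr p) <
      (LINT z|lborel. \<bar>dx (dx u) z\<bar> powr p)"
proof -
  have p0: "p > 0" using \<kappa> by (simp add: p)
  let ?F = "defect_density \<kappa> p (real j)"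
  obtain v \<epsilon> where \<epsilon>: "\<epsilon> > 0" and v: "Ck 2 v" and v0: "\<And>z. z \<notin> {\<epsilon>..1-\<epsilon>} \<times> {\<epsilon>..1-\<epsilon>} \<Longrightarrow> v z = 0"
    and en: "energy ?F 0 0 v < 0"
    by (rule attains_csupp[OF attains_defect(2)[OF assms] attains_defect(1)[OF assms]]) (rule that; assumption)
  define u where "u = (\<lambda>z. v (1 * fst z + 0, 1 * snd z + (- real j)))"
  have u: "Ck 2 u" unfolding u_def by (rule Ck_affine[OF v])
  have du: "dt u = (\<lambda>z. dt v (fst z, snd z - real j))" "dx (dx u) = (\<lambda>z. dx (dx v) (fst z, snd z - real j))"
  proof -
    show "dt u = (\<lambda>z. dt v (fst z, snd z - real j))"
      unfolding u_def dt_affine[OF Ck2D(2)[OF v]] by simp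
    have "dx u = (\<lambda>z. dx v (1 * fst z + 0, 1 * snd z + (- real j)))"
      unfolding u_def dx_affine[OF Ck2D(2)[OF v]] by simp
    then show "dx (dx u) = (\<lambda>z. dx (dx v) (fst z, snd z - real j))"
      using dx_affine[OF Ck1D(1)[OF Ck2D(4)[OF v]], of 1 0 1 "- real j"] by simp
  qed
  define C where "C = {\<epsilon>..1-\<epsilon>} \<times> {real j + \<epsilon>..real j + 1 - \<epsilon>}"
  have C: "closed C" "bounded C" "C \<subseteq> {0<..<1} \<times> {real j<..<real j + 1}"
    using \<epsilon> by (auto simp: C_def intro!: closed_Times bounded_Times)
  have u0: "u z = 0" if "z \<notin> C" for z
    unfolding u_def using that by (intro v0) (auto simp: C_def mem_Times_iff)
  define D where "D = (\<lambda>z. \<bar>dt u z - cone_proj \<kappa> (dt u z) (dx (dx u) z)\<bar> powr p)"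
  define X where "X = (\<lambda>z. \<bar>dx (dx u) z\<bar> powr p)"
  have c: "continuous_on UNIV (dt u)" "continuous_on UNIV (dx (dx u))"
    by (rule Ck1D(3)[OF Ck2D(1)[OF u]], rule Ck1D(4)[OF Ck2D(4)[OF u]])
  have cp: "continuous_on UNIV (\<lambda>z. cone_proj \<kappa> (dt u z) (dx (dx u) z))"
    using continuous_on_compose2[OF continuous_cone_proj[of \<kappa>] continuous_on_Pair[OF c]] \<kappa> by simp
  have zero: "dt u z = 0" "dx (dx u) z = 0" if "z \<notin> C" for z
    by (rule zero_off_closed[OF C(1) u0 that], assumption)+
  have DX: "integrable lborel D" "integrable lborel X"
  proof -
    obtain R where R: "\<forall>z\<in>C. norm z \<le> R" using C(2) by (auto simp: bounded_iff)
    have "D z = 0" "X z = 0" if "z \<notin> C" for z using zero[OF that] by (simp_all add: D_def X_def)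
    then have "csupp D" "csupp X" using R unfolding csupp_def by blast+
    moreover have "continuous_on UNIV D" "continuous_on UNIV X"
      unfolding D_def X_def using p0 by (auto intro!: continuous_intros continuous_on_powr' c cp)
    ultimately show "integrable lborel D" "integrable lborel X" by (blast intro: csupp_integrable)+
  qed
  define E where "E = (\<lambda>z. ?F (dt v z) (dx (dx v) z))"
  have E0: "E z = 0" if "z \<notin> cell" for z
  proof -
    have cl: "closed ({\<epsilon>..1-\<epsilon>} \<times> {\<epsilon>..1-\<epsilon>})" by (intro closed_Times) auto
    have "z \<notin> {\<epsilon>..1-\<epsilon>} \<times> {\<epsilon>..1-\<epsilon>}" using that \<epsilon> by (auto simp: mem_Times_iff)
    from zero_off_closed[OF cl v0 this] show ?thesis
      by (simp add: E_def defect_density_def)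
  qed
  have "(LINT z|lborel. E z) = energy ?F 0 0 v"
    unfolding energy_def set_lebesgue_integral_def
    by (intro Bochner_Integration.integral_cong refl) (use E0 in \<open>auto simp: E_def indicator_def\<close>)
  moreover have "(LINT z|lborel. E (fst z, snd z - real j)) = (LINT z|lborel. E z)"
  proof (rule lborel_integral_shift_snd)
    have "continuous_on UNIV E"
      using continuous_energy_density[OF attains_defect(2)[OF assms] v, of "real j" 0 0] by (simp add: E_def)
    then show "E \<in> borel_measurable borel" by (rule borel_measurable_continuous_onI)
  qed
  moreover have "(LINT z|lborel. E (fst z, snd z - real j)) = real j * (LINT z|lborel. D z) - (LINT z|lborel. X z)"
    using DX by (simp add: E_def D_def X_def defect_density_def du)
  ultimately show ?thesis
    using en by (intro that[OF u C u0]) (simp_all add: D_def X_def)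
qed

text \<open>\<open>ennreal\<close> sends a negative \<open>N\<close> to zero, so the comparison is
  with \<open>max N 0\<close>. Raising to the power \<open>p\<close> turns the inequality of norms
  into one of integrals.\<close>

lemma powr_gap:
  fixes N X Y :: real
  assumes "real j \<ge> (max N 0) powr p" "p > 0" "real j * Y < X" "Y \<ge> 0"
  shows "\<not> ennreal (X powr (1 / p)) \<le> ennreal N * ennreal (Y powr (1 / p))"
proof
  assume le: "ennreal (X powr (1 / p)) \<le> ennreal N * ennreal (Y powr (1 / p))"
  have "ennreal N = ennreal (max N 0)"
    by (cases "N \<ge> 0") (simp_all only: max_absorb1 max_absorb2 ennreal_neg not_le less_imp_le ennreal_0)
  then have "ennreal N * ennreal (Y powr (1 / p)) = ennreal (max N 0 * Y powr (1 / p))"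
    by (simp only: ennreal_mult max.cobounded2 powr_ge_zero)
  with le have "ennreal (X powr (1 / p)) \<le> ennreal (max N 0 * Y powr (1 / p))"
    by (simp only:)
  then have "X powr (1 / p) \<le> max N 0 * Y powr (1 / p)" by (simp add: ennreal_le_iff)
  then have "(X powr (1 / p)) powr p \<le> (max N 0 * Y powr (1 / p)) powr p"
    using assms(2) by (intro powr_mono2) auto
  moreover have "X > 0" using assms(3,4) by (meson le_less_trans mult_nonneg_nonneg of_nat_0_le_iff)
  ultimately have "X \<le> max N 0 powr p * Y"
    using assms(2,4) by (simp add: powr_mult powr_powr)
  also have "\<dots> \<le> real j * Y" using assms(1,4) by (rule mult_right_mono)
  finally show False using assms(3) by simp
qed

theorem theorem2p4:
  fixes \<kappa> p :: real
  assumes "0 < \<kappa>" and "\<kappa> < 1" and "p = 2 / (1 + \<kappa>)"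
  shows "\<exists>a :: real \<times> real \<Rightarrow> real.
    a \<in> borel_measurable (restrict_space borel Q) \<and>
    (\<forall>z\<in>Q. \<kappa> \<le> a z \<and> a z \<le> 1 / \<kappa>) \<and>
    \<not> (\<exists>N :: real. \<forall>f \<in> Lp_space 2 MQ \<inter> Lp_space p MQ. \<forall>u ut ux uxx.
         strong_solution a f u ut ux uxx \<longrightarrow>
         Lp_norm p MQ ut + Lp_norm p MQ uxx \<le> ennreal N * Lp_norm p MQ f) \<and>
    \<not> (\<exists>N :: real. \<forall>f \<in> Lp_space 2 MQ \<inter> Lp_space p MQ. \<forall>v vx.
         weak_solution a f v vx \<longrightarrow>
         Lp_norm p MQ vx \<le> ennreal N * Lp_norm p MQ f)"
proof -
  have p0: "p > 0" using assms by simp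
  define good where "good j u C \<longleftrightarrow> Ck 2 u \<and> closed C \<and> bounded C \<and> C \<subseteq> {0<..<1} \<times> {real j<..<real j + 1} \<and>
    (\<forall>z. z \<notin> C \<longrightarrow> u z = 0) \<and>
    real j * (LINT z|lborel. \<bar>dt u z - cone_proj \<kappa> (dt u z) (dx (dx u) z)\<bar> powr p) <
      (LINT z|lborel. \<bar>dx (dx u) z\<bar> powr p)" for j u and C :: "(real \<times> real) set"
  have "\<exists>u C. good j u C" for j
    by (rule strip_counterexample[OF assms, of j]) (unfold good_def, blast)
  then obtain u C where "\<And>j. good j (u j) (C j)" by metis
  then have u: "Ck 2 (u j)" and C: "closed (C j)" "bounded (C j)" "C j \<subseteq> {0<..<1} \<times> {real j<..<real j + 1}"
    and u0: "\<And>z. z \<notin> C j \<Longrightarrow> u j z = 0"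
    and gap: "real j * (LINT z|lborel. \<bar>dt (u j) z - cone_proj \<kappa> (dt (u j) z) (dx (dx (u j)) z)\<bar> powr p) <
      (LINT z|lborel. \<bar>dx (dx (u j)) z\<bar> powr p)" for j
    unfolding good_def by blast+
  \<comment> \<open>The strip index is the integer part of \<open>x\<close>, written in the shape of
    \<open>measurable_compose_countable\<close>. Negative \<open>x\<close> gets index 0; there the
    derivatives of \<open>u 0\<close> vanish and the coefficient is 1.\<close>
  define a where "a = (\<lambda>z. (\<lambda>j z. coefficient \<kappa> (dt (u j) z) (dx (dx (u j)) z)) (nat \<lfloor>snd z\<rfloor>) z)"
  have cont: "continuous_on UNIV (dt (u j))" "continuous_on UNIV (dx (dx (u j)))" for j
    by (rule Ck1D(3)[OF Ck2D(1)[OF u]], rule Ck1D(4)[OF Ck2D(4)[OF u]])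
  have am: "a \<in> borel_measurable borel"
    unfolding a_def
  proof (rule measurable_compose_countable)
    fix j
    have [measurable]: "dt (u j) \<in> borel_measurable borel" "dx (dx (u j)) \<in> borel_measurable borel"
      by (intro borel_measurable_continuous_onI cont)+
    show "(\<lambda>z. coefficient \<kappa> (dt (u j) z) (dx (dx (u j)) z)) \<in> borel_measurable borel"
      unfolding coefficient_def cone_proj_def by measurable
  next
    show "(\<lambda>z::real \<times> real. nat \<lfloor>snd z\<rfloor>) \<in> measurable borel (count_space UNIV)"
    proof (rule measurable_compose[where f = snd and g = "\<lambda>x. nat \<lfloor>x\<rfloor>"])
      show "(snd :: real \<times> real \<Rightarrow> real) \<in> borel_measurable borel"
        by (intro borel_measurable_continuous_onI continuous_on_snd continuous_on_id)
    qed measurable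
  qed
  have ab: "\<kappa> \<le> a z" "a z \<le> 1 / \<kappa>" for z
    unfolding a_def by (rule coefficient_bounds[OF assms(1,2)])+
  have aK: "\<bar>a z\<bar> \<le> 1 / \<kappa>" for z using ab[of z] assms(1) by simp
  define f where "f j = (\<lambda>z. dt (u j) z - a z * dx (dx (u j)) z)" for j
  have zero: "dt (u j) z = 0" "dx (dx (u j)) z = 0" if "z \<notin> C j" for j z
    by (rule zero_off_closed[OF C(1) u0 that], assumption)+
  \<comment> \<open>On its own strip \<open>a\<close> is the optimal coefficient for
    \<open>u j\<close>; off \<open>C j\<close> both derivatives are zero, so the coefficient does
    not matter.\<close>
  have f_eq: "f j = (\<lambda>z. dt (u j) z - cone_proj \<kappa> (dt (u j) z) (dx (dx (u j)) z))" for j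
  proof
    fix z
    show "f j z = dt (u j) z - cone_proj \<kappa> (dt (u j) z) (dx (dx (u j)) z)"
    proof (cases "z \<in> C j")
      case True
      then have "real j < snd z" "snd z < real j + 1" using C(3)[of j] by (auto simp: subset_eq)
      then have "nat \<lfloor>snd z\<rfloor> = j" by (simp add: floor_eq_iff nat_eq_iff less_imp_le)
      then show ?thesis by (simp add: f_def a_def coefficient_mult)
    next
      case False
      then show ?thesis by (simp add: f_def zero)
    qed
  qed
  have CQ: "C j \<subseteq> Q" for j using C(3)[of j] by (auto simp: Q_def)
  have cs: "csupp h" if "\<And>z. z \<notin> C j \<Longrightarrow> h z = 0" for h :: "real \<times> real \<Rightarrow> real" and j
  proof -
    obtain R where "\<forall>z\<in>C j. norm z \<le> R" using C(2)[of j] by (auto simp: bounded_iff)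
    then show ?thesis using that unfolding csupp_def by blast
  qed
  have fC: "f j z = 0" if "z \<notin> C j" for j z using zero[OF that] by (simp add: f_def)
  have fc: "continuous_on UNIV (f j)" for j
  proof -
    have "continuous_on UNIV (\<lambda>z. cone_proj \<kappa> (dt (u j) z) (dx (dx (u j)) z))"
      using continuous_on_compose2[OF continuous_cone_proj[of \<kappa>] continuous_on_Pair[OF cont]] assms(1) by simp
    then show ?thesis unfolding f_eq by (intro continuous_intros cont)
  qed
  have fL: "f j \<in> Lp_space 2 MQ \<inter> Lp_space p MQ" for j
    using csupp_Lp_space[OF fc cs[OF fC]] p0 by auto
  have sol: "strong_solution a (f j) (u j) (dt (u j)) (dx (u j)) (dx (dx (u j)))"
    "weak_solution a (f j) (dx (u j)) (dx (dx (u j)))" for j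
    by (rule smooth_solutions[OF u cs[OF u0] C(1) CQ u0 am aK f_def], assumption+)+
  have norm: "Lp_norm p MQ h = ennreal ((LINT z|lborel. \<bar>h z\<bar> powr p) powr (1 / p))"
    if "continuous_on UNIV h" "\<And>z. z \<notin> C j \<Longrightarrow> h z = 0" for h j
  proof (rule Lp_norm_MQ_eq)
    note hs = cs[OF that(2)]
    obtain B where "\<And>z. norm (h z) \<le> B" using csupp_bounded[OF \<open>continuous_on UNIV h\<close> hs] by metis
    then show "integrable lborel (\<lambda>z. \<bar>h z\<bar> powr p)"
      using that(1) hs p0
      by (intro csupp_powr_integrable[where B = B]) (auto intro: borel_measurable_continuous_onI)
    show "h z = 0" if "z \<notin> Q" for z using \<open>\<And>z. z \<notin> C j \<Longrightarrow> h z = 0\<close>[of z] CQ[of j] that by blast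
  qed (use that(1) in \<open>rule borel_measurable_continuous_onI\<close>)
  have key: "\<exists>j. \<not> Lp_norm p MQ (dx (dx (u j))) \<le> ennreal N * Lp_norm p MQ (f j)" for N
  proof -
    \<comment> \<open>The function in strip \<open>j\<close> defeats every constant whose
      \<open>p\<close>-th power is at most \<open>j\<close>.\<close>
    obtain j :: nat where j: "real j \<ge> (max N 0) powr p" using real_arch_simple by blast
    have n: "Lp_norm p MQ (dx (dx (u j))) = ennreal ((LINT z|lborel. \<bar>dx (dx (u j)) z\<bar> powr p) powr (1 / p))"
      "Lp_norm p MQ (f j) = ennreal ((LINT z|lborel. \<bar>f j z\<bar> powr p) powr (1 / p))"
      by (rule norm[OF cont(2)], erule zero, rule norm[OF fc], erule fC)
    have "\<not> Lp_norm p MQ (dx (dx (u j))) \<le> ennreal N * Lp_norm p MQ (f j)"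
      unfolding n
    proof (rule powr_gap[OF j p0])
      show "real j * (LINT z|lborel. \<bar>f j z\<bar> powr p) < (LINT z|lborel. \<bar>dx (dx (u j)) z\<bar> powr p)"
        unfolding f_eq by (rule gap)
    qed simp
    then show ?thesis by blast
  qed
  show ?thesis
  proof (intro exI[of _ a] conjI)
    show "a \<in> borel_measurable (restrict_space borel Q)"
      using am by (rule measurable_restrict_space1)
    show "\<forall>z\<in>Q. \<kappa> \<le> a z \<and> a z \<le> 1 / \<kappa>" using ab by blast
    show "\<not> (\<exists>N :: real. \<forall>f \<in> Lp_space 2 MQ \<inter> Lp_space p MQ. \<forall>u ut ux uxx.
         strong_solution a f u ut ux uxx \<longrightarrow>
         Lp_norm p MQ ut + Lp_norm p MQ uxx \<le> ennreal N * Lp_norm p MQ f)"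
    proof
      assume "\<exists>N :: real. \<forall>f \<in> Lp_space 2 MQ \<inter> Lp_space p MQ. \<forall>u ut ux uxx.
         strong_solution a f u ut ux uxx \<longrightarrow>
         Lp_norm p MQ ut + Lp_norm p MQ uxx \<le> ennreal N * Lp_norm p MQ f"
      then obtain N :: real where N: "\<And>j. Lp_norm p MQ (dt (u j)) + Lp_norm p MQ (dx (dx (u j))) \<le>
          ennreal N * Lp_norm p MQ (f j)"
        using fL sol(1) by metis
      \<comment> \<open>The term with \<open>u_xx\<close> alone already violates the bound.\<close>
      have "Lp_norm p MQ (dx (dx (u j))) \<le> ennreal N * Lp_norm p MQ (f j)" for j
        by (rule order_trans[OF _ N]) simp
      with key[of N] show False by blast
    qed
    show "\<not> (\<exists>N :: real. \<forall>f \<in> Lp_space 2 MQ \<inter> Lp_space p MQ. \<forall>v vx.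
         weak_solution a f v vx \<longrightarrow>
         Lp_norm p MQ vx \<le> ennreal N * Lp_norm p MQ f)"
      using key fL sol(2) by metis
  qed
qed

end
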